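(* Let $G$ be a 2-connected $\{K_{1,3},S\}$-$o$-heavy graph, where $S\in\{P_4,P_5,C_3,Z_1,Z_2,B,N,W\}$. Then $cl_c(G)$ is claw-free and $N$-$pq$-heavy.
   Context: All graphs are finite, simple and undirected; $n=|V(G)|$ and $d(v)$ denotes the degree of $v$ in $G$. A pair of nonadjacent vertices $\{u,v\}$ is an $o$-heavy pair if $d(u)+d(v)\ge n$; an adjacent pair $\{u,v\}$ with $d(u)+d(v)\ge n$ is an $a$-heavy pair; a vertex $u$ is heavy if $d(u)\ge n/2$. For a graph $H$, $G$ is $H$-$o$-heavy if every induced subgraph of $G$ isomorphic to $H$ contains an $o$-heavy pair of $G$; for a family $\mathcal H$, $G$ is $\mathcal H$-$o$-heavy if it is $H$-$o$-heavy for every $H\in\mathcal H$. $K_{1,3}$ is the claw; $P_k$ and $C_k$ are the path and cycle on $k$ vertices; $Z_k$ is obtained by identifying a vertex of a $C_3$ with an end-vertex of a $P_{k+1}$; $B$ (bull) is a triangle with a pendant edge attached at two of its vertices; $W$ (wounded) is a triangle with a pendant edge at one vertex and a pendant path of length two at another vertex; $N$ (net) is a triangle $a_1a_2a_3$ with pendant vertices $b_1,b_2,b_3$, where $b_i$ is adjacent only to $a_i$. An induced net of $G$ is $p$-heavy if its triangle contains an $a$-heavy pair of $G$; it is $q$-heavy if there is $i\in\{1,2,3\}$ such that $a_i,b_i$ are heavy in $G$, and for both $j\neq i$: $d(a_j)=3$, $d(b_j)=2$, and the neighbor of $b_j$ other than $a_j$ is heavy. $G$ is $N$-$pq$-heavy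 if every induced net of $G$ is $p$-heavy or $q$-heavy. $cl_c(G)$ is Čada's closure of a claw-$o$-heavy graph $G$: for $x\in V(G)$, let $G^{BC}_x$ be $G$ plus all edges $uv$ with $u,v\in N(x)$, $uv\notin E(G)$, $d(u)+d(v)\ge n$. A vertex $x$ is $c$-eligible if $N(x)$ is not a clique in $G^{BC}_x$ and either (i) $G^{BC}_x[N(x)]$ is connected, or (ii) $G^{BC}_x[N(x)]$ is the disjoint union of two cliques $C_1,C_2$ and $x$ lies in an $o$-heavy pair $\{x,z\}$ of $G$ with $zy_1,zy_2\in E(G)$ for some $y_1\in C_1$, $y_2\in C_2$. The local completion at a $c$-eligible $x$ adds all edges between vertices of $N(x)$; $cl_c(G)$ is obtained by repeating local completions at $c$-eligible vertices until none remain (it is uniquely determined, and equals the minimum $\{K_{1,3},\text{diamond}\}$-free spanning supergraph of $G$ with no $o$-heavy pair).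
   Formalization: A vertex x is taken to be c-eligible when N(x) is not a clique in G itself (not in G^BC_x, as the stated definition says); with the literal wording K_{3,3} would be its own closure and contain claws, so the claim would fail. *)

theory Defs
  imports "Graph_Theory.Graph_Theory"
begin

text \<open>
  A finite simple undirected graph is a \<^locale>\<open>pair_graph\<close>: a finite loopless digraph whose
  arc set is symmetric, so that the edge \<open>uv\<close> is the pair of arcs \<open>(u, v)\<close>, \<open>(v, u)\<close>.
\<close>

definition nbhd :: "'a pair_pre_digraph \<Rightarrow> 'a \<Rightarrow> 'a set" where
  "nbhd G v = {u. (v, u) \<in> parcs G}"

definition deg :: "'a pair_pre_digraph \<Rightarrow> 'a \<Rightarrow> nat" where
  "deg G v = card (nbhd G v)"

definition two_connected :: "'a pair_pre_digraph \<Rightarrow> bool" where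
  "two_connected G \<longleftrightarrow> card (pverts G) \<ge> 3 \<and> connected (with_proj G) \<and>
     (\<forall>v \<in> pverts G. connected (with_proj G \<restriction> (pverts G - {v})))"

definition clique :: "'a pair_pre_digraph \<Rightarrow> 'a set \<Rightarrow> bool" where
  "clique G C \<longleftrightarrow> C \<subseteq> pverts G \<and> (\<forall>u \<in> C. \<forall>v \<in> C. u \<noteq> v \<longrightarrow> (u, v) \<in> parcs G)"


section \<open>Heavy vertices and pairs\<close>

definition o_heavy_pair :: "'a pair_pre_digraph \<Rightarrow> 'a \<Rightarrow> 'a \<Rightarrow> bool" where
  "o_heavy_pair G u v \<longleftrightarrow> u \<in> pverts G \<and> v \<in> pverts G \<and> u \<noteq> v \<and> (u, v) \<notin> parcs G \<and>
     deg G u + deg G v \<ge> card (pverts G)"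

definition a_heavy_pair :: "'a pair_pre_digraph \<Rightarrow> 'a \<Rightarrow> 'a \<Rightarrow> bool" where
  "a_heavy_pair G u v \<longleftrightarrow> (u, v) \<in> parcs G \<and> deg G u + deg G v \<ge> card (pverts G)"

definition heavy :: "'a pair_pre_digraph \<Rightarrow> 'a \<Rightarrow> bool" where
  "heavy G u \<longleftrightarrow> u \<in> pverts G \<and> real (deg G u) \<ge> real (card (pverts G)) / 2"


section \<open>Induced copies of a graph\<close>

text \<open>
  The induced subgraphs of \<open>G\<close> isomorphic to \<open>H\<close> are those induced by the images of the
  embeddings below; see \<open>induced_copy_iff\<close> for the link with \<^const>\<open>digraph_iso\<close>.
\<close>

definition induced_embedding ::
  "'b pair_pre_digraph \<Rightarrow> 'a pair_pre_digraph \<Rightarrow> ('b \<Rightarrow> 'a) \<Rightarrow> bool" where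
  "induced_embedding H G f \<longleftrightarrow> inj_on f (pverts H) \<and> f ` pverts H \<subseteq> pverts G \<and>
     (\<forall>u \<in> pverts H. \<forall>v \<in> pverts H. (f u, f v) \<in> parcs G \<longleftrightarrow> (u, v) \<in> parcs H)"

definition induced_free :: "'b pair_pre_digraph \<Rightarrow> 'a pair_pre_digraph \<Rightarrow> bool" where
  "induced_free H G \<longleftrightarrow> \<not> (\<exists>f. induced_embedding H G f)"

definition o_heavy :: "'b pair_pre_digraph \<Rightarrow> 'a pair_pre_digraph \<Rightarrow> bool" where
  "o_heavy H G \<longleftrightarrow> (\<forall>f. induced_embedding H G f \<longrightarrow>
     (\<exists>u \<in> f ` pverts H. \<exists>v \<in> f ` pverts H. o_heavy_pair G u v))"

definition family_o_heavy :: "'b pair_pre_digraph set \<Rightarrow> 'a pair_pre_digraph \<Rightarrow> bool" where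
  "family_o_heavy \<H> G \<longleftrightarrow> (\<forall>H \<in> \<H>. o_heavy H G)"

lemma induced_copy_iff:
  assumes "pair_graph H" "pair_graph G" "A \<subseteq> pverts G"
  shows "digraph_iso (with_proj H) (with_proj G \<restriction> A) \<longleftrightarrow>
         (\<exists>f. induced_embedding H G f \<and> f ` pverts H = A)"
proof
  assume "digraph_iso (with_proj H) (with_proj G \<restriction> A)"
  then obtain h where h: "pre_digraph.digraph_isomorphism (with_proj H) h"
      and eq: "with_proj G \<restriction> A = app_iso h (with_proj H)"
    by (auto simp: digraph_iso_def)
  let ?f = "iso_verts h"
  have verts: "?f ` pverts H = A"
    using arg_cong[OF eq, of verts] by simp
  have tail: "iso_tail h = fst" and head: "iso_head h = snd"
    using arg_cong[OF eq, of tail] arg_cong[OF eq, of head] by simp_all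
  have arcs: "{e \<in> parcs G. fst e \<in> A \<and> snd e \<in> A} = iso_arcs h ` parcs H"
    using arg_cong[OF eq, of arcs] by (simp add: induce_subgraph_def)
  have on_arcs: "iso_arcs h (u, v) = (?f u, ?f v)" if "(u, v) \<in> parcs H" for u v
    using h that tail head
    by (auto simp: pre_digraph.digraph_isomorphism_def prod_eq_iff)
  have inj: "inj_on ?f (pverts H)"
    using h by (auto simp: pre_digraph.digraph_isomorphism_def)
  have "(?f u, ?f v) \<in> parcs G \<longleftrightarrow> (u, v) \<in> parcs H" if uv: "u \<in> pverts H" "v \<in> pverts H" for u v
  proof
    assume "(u, v) \<in> parcs H"
    then show "(?f u, ?f v) \<in> parcs G"
      using arcs on_arcs[of u v] by (metis (mono_tags, lifting) imageI mem_Collect_eq)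
  next
    assume "(?f u, ?f v) \<in> parcs G"
    then have "(?f u, ?f v) \<in> iso_arcs h ` parcs H"
      using arcs verts uv by auto
    then obtain u' v' where e: "(u', v') \<in> parcs H" "?f u = ?f u'" "?f v = ?f v'"
      using on_arcs by auto
    then have "u' \<in> pverts H" "v' \<in> pverts H"
      using assms(1) by (auto simp: pair_graph_def pair_digraph_def pair_fin_digraph_def
          dest: pair_wf_digraph.in_arcsD1 pair_wf_digraph.in_arcsD2)
    then show "(u, v) \<in> parcs H"
      using e uv inj by (metis inj_onD)
  qed
  then show "\<exists>f. induced_embedding H G f \<and> f ` pverts H = A"
    using inj verts assms(3) by (intro exI[of _ ?f]) (auto simp: induced_embedding_def)
next
  assume "\<exists>f. induced_embedding H G f \<and> f ` pverts H = A"
  then obtain f where f: "induced_embedding H G f" and A: "A = f ` pverts H"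
    by auto
  interpret H: pair_graph H by fact
  define h where "h = \<lparr> iso_verts = f, iso_arcs = map_prod f f, iso_head = snd, iso_tail = fst \<rparr>"
  have inj: "inj_on f (pverts H)"
    using f by (simp add: induced_embedding_def)
  have "inj_on (map_prod f f) (parcs H)"
    by (rule inj_on_subset[OF map_prod_inj_on[OF inj inj]]) (auto dest: H.in_arcsD1 H.in_arcsD2)
  then have "pre_digraph.digraph_isomorphism (with_proj H) h"
    using inj H.wf_digraph by (auto simp: pre_digraph.digraph_isomorphism_def h_def)
  moreover have "map_prod f f ` parcs H = {e \<in> parcs G. fst e \<in> A \<and> snd e \<in> A}"
  proof (intro equalityI subsetI)
    fix e assume "e \<in> map_prod f f ` parcs H"
    then obtain u v where "(u, v) \<in> parcs H" "e = (f u, f v)" by auto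
    then show "e \<in> {e \<in> parcs G. fst e \<in> A \<and> snd e \<in> A}"
      using f A H.in_arcsD1 H.in_arcsD2 by (auto simp: induced_embedding_def)
  next
    fix e assume "e \<in> {e \<in> parcs G. fst e \<in> A \<and> snd e \<in> A}"
    then obtain u v where "u \<in> pverts H" "v \<in> pverts H" "e = (f u, f v)" "(f u, f v) \<in> parcs G"
      using A by (cases e) auto
    then show "e \<in> map_prod f f ` parcs H"
      using f by (auto simp: induced_embedding_def intro!: image_eqI[where x = "(u, v)"])
  qed
  then have "with_proj G \<restriction> A = app_iso h (with_proj H)"
    using A by (simp add: induce_subgraph_def app_iso_def h_def)
  ultimately show "digraph_iso (with_proj H) (with_proj G \<restriction> A)"
    unfolding digraph_iso_def by blast
qed


section \<open>The particular graphs\<close>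

definition graph_on :: "nat \<Rightarrow> (nat \<times> nat) set \<Rightarrow> nat pair_pre_digraph" where
  "graph_on k E = \<lparr> pverts = {..<k}, parcs = E \<union> E\<inverse> \<rparr>"

definition path_graph :: "nat \<Rightarrow> nat pair_pre_digraph" where
  "path_graph k = graph_on k {(i, Suc i) | i. Suc i < k}"

text \<open>Meaningful for \<open>k \<ge> 3\<close> only.\<close>
definition cycle_graph :: "nat \<Rightarrow> nat pair_pre_digraph" where
  "cycle_graph k = graph_on k (insert (k - 1, 0) {(i, Suc i) | i. Suc i < k})"

definition claw_graph :: "nat pair_pre_digraph" where
  "claw_graph = graph_on 4 {(0, 1), (0, 2), (0, 3)}"

text \<open>The triangle is \<open>0, 1, 2\<close> and the attached path is \<open>2, 3, \<dots>, k + 2\<close>.\<close>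
definition Z_graph :: "nat \<Rightarrow> nat pair_pre_digraph" where
  "Z_graph k = graph_on (k + 3)
     ({(0, 1), (1, 2), (0, 2)} \<union> {(i, Suc i) | i. 2 \<le> i \<and> i < k + 2})"

definition bull_graph :: "nat pair_pre_digraph" where
  "bull_graph = graph_on 5 {(0, 1), (1, 2), (0, 2), (0, 3), (1, 4)}"

definition wounded_graph :: "nat pair_pre_digraph" where
  "wounded_graph = graph_on 6 {(0, 1), (1, 2), (0, 2), (0, 3), (1, 4), (4, 5)}"

definition net_graph :: "nat pair_pre_digraph" where
  "net_graph = graph_on 6 {(0, 1), (1, 2), (0, 2), (0, 3), (1, 4), (2, 5)}"


section \<open>Heavy nets\<close>

text \<open>
  For an embedding \<open>f\<close> of the net, the triangle is \<open>f 0, f 1, f 2\<close> and the pendant vertex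
  attached to \<open>f i\<close> is \<open>f (i + 3)\<close>.
\<close>

definition p_heavy_net :: "'a pair_pre_digraph \<Rightarrow> (nat \<Rightarrow> 'a) \<Rightarrow> bool" where
  "p_heavy_net G f \<longleftrightarrow> (\<exists>i < 3. \<exists>j < 3. a_heavy_pair G (f i) (f j))"

definition q_heavy_net :: "'a pair_pre_digraph \<Rightarrow> (nat \<Rightarrow> 'a) \<Rightarrow> bool" where
  "q_heavy_net G f \<longleftrightarrow> (\<exists>i < 3. heavy G (f i) \<and> heavy G (f (i + 3)) \<and>
     (\<forall>j < 3. j \<noteq> i \<longrightarrow> deg G (f j) = 3 \<and> deg G (f (j + 3)) = 2 \<and>
        (\<forall>w \<in> nbhd G (f (j + 3)) - {f j}. heavy G w)))"

definition N_pq_heavy :: "'a pair_pre_digraph \<Rightarrow> bool" where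
  "N_pq_heavy G \<longleftrightarrow> (\<forall>f. induced_embedding net_graph G f \<longrightarrow> p_heavy_net G f \<or> q_heavy_net G f)"


section \<open>The closure\<close>

definition bc_graph :: "'a pair_pre_digraph \<Rightarrow> 'a \<Rightarrow> 'a pair_pre_digraph" where
  "bc_graph G x =
     G \<lparr> parcs := parcs G \<union> {(u, v). u \<in> nbhd G x \<and> v \<in> nbhd G x \<and> o_heavy_pair G u v} \<rparr>"

definition disjoint_union_of_cliques ::
  "'a pair_pre_digraph \<Rightarrow> 'a set \<Rightarrow> 'a set \<Rightarrow> 'a set \<Rightarrow> bool" where
  "disjoint_union_of_cliques G A C\<^sub>1 C\<^sub>2 \<longleftrightarrow> A = C\<^sub>1 \<union> C\<^sub>2 \<and> C\<^sub>1 \<inter> C\<^sub>2 = {} \<and>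
     clique G C\<^sub>1 \<and> clique G C\<^sub>2 \<and> (\<forall>u \<in> C\<^sub>1. \<forall>v \<in> C\<^sub>2. (u, v) \<notin> parcs G)"

text \<open>
  The neighbourhood of an eligible vertex is required not to be a clique of \<open>G\<close> itself. Demanding
  instead that it is not a clique of \<^term>\<open>bc_graph G x\<close> would leave o-heavy pairs and claws
  behind: in \<open>K\<^sub>3\<^sub>,\<^sub>3\<close> no vertex would be eligible.
\<close>

definition c_eligible :: "'a pair_pre_digraph \<Rightarrow> 'a \<Rightarrow> bool" where
  "c_eligible G x \<longleftrightarrow> x \<in> pverts G \<and> \<not> clique G (nbhd G x) \<and>
     (connected (with_proj (bc_graph G x) \<restriction> nbhd G x) \<or>
      (\<exists>C\<^sub>1 C\<^sub>2. disjoint_union_of_cliques (bc_graph G x) (nbhd G x) C\<^sub>1 C\<^sub>2 \<and>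
         (\<exists>z. o_heavy_pair G x z \<and>
            (\<exists>y\<^sub>1 \<in> C\<^sub>1. \<exists>y\<^sub>2 \<in> C\<^sub>2. (z, y\<^sub>1) \<in> parcs G \<and> (z, y\<^sub>2) \<in> parcs G))))"

definition local_completion :: "'a pair_pre_digraph \<Rightarrow> 'a \<Rightarrow> 'a pair_pre_digraph" where
  "local_completion G x =
     G \<lparr> parcs := parcs G \<union> {(u, v). u \<in> nbhd G x \<and> v \<in> nbhd G x \<and> u \<noteq> v} \<rparr>"

definition completion_step :: "'a pair_pre_digraph \<Rightarrow> 'a pair_pre_digraph \<Rightarrow> bool" where
  "completion_step G H \<longleftrightarrow> (\<exists>x. c_eligible G x \<and> H = local_completion G x)"

text \<open>
  \<open>is_c_closure G H\<close> holds iff \<open>H\<close> is the outcome of a maximal sequence of local completions.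
  That all such sequences from a claw-o-heavy graph end in the same graph is not built in.
\<close>

definition is_c_closure :: "'a pair_pre_digraph \<Rightarrow> 'a pair_pre_digraph \<Rightarrow> bool" where
  "is_c_closure G H \<longleftrightarrow> completion_step\<^sup>*\<^sup>* G H \<and> \<not> (\<exists>x. c_eligible H x)"

lemma pair_graph_local_completion:
  assumes "pair_graph G"
  shows "pair_graph (local_completion G x)"
proof -
  interpret pair_graph G by fact
  have sub: "nbhd G x \<subseteq> pverts G"
    by (auto simp: nbhd_def dest: in_arcsD2)
  have "{(u, v). u \<in> nbhd G x \<and> v \<in> nbhd G x \<and> u \<noteq> v} \<subseteq> pverts G \<times> pverts G"
    using sub by auto
  then have fin: "finite {(u, v). u \<in> nbhd G x \<and> v \<in> nbhd G x \<and> u \<noteq> v}"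
    using pair_finite_verts finite_subset by blast
  show ?thesis
    using sub fin pair_finite_verts pair_finite_arcs
    by unfold_locales
      (auto simp: local_completion_def symmetric_def sym_def
        dest: in_arcsD1 in_arcsD2 no_loops' arcs_symmetric)
qed

lemma is_c_closure_exists:
  assumes "pair_graph G"
  shows "\<exists>H. is_c_closure G H"
  using assms
proof (induction "card (pverts G \<times> pverts G - parcs G)" arbitrary: G rule: less_induct)
  case less
  interpret pair_graph G by fact
  show ?case
  proof (cases "\<exists>x. c_eligible G x")
    case False
    then show ?thesis
      by (intro exI[of _ G]) (simp add: is_c_closure_def)
  next
    case True
    then obtain x where x: "c_eligible G x" by blast
    let ?G' = "local_completion G x"
    have sub: "nbhd G x \<subseteq> pverts G"
      by (auto simp: nbhd_def dest: in_arcsD2)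
    then obtain u v where uv: "u \<in> nbhd G x" "v \<in> nbhd G x" "u \<noteq> v" "(u, v) \<notin> parcs G"
      using x by (auto simp: c_eligible_def clique_def)
    have "pverts ?G' \<times> pverts ?G' - parcs ?G' \<subset> pverts G \<times> pverts G - parcs G"
      using uv sub by (auto simp: local_completion_def)
    then have "card (pverts ?G' \<times> pverts ?G' - parcs ?G') < card (pverts G \<times> pverts G - parcs G)"
      using pair_finite_verts by (intro psubset_card_mono) auto
    then obtain H where H: "is_c_closure ?G' H"
      using less.hyps pair_graph_local_completion[OF less.prems] by blast
    have "completion_step G ?G'"
      using x by (auto simp: completion_step_def)
    then show ?thesis
      using H by (meson converse_rtranclp_into_rtranclp is_c_closure_def)
  qed
qed

end

theory Submission
  imports Defs
begin

text \<open>
  A local completion keeps the graph claw-o-heavy, and a claw-o-heavy graph without eligible vertices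
  has no o-heavy pair; hence the closure \<open>H\<close> is claw-free and each of its neighbourhoods is a clique or
  the disjoint union of two cliques. Moreover any two vertices of a maximal clique of \<open>H\<close> are joined by a
  path of \<open>G\<close> whose inner vertices are simplicial vertices of that clique.

  Each \<open>S\<close> is an induced subgraph of the net or of the wounded graph, so \<open>G\<close> is \<open>N\<close>-o-heavy or
  \<open>W\<close>-o-heavy. Take an induced net of \<open>H\<close> that is not p-heavy. Joining the vertices of its triangle by
  paths of \<open>G\<close> through simplicial vertices gives a triangle of \<open>G\<close> with three attached paths that contains
  no o-heavy pair, and therefore an induced net without o-heavy pair: a contradiction if \<open>G\<close> is
  \<open>N\<close>-o-heavy. If \<open>G\<close> is \<open>W\<close>-o-heavy, the three paths cannot be extended, so the triangle lies in \<open>G\<close>.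
  Each \<open>a\<^sub>i\<close> lies in a second maximal clique \<open>K\<^sub>i\<close>, and at most one \<open>K\<^sub>i\<close> contains a vertex whose degree sum
  with \<open>a\<^sub>i\<close> is at least \<open>n\<close>. By 2-connectedness every \<open>K\<^sub>i\<close> has a further vertex with neighbours
  outside \<open>K\<^sub>i\<close>; following such edges produces induced wounded graphs without o-heavy pair unless
  exactly one \<open>K\<^sub>i\<close> is heavy, the other two are single edges \<open>a\<^sub>j b\<^sub>j\<close>, and each \<open>b\<^sub>j\<close> has its only other
  neighbour in the heavy clique. Counting then shows that the heavy clique has more than \<open>n / 2\<close> vertices,
  which makes the net q-heavy.
\<close>

section \<open>Nets in claw-free graphs with three leaves\<close>

text \<open>Each triangle vertex is followed by its pendant. For a symmetric irreflexive relation
  the listed adjacencies and non-adjacencies already make the six vertices distinct.\<close>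

definition is_net :: "('a \<Rightarrow> 'a \<Rightarrow> bool) \<Rightarrow> 'a \<Rightarrow> 'a \<Rightarrow> 'a \<Rightarrow> 'a \<Rightarrow> 'a \<Rightarrow> 'a \<Rightarrow> bool" where
  "is_net R a\<^sub>1 b\<^sub>1 a\<^sub>2 b\<^sub>2 a\<^sub>3 b\<^sub>3 \<longleftrightarrow>
     R a\<^sub>1 a\<^sub>2 \<and> R a\<^sub>1 a\<^sub>3 \<and> R a\<^sub>2 a\<^sub>3 \<and> R a\<^sub>1 b\<^sub>1 \<and> R a\<^sub>2 b\<^sub>2 \<and> R a\<^sub>3 b\<^sub>3 \<and>
     \<not> R a\<^sub>1 b\<^sub>2 \<and> \<not> R a\<^sub>1 b\<^sub>3 \<and> \<not> R a\<^sub>2 b\<^sub>1 \<and> \<not> R a\<^sub>2 b\<^sub>3 \<and> \<not> R a\<^sub>3 b\<^sub>1 \<and> \<not> R a\<^sub>3 b\<^sub>2 \<and>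
     \<not> R b\<^sub>1 b\<^sub>2 \<and> \<not> R b\<^sub>1 b\<^sub>3 \<and> \<not> R b\<^sub>2 b\<^sub>3"

definition is_wounded :: "('a \<Rightarrow> 'a \<Rightarrow> bool) \<Rightarrow> 'a \<Rightarrow> 'a \<Rightarrow> 'a \<Rightarrow> 'a \<Rightarrow> 'a \<Rightarrow> 'a \<Rightarrow> bool" where
  "is_wounded R a b c p q r \<longleftrightarrow>
     R a b \<and> R b c \<and> R a c \<and> R a p \<and> R b q \<and> R q r \<and>
     \<not> R a q \<and> \<not> R a r \<and> \<not> R b p \<and> \<not> R b r \<and> \<not> R c p \<and> \<not> R c q \<and> \<not> R c r \<and>
     \<not> R p q \<and> \<not> R p r"

text \<open>With \<open>k\<close> the least length of a walk into \<open>T\<close>, an earlier visit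
  to \<open>T\<close>, a forward chord or a repeated vertex would give a shorter walk.\<close>

lemma shortest_path_into:
  assumes "R\<^sup>*\<^sup>* a b" and "T b"
  obtains p :: "nat \<Rightarrow> 'a" and k where "p 0 = a" "T (p k)" "\<And>i. i < k \<Longrightarrow> R (p i) (p (Suc i))"
    "\<And>i. i < k \<Longrightarrow> \<not> T (p i)" "\<And>i j. i < j \<Longrightarrow> j \<le> k \<Longrightarrow> R (p i) (p j) \<Longrightarrow> j = Suc i"
    "\<And>i j. i < j \<Longrightarrow> j \<le> k \<Longrightarrow> p i \<noteq> p j"
proof -
  define P where "P k \<longleftrightarrow> (\<exists>c. T c \<and> (R ^^ k) a c)" for k
  define k where "k = (LEAST k. P k)"
  have ex: "\<exists>k. P k"
    using assms rtranclp_imp_relpowp unfolding P_def by metis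
  then have "P k"
    unfolding k_def by (metis LeastI)
  then obtain c where c: "T c" "(R ^^ k) a c"
    unfolding P_def by blast
  have min: "k \<le> l" if "T c" "(R ^^ l) a c" for l c
    unfolding k_def by (rule Least_le) (use that P_def in blast)
  obtain p where p: "p 0 = a" "p k = c" "\<And>i. i < k \<Longrightarrow> R (p i) (p (Suc i))"
    using c(2) unfolding relpowp_fun_conv by blast
  have part: "(R ^^ (j - i)) (p i) (p j)" if "i \<le> j" "j \<le> k" for i j
    unfolding relpowp_fun_conv
    by (rule exI[of _ "\<lambda>t. p (i + t)"]) (use that p(3) in auto)
  show thesis
  proof (rule that[of p k])
    show "p 0 = a" "T (p k)" "\<And>i. i < k \<Longrightarrow> R (p i) (p (Suc i))"
      using p c by auto
    show "\<not> T (p i)" if "i < k" for i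
      using min[of "p i" i] part[of 0 i] that p(1) by auto
    show "j = Suc i" if "i < j" "j \<le> k" "R (p i) (p j)" for i j
    proof -
      have "(R ^^ Suc i) a (p j)"
        using part[of 0 i] that p(1) by auto
      then have "(R ^^ (Suc i + (k - j))) a c"
        using part[of j k] that p(2) by (metis le_refl relpowp_trans)
      then have "k \<le> Suc i + (k - j)"
        using min c(1) by blast
      then show ?thesis
        using that by linarith
    qed
    show "p i \<noteq> p j" if "i < j" "j \<le> k" for i j
    proof
      assume "p i = p j"
      then have "(R ^^ (i + (k - j))) a c"
        using part[of 0 i] part[of j k] that p(1,2) relpowp_trans[of i R a "p i" "k - j" c] by simp
      then have "k \<le> i + (k - j)"
        using min c(1) by blast
      then show False
        using that by linarith
    qed
  qed
qed

text \<open>Let \<open>p\<close> be a shortest path from \<open>b\<^sub>1\<close> to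
  \<open>b\<^sub>2\<close>, and \<open>q\<close> one from \<open>b\<^sub>3\<close> to a vertex with
  a neighbour on \<open>p\<close>. Claw-freeness makes the end of \<open>q\<close> adjacent to
  exactly two consecutive vertices of \<open>p\<close>: a triangle with three tails. If all tails
  are single edges, the triangle is \<open>a\<^sub>1 a\<^sub>2 a\<^sub>3\<close>; a longer tail
  yields a wounded graph.\<close>

lemma claw_free_three_leaves:
  fixes E :: "'a \<Rightarrow> 'a \<Rightarrow> bool"
  assumes sym: "\<And>u v. E u v \<Longrightarrow> E v u" and irrefl: "\<And>u. \<not> E u u"
    and claw: "\<And>x u v w. {x, u, v, w} \<subseteq> Q \<Longrightarrow> E x u \<Longrightarrow> E x v \<Longrightarrow> E x w \<Longrightarrow>
      u \<noteq> v \<Longrightarrow> u \<noteq> w \<Longrightarrow> v \<noteq> w \<Longrightarrow> E u v \<or> E u w \<or> E v w"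
    and in_Q: "{b\<^sub>1, b\<^sub>2, b\<^sub>3} \<subseteq> Q" and dist: "b\<^sub>1 \<noteq> b\<^sub>2" "b\<^sub>1 \<noteq> b\<^sub>3" "b\<^sub>2 \<noteq> b\<^sub>3"
    and not_leaf: "a\<^sub>3 \<noteq> b\<^sub>1" "a\<^sub>3 \<noteq> b\<^sub>2"
    and leaf: "\<And>y. y \<in> Q \<Longrightarrow> E b\<^sub>1 y \<Longrightarrow> y = a\<^sub>1" "\<And>y. y \<in> Q \<Longrightarrow> E b\<^sub>2 y \<Longrightarrow> y = a\<^sub>2"
      "\<And>y. y \<in> Q \<Longrightarrow> E b\<^sub>3 y \<Longrightarrow> y = a\<^sub>3"
    and conn: "(\<lambda>u v. E u v \<and> u \<in> Q \<and> v \<in> Q)\<^sup>*\<^sup>* b\<^sub>1 b\<^sub>2" "(\<lambda>u v. E u v \<and> u \<in> Q \<and> v \<in> Q)\<^sup>*\<^sup>* b\<^sub>3 b\<^sub>1"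
  obtains (net) x x' y y' z z' where "{x, x', y, y', z, z'} \<subseteq> Q" "is_net E x x' y y' z z'"
      "E a\<^sub>1 a\<^sub>2 \<and> E a\<^sub>1 a\<^sub>3 \<and> E a\<^sub>2 a\<^sub>3 \<or>
       (\<exists>a b c p q r. {a, b, c, p, q, r} \<subseteq> Q \<and> is_wounded E a b c p q r)"
proof -
  let ?R = "\<lambda>u v. E u v \<and> u \<in> Q \<and> v \<in> Q"
  obtain p k where p: "p 0 = b\<^sub>1" "p k = b\<^sub>2" "\<And>i. i < k \<Longrightarrow> ?R (p i) (p (Suc i))"
    and p_ind: "\<And>i j. i < j \<Longrightarrow> j \<le> k \<Longrightarrow> ?R (p i) (p j) \<Longrightarrow> j = Suc i"
    and p_inj: "\<And>i j. i < j \<Longrightarrow> j \<le> k \<Longrightarrow> p i \<noteq> p j"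
    by (rule shortest_path_into[OF conn(1), of "\<lambda>x. x = b\<^sub>2"]) auto
  have k: "k > 0"
    using p(1,2) dist(1) by (metis gr0I)
  have pQ: "p i \<in> Q" if "i \<le> k" for i
  proof (cases "i = k")
    case True
    then show ?thesis using in_Q p(2) by auto
  next
    case False
    then show ?thesis using p(3)[of i] that by auto
  qed
  define near where "near x \<longleftrightarrow> x \<in> Q \<and> (\<exists>i\<le>k. E x (p i))" for x
  have "near b\<^sub>1"
    unfolding near_def using p_inj[of 0 1] p(3)[of 0] p(1) k
    by (metis One_nat_def Suc_leI)
  obtain q m where q: "q 0 = b\<^sub>3" "near (q m)" "\<And>i. i < m \<Longrightarrow> ?R (q i) (q (Suc i))"
    "\<And>i. i < m \<Longrightarrow> \<not> near (q i)"
    and q_ind: "\<And>i j. i < j \<Longrightarrow> j \<le> m \<Longrightarrow> ?R (q i) (q j) \<Longrightarrow> j = Suc i"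
    by (rule shortest_path_into[OF conn(2), of near]) (use \<open>near b\<^sub>1\<close> in auto)
  have qQ: "q i \<in> Q" if "i \<le> m" for i
    using that q(2) q(3)[of i] unfolding near_def by (cases "i = m") auto
  have far: "\<not> E (q j) (p i)" "\<not> E (p i) (q j)" if "j < m" "i \<le> k" for i j
    using q(4)[OF that(1)] qQ[of j] that sym unfolding near_def by auto
  have inner: "near (p i)" if "i \<le> k" for i
  proof (cases "i = k")
    case True
    then show ?thesis
      using p(3)[of "k - 1"] k sym pQ unfolding near_def
      by (metis Suc_pred' diff_le_self lessI order_refl)
  next
    case False
    then show ?thesis
      using p(3)[of i] that pQ unfolding near_def by (metis Suc_leI le_neq_implies_less)
  qed
  have b3: "b\<^sub>3 \<noteq> p j" if jk: "j \<le> k" for j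
  proof
    assume eq: "b\<^sub>3 = p j"
    then have "j \<noteq> 0" "j \<noteq> k"
      using p(1,2) dist by metis+
    then obtain h where j: "j = Suc h" "j < k" using jk by (cases j) auto
    have "p h = a\<^sub>3" "p (Suc j) = a\<^sub>3"
      using p(3)[of h] p(3)[of j] j eq leaf(3) sym by auto
    then show False using p_inj[of h "Suc j"] j by auto
  qed
  have q_not_p: "q m \<noteq> p j" if "j \<le> k" for j
  proof (cases m)
    case 0
    then show ?thesis using b3[OF that] q(1) by simp
  next
    case (Suc m')
    then show ?thesis using q(3)[of m'] far(1)[of m' j] that by auto
  qed
  \<comment> \<open>If \<open>m = 0\<close>, then \<open>a\<^sub>3\<close> is an inner vertex of
    \<open>p\<close> and forms a claw with \<open>b\<^sub>3\<close> and its two neighbours on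
    \<open>p\<close>.\<close>
  have m: "m > 0"
  proof (rule ccontr)
    assume "\<not> m > 0"
    then have "near b\<^sub>3" using q(1,2) by simp
    then obtain j where j: "j \<le> k" "E b\<^sub>3 (p j)" unfolding near_def by blast
    then have a3: "a\<^sub>3 = p j" using leaf(3) pQ by auto
    then have "j \<noteq> 0" "j \<noteq> k" using not_leaf p(1,2) by metis+
    then obtain h where j': "j = Suc h" "j < k" using j by (cases j) auto
    have "E (p j) (p h)" "E (p j) (p (Suc j))" "E (p j) b\<^sub>3"
      using p(3)[of h] p(3)[of j] j' j sym by auto
    moreover have "\<not> E (p h) (p (Suc j))"
      using p_ind[of h "Suc j"] j' pQ by auto
    moreover have "\<not> E (p h) b\<^sub>3"
      using leaf(3)[of "p h"] sym a3 p_inj[of h j] j' pQ by fastforce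
    moreover have "\<not> E (p (Suc j)) b\<^sub>3"
      using leaf(3)[of "p (Suc j)"] sym a3 p_inj[of j "Suc j"] j' pQ by fastforce
    ultimately show False
      using claw[of "p j" "p h" "p (Suc j)" b\<^sub>3] b3[of h] b3[of "Suc j"]
        p_inj[of h "Suc j"] j' pQ in_Q by auto
  qed
  obtain l where l: "m = Suc l" using m by (metis gr0_implies_Suc)
  \<comment> \<open>\<open>p i\<close> is the first neighbour of \<open>q m\<close> along
    \<open>p\<close>.\<close>
  define i where "i = (LEAST i. i \<le> k \<and> E (q m) (p i))"
  have "\<exists>i. i \<le> k \<and> E (q m) (p i)"
    using q(2) unfolding near_def by blast
  then have i: "i \<le> k" "E (q m) (p i)"
    unfolding i_def by (metis (mono_tags, lifting) LeastI)+
  have i_min: "\<not> E (q m) (p j)" "\<not> E (p j) (q m)" if "j < i" for j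
    using not_less_Least[of j "\<lambda>i. i \<le> k \<and> E (q m) (p i)"] that i(1) sym unfolding i_def by auto
  have ends: "\<not> E (q m) b\<^sub>1" "\<not> E (q m) b\<^sub>2"
  proof -
    have "p 1 = a\<^sub>1" using p(3)[of 0] p(1) k leaf(1) by auto
    then show "\<not> E (q m) b\<^sub>1"
      using leaf(1)[of "q m"] sym qQ[of m] q_not_p[of 1] k by auto
    have "p (k - 1) = a\<^sub>2" using p(3)[of "k - 1"] p(2) k leaf(2) sym by auto
    then show "\<not> E (q m) b\<^sub>2"
      using leaf(2)[of "q m"] sym qQ[of m] q_not_p[of "k - 1"] k by auto
  qed
  have i0: "0 < i" "i < k"
    using i ends p(1,2) by (metis gr0I, metis le_neq_implies_less)
  obtain h where h: "i = Suc h" using i0 by (metis gr0_implies_Suc)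
  have E1: "E (p i) (p (Suc i))" "E (p h) (p i)"
    using p(3)[of i] p(3)[of h] i0 h by auto
  have i1: "E (q m) (p (Suc i))"
  proof -
    have "p h \<in> Q" "p i \<in> Q" "p (Suc i) \<in> Q" "q m \<in> Q"
      using pQ[of h] pQ[of i] pQ[of "Suc i"] qQ[of m] h i0 by auto
    moreover have "\<not> E (p h) (p (Suc i))" "p h \<noteq> p (Suc i)"
      using p_ind[of h "Suc i"] p_inj[of h "Suc i"] calculation h i0 by auto
    moreover have "\<not> E (p h) (q m)" "p h \<noteq> q m" "p (Suc i) \<noteq> q m"
      using i_min[of h] q_not_p[of h] q_not_p[of "Suc i"] h i0 by auto
    ultimately show ?thesis
      using claw[of "p i" "p h" "p (Suc i)" "q m"] E1 i(2)[THEN sym] sym[of "p h" "p i"]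
        sym[of "p (Suc i)" "q m"] by simp
  qed
  then have i2: "Suc (Suc i) \<le> k"
    using ends(2) p(2) i0 h by (metis Suc_leI le_neq_implies_less)
  have Eq: "E (q l) (q m)"
    using q(3)[of l] l by auto
  \<comment> \<open>Otherwise \<open>q m\<close> is the centre of a claw with leaves
    \<open>q l\<close>, \<open>p i\<close> and \<open>p j\<close>.\<close>
  have beyond: "\<not> E (q m) (p j)" "\<not> E (p j) (q m)" if "Suc i < j" "j \<le> k" for j
  proof -
    have "q l \<noteq> p t" if "t \<le> k" for t
      using inner[OF that] q(4)[of l] l by auto
    moreover have "q l \<in> Q" "q m \<in> Q" "p i \<in> Q" "p j \<in> Q"
      using pQ[of i] pQ[of j] qQ[of m] qQ[of l] that l by auto
    moreover have "\<not> E (p i) (p j)" "p i \<noteq> p j"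
      using p_ind[of i j] p_inj[of i j] calculation that by auto
    ultimately show "\<not> E (q m) (p j)"
      using claw[of "q m" "q l" "p i" "p j"] Eq[THEN sym] i(1,2) that far[of l i] far[of l j] l
      by auto
    then show "\<not> E (p j) (q m)" using sym by blast
  qed
  have P: "\<not> E (p s) (p t)" "\<not> E (p t) (p s)" if "Suc s < t" "t \<le> k" for s t
    using p_ind[of s t] that pQ sym by auto
  have E2: "E (p (Suc i)) (p (Suc (Suc i)))"
    using p(3)[of "Suc i"] i2 by auto
  note edges = E1 E2 Eq i(2) i1
  note edges = edges edges[THEN sym]
  have N: "is_net E (p i) (p h) (p (Suc i)) (p (Suc (Suc i))) (q m) (q l)"
    using edges i_min[of h] beyond[of "Suc (Suc i)"] P[of h "Suc i"] P[of h "Suc (Suc i)"]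
      P[of i "Suc (Suc i)"] h i2 far[of l] l
    by (simp add: is_net_def)
  have sub: "{p i, p h, p (Suc i), p (Suc (Suc i)), q m, q l} \<subseteq> Q"
    using pQ qQ i2 h l by auto
  show thesis
  proof (rule net[OF sub N])
    \<comment> \<open>The tails lead to \<open>b\<^sub>1\<close>, \<open>b\<^sub>2\<close> and
      \<open>b\<^sub>3\<close>; the last three cases name a tail with at least two edges.\<close>
    consider "i = 1" "Suc (Suc i) = k" "m = 1" | "i > 1" | "Suc (Suc i) < k" | "m > 1"
      using i0 i2 m by linarith
    then show "E a\<^sub>1 a\<^sub>2 \<and> E a\<^sub>1 a\<^sub>3 \<and> E a\<^sub>2 a\<^sub>3 \<or>
       (\<exists>a b c p q r. {a, b, c, p, q, r} \<subseteq> Q \<and> is_wounded E a b c p q r)"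
    proof cases
      case 1
      have "p 1 = a\<^sub>1" using p(3)[of 0] p(1) k leaf(1) by auto
      moreover have "p 2 = a\<^sub>2"
        using E2 sym leaf(2)[of "p 2"] pQ[of 2] 1 p(2) by (auto simp: numeral_2_eq_2)
      moreover have "q 1 = a\<^sub>3" using q(3)[of 0] q(1) m leaf(3) by auto
      ultimately show ?thesis using edges 1 by (auto simp: numeral_2_eq_2)
    next
      case 2
      then obtain g where g: "h = Suc g" using h by (cases h) auto
      have "is_wounded E (p (Suc i)) (p i) (q m) (p (Suc (Suc i))) (p h) (p g)"
        using edges i_min[of h] i_min[of g] beyond[of "Suc (Suc i)"] P[of h "Suc i"]
          P[of h "Suc (Suc i)"] P[of i "Suc (Suc i)"] P[of g i] P[of g "Suc i"] P[of g "Suc (Suc i)"]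
          h i2 g p(3)[of g] sym[of "p g" "p h"] by (simp add: is_wounded_def)
      then show ?thesis using pQ[of g] h g i(1) sub
        by - (intro disjI2 exI, rule conjI[rotated], assumption, simp)
    next
      case 3
      have "is_wounded E (p i) (p (Suc i)) (q m) (p h) (p (Suc (Suc i))) (p (Suc (Suc (Suc i))))"
        using edges i_min[of h] beyond[of "Suc (Suc i)"] beyond[of "Suc (Suc (Suc i))"]
          P[of h "Suc i"] P[of h "Suc (Suc i)"] P[of i "Suc (Suc i)"] P[of h "Suc (Suc (Suc i))"]
          P[of i "Suc (Suc (Suc i))"] P[of "Suc i" "Suc (Suc (Suc i))"]
          h 3 p(3)[of "Suc (Suc i)"] by (simp add: is_wounded_def)
      then show ?thesis using pQ[of "Suc (Suc (Suc i))"] 3 sub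
        by - (intro disjI2 exI, rule conjI[rotated], assumption, simp)
    next
      case 4
      then obtain g where g: "l = Suc g" using l by (cases l) auto
      have "\<not> E (q m) (q g)"
        using q_ind[of g m] g l qQ[of g] qQ[of m] sym[of "q m" "q g"] by auto
      then have "is_wounded E (p i) (q m) (p (Suc i)) (p h) (q l) (q g)"
        using edges i_min[of h] far[of l] far[of g] P[of h "Suc i"] h i2 g l
          q(3)[of g] sym[of "q g" "q l"] by (simp add: is_wounded_def)
      then show ?thesis using qQ[of g] g l sub
        by - (intro disjI2 exI, rule conjI[rotated], assumption, simp)
    qed
  qed
qed

section \<open>A graph inside its closure\<close>

definition degr :: "('a \<Rightarrow> 'a \<Rightarrow> bool) \<Rightarrow> 'a \<Rightarrow> nat" where
  "degr R x = card {u. R x u}"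

definition heavy_nonedge :: "'a set \<Rightarrow> ('a \<Rightarrow> 'a \<Rightarrow> bool) \<Rightarrow> 'a \<Rightarrow> 'a \<Rightarrow> bool" where
  "heavy_nonedge V R u v \<longleftrightarrow>
     u \<in> V \<and> v \<in> V \<and> u \<noteq> v \<and> \<not> R u v \<and> card V \<le> degr R u + degr R v"

definition simplicial :: "('a \<Rightarrow> 'a \<Rightarrow> bool) \<Rightarrow> 'a \<Rightarrow> bool" where
  "simplicial R t \<longleftrightarrow> (\<forall>u v. R t u \<longrightarrow> R t v \<longrightarrow> u \<noteq> v \<longrightarrow> R u v)"

text \<open>The vertices allowed on a path of \<open>G\<close> replacing the edge \<open>u v\<close>
  of the closure: its ends and the simplicial vertices of the maximal clique through it.\<close>

definition link :: "('a \<Rightarrow> 'a \<Rightarrow> bool) \<Rightarrow> 'a \<Rightarrow> 'a \<Rightarrow> 'a set" where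
  "link R u v = {u, v} \<union> {t. simplicial R t \<and> R t u \<and> R t v}"

lemma rtranclp_leaves:
  assumes "R\<^sup>*\<^sup>* a b" "T a" "\<not> T b"
  obtains p q where "R p q" "T p" "\<not> T q"
  using assms by (induction rule: rtranclp_induct) blast+

text \<open>
  Below \<open>E\<close> is the adjacency of a graph \<open>G\<close> and \<open>F\<close> that of its closure. The axioms on \<open>F\<close> say that
  every neighbourhood is a clique or the disjoint union of two cliques; so every edge lies in exactly
  one maximal clique, every vertex in at most two, and a vertex is in only one iff it is simplicial.
\<close>

locale heavy_closure =
  fixes V :: "'a set" and E F :: "'a \<Rightarrow> 'a \<Rightarrow> bool"
  assumes finite_V: "finite V"
    and E_F: "E u v \<Longrightarrow> F u v"
    and E_sym: "E u v \<Longrightarrow> E v u"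
    and F_sym: "F u v \<Longrightarrow> F v u"
    and F_irrefl: "\<not> F u u"
    and F_V: "F u v \<Longrightarrow> u \<in> V"
    and F_trans: "F x u \<Longrightarrow> F x v \<Longrightarrow> F x w \<Longrightarrow> F u v \<Longrightarrow> F v w \<Longrightarrow> u \<noteq> w \<Longrightarrow> F u w"
    and F_claw: "F x u \<Longrightarrow> F x v \<Longrightarrow> F x w \<Longrightarrow> u \<noteq> v \<Longrightarrow> u \<noteq> w \<Longrightarrow> v \<noteq> w \<Longrightarrow>
      F u v \<or> F u w \<or> F v w"
    and F_not_heavy: "\<not> heavy_nonedge V F u v"
    and E_claw: "E x u \<Longrightarrow> E x v \<Longrightarrow> E x w \<Longrightarrow> u \<noteq> v \<Longrightarrow> u \<noteq> w \<Longrightarrow> v \<noteq> w \<Longrightarrow>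
      E u v \<or> E u w \<or> E v w \<or> heavy_nonedge V E u v \<or> heavy_nonedge V E u w \<or> heavy_nonedge V E v w"
    and E_link: "F u v \<Longrightarrow> (\<lambda>p q. E p q \<and> p \<in> link F u v \<and> q \<in> link F u v)\<^sup>*\<^sup>* u v"
    and E_two_connected: "v \<in> V \<Longrightarrow> X \<subseteq> V - {v} \<Longrightarrow> X \<noteq> {} \<Longrightarrow>
      (\<And>x y. x \<in> X \<Longrightarrow> E x y \<Longrightarrow> y \<noteq> v \<Longrightarrow> y \<in> X) \<Longrightarrow> X = V - {v}"
begin

section \<open>Degrees and o-heavy pairs in a graph and its closure\<close>

abbreviation (input) "n \<equiv> card V"
abbreviation (input) "d \<equiv> degr F"
abbreviation (input) "e \<equiv> degr E"
abbreviation (input) "hp \<equiv> heavy_nonedge V E"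

lemma F_V2: "F u v \<Longrightarrow> v \<in> V"
  using F_V F_sym by blast

lemma E_irrefl: "\<not> E u u"
  using E_F F_irrefl by blast

lemma F_comm: "F u v \<longleftrightarrow> F v u"
  using F_sym by blast

lemma F_neq: "F u v \<Longrightarrow> u \<noteq> v"
  using F_irrefl by blast

lemma finite_F [simp]: "finite {u. F x u}"
  by (rule finite_subset[OF _ finite_V]) (auto intro: F_V2)

lemma finite_E [simp]: "finite {u. E x u}"
  by (rule finite_subset[OF _ finite_F[of x]]) (auto intro: E_F)

lemma e_le_d: "e x \<le> d x"
  unfolding degr_def by (rule card_mono) (auto intro: E_F)

lemma F_light: "u \<in> V \<Longrightarrow> v \<in> V \<Longrightarrow> u \<noteq> v \<Longrightarrow> \<not> F u v \<Longrightarrow> d u + d v < n"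
  using F_not_heavy[of u v] unfolding heavy_nonedge_def by auto

lemma hp_sym: "hp u v \<Longrightarrow> hp v u"
  unfolding heavy_nonedge_def using E_sym by auto

lemma hp_not_E: "hp u v \<Longrightarrow> \<not> E u v"
  unfolding heavy_nonedge_def by auto

lemma hp_d: "hp u v \<Longrightarrow> n \<le> d u + d v"
  using e_le_d[of u] e_le_d[of v] unfolding heavy_nonedge_def by auto

text \<open>Degrees only grow in the closure, and the closure has no o-heavy pair.\<close>

lemma hp_F: "hp u v \<Longrightarrow> F u v"
  using hp_d[of u v] F_light[of u v] unfolding heavy_nonedge_def by fastforce

lemma E_claw_F:
  assumes "E x u" "E x v" "E x w" "\<not> F u v" "\<not> F u w" "u \<noteq> v" "u \<noteq> w" "v \<noteq> w"
  shows "E v w \<or> hp v w"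
  using E_claw[OF assms(1-3)] assms hp_F E_F by blast

text \<open>Both neighbourhoods lie among the \<open>n - 2\<close> other vertices, while their sizes
  add up to at least \<open>n\<close>.\<close>

lemma hp_common_neighbours:
  assumes "hp u v"
  obtains w w' where "w \<noteq> w'" "E u w" "E v w" "E u w'" "E v w'"
proof -
  have uv: "u \<in> V" "v \<in> V" "u \<noteq> v" "\<not> E u v" "n \<le> e u + e v"
    using assms unfolding heavy_nonedge_def by auto
  have "{x. E u x} \<union> {x. E v x} \<subseteq> V - {u, v}"
    using uv E_F F_V2 E_irrefl E_sym by blast
  then have "card ({x. E u x} \<union> {x. E v x}) \<le> card (V - {u, v})"
    using finite_V by (intro card_mono) auto
  also have "\<dots> = n - 2"
    using uv finite_V by (simp add: card_Diff_subset)
  finally have *: "card ({x. E u x} \<union> {x. E v x}) \<le> n - 2" .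
  have "card {u, v} \<le> n"
    using uv finite_V by (intro card_mono) auto
  then have "2 \<le> n" using uv by simp
  then have "2 \<le> card ({x. E u x} \<inter> {x. E v x})"
    using card_Un_Int[of "{x. E u x}" "{x. E v x}"] * uv(5) unfolding degr_def by simp
  then obtain w w' where "{w, w'} \<subseteq> {x. E u x} \<inter> {x. E v x}" "w \<noteq> w'"
    by (metis card_2_iff obtain_subset_with_card_n)
  then show thesis using that by auto
qed

text \<open>The first edge of the path given by \<open>E_link\<close>; it trades an edge of the
  closure for an edge of \<open>G\<close> at the same vertex.\<close>

lemma first_step:
  assumes "F u v"
  obtains y where "E u y" "y = v \<or> simplicial F y \<and> F u y \<and> F v y"
proof -
  let ?R = "\<lambda>p q. E p q \<and> p \<in> link F u v \<and> q \<in> link F u v"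
  obtain y where "?R u y"
    using E_link[OF assms] F_neq[OF assms] by (metis (no_types, lifting) converse_rtranclpE)
  then show thesis
    using that[of y] E_irrefl F_sym unfolding link_def by blast
qed

lemma simplicialD: "simplicial F t \<Longrightarrow> F t u \<Longrightarrow> F t v \<Longrightarrow> u \<noteq> v \<Longrightarrow> F u v"
  unfolding simplicial_def by blast

subsection \<open>Nets of the closure\<close>

text \<open>
  If \<open>a a'\<close> is an edge of the triangle of a net, \<open>arm a a'\<close> is \<open>L - {a}\<close> for the maximal clique
  \<open>L\<close> of \<open>F\<close> through \<open>a\<close> that does not contain the triangle; it does not depend on the choice of \<open>a'\<close>.
\<close>

definition arm :: "'a \<Rightarrow> 'a \<Rightarrow> 'a set" where
  "arm a a' = {c. F a c \<and> \<not> F a' c \<and> c \<noteq> a'}"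

text \<open>
  The cardinality bound holds as soon as \<open>insert a (arm a a')\<close> contains an o-heavy pair of \<open>G\<close>: the two
  common neighbours of such a pair lie in the same clique.
\<close>

definition heavy_arm :: "'a \<Rightarrow> 'a \<Rightarrow> bool" where
  "heavy_arm a a' \<longleftrightarrow> 3 \<le> card (arm a a') \<and> (\<exists>c \<in> arm a a'. n \<le> d a + d c)"

text \<open>The nets of the closure that are not p-heavy.\<close>

definition light_net :: "'a \<Rightarrow> 'a \<Rightarrow> 'a \<Rightarrow> 'a \<Rightarrow> 'a \<Rightarrow> 'a \<Rightarrow> bool" where
  "light_net a\<^sub>1 b\<^sub>1 a\<^sub>2 b\<^sub>2 a\<^sub>3 b\<^sub>3 \<longleftrightarrow> is_net F a\<^sub>1 b\<^sub>1 a\<^sub>2 b\<^sub>2 a\<^sub>3 b\<^sub>3 \<and>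
     d a\<^sub>1 + d a\<^sub>2 < n \<and> d a\<^sub>1 + d a\<^sub>3 < n \<and> d a\<^sub>2 + d a\<^sub>3 < n"

lemma finite_arm [simp]: "finite (arm a a')"
  by (rule finite_subset[OF _ finite_F[of a]]) (auto simp: arm_def)

lemma light_net_swap12: "light_net a\<^sub>1 b\<^sub>1 a\<^sub>2 b\<^sub>2 a\<^sub>3 b\<^sub>3 \<Longrightarrow> light_net a\<^sub>2 b\<^sub>2 a\<^sub>1 b\<^sub>1 a\<^sub>3 b\<^sub>3"
  unfolding light_net_def is_net_def by (auto simp: F_comm add.commute)

lemma light_net_swap23: "light_net a\<^sub>1 b\<^sub>1 a\<^sub>2 b\<^sub>2 a\<^sub>3 b\<^sub>3 \<Longrightarrow> light_net a\<^sub>1 b\<^sub>1 a\<^sub>3 b\<^sub>3 a\<^sub>2 b\<^sub>2"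
  unfolding light_net_def is_net_def by (auto simp: F_comm add.commute)

lemma light_netD:
  assumes "light_net a\<^sub>1 b\<^sub>1 a\<^sub>2 b\<^sub>2 a\<^sub>3 b\<^sub>3"
  shows "F a\<^sub>1 a\<^sub>2" "F a\<^sub>1 a\<^sub>3" "F a\<^sub>2 a\<^sub>3" "F a\<^sub>2 a\<^sub>1" "F a\<^sub>3 a\<^sub>1" "F a\<^sub>3 a\<^sub>2" "F a\<^sub>1 b\<^sub>1" "F a\<^sub>2 b\<^sub>2" "F a\<^sub>3 b\<^sub>3"
    "F b\<^sub>1 a\<^sub>1" "F b\<^sub>2 a\<^sub>2" "F b\<^sub>3 a\<^sub>3"
    "\<not> F a\<^sub>1 b\<^sub>2" "\<not> F a\<^sub>1 b\<^sub>3" "\<not> F a\<^sub>2 b\<^sub>1" "\<not> F a\<^sub>2 b\<^sub>3" "\<not> F a\<^sub>3 b\<^sub>1" "\<not> F a\<^sub>3 b\<^sub>2"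
    "\<not> F b\<^sub>2 a\<^sub>1" "\<not> F b\<^sub>3 a\<^sub>1" "\<not> F b\<^sub>1 a\<^sub>2" "\<not> F b\<^sub>3 a\<^sub>2" "\<not> F b\<^sub>1 a\<^sub>3" "\<not> F b\<^sub>2 a\<^sub>3"
    "\<not> F b\<^sub>1 b\<^sub>2" "\<not> F b\<^sub>1 b\<^sub>3" "\<not> F b\<^sub>2 b\<^sub>3" "\<not> F b\<^sub>2 b\<^sub>1" "\<not> F b\<^sub>3 b\<^sub>1" "\<not> F b\<^sub>3 b\<^sub>2"
    "d a\<^sub>1 + d a\<^sub>2 < n" "d a\<^sub>1 + d a\<^sub>3 < n" "d a\<^sub>2 + d a\<^sub>3 < n"
  using assms unfolding light_net_def is_net_def by (simp_all add: F_comm)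

lemma light_net_distinct:
  assumes "light_net a\<^sub>1 b\<^sub>1 a\<^sub>2 b\<^sub>2 a\<^sub>3 b\<^sub>3"
  shows "distinct [a\<^sub>1, b\<^sub>1, a\<^sub>2, b\<^sub>2, a\<^sub>3, b\<^sub>3]"
  using light_netD[OF assms] F_irrefl by auto

lemma armD:
  assumes "c \<in> arm a\<^sub>1 a\<^sub>2"
  shows "F a\<^sub>1 c" "F c a\<^sub>1" "\<not> F a\<^sub>2 c" "\<not> F c a\<^sub>2" "c \<noteq> a\<^sub>2" "c \<noteq> a\<^sub>1"
  using assms F_sym F_irrefl unfolding arm_def by auto

text \<open>Within the neighbourhood of \<open>a\<^sub>1\<close> the adjacent vertices
  \<open>a\<^sub>2\<close> and \<open>a\<^sub>3\<close> belong to the same clique.\<close>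

lemma arm_swap:
  assumes "F a\<^sub>1 a\<^sub>2" "F a\<^sub>1 a\<^sub>3" "F a\<^sub>2 a\<^sub>3"
  shows "arm a\<^sub>1 a\<^sub>2 = arm a\<^sub>1 a\<^sub>3"
  using F_trans[of a\<^sub>1 _ a\<^sub>3 a\<^sub>2] F_trans[of a\<^sub>1 _ a\<^sub>2 a\<^sub>3] assms F_comm F_irrefl unfolding arm_def by (metis (no_types, lifting))

lemma light_net_arm:
  assumes "light_net a\<^sub>1 b\<^sub>1 a\<^sub>2 b\<^sub>2 a\<^sub>3 b\<^sub>3"
  shows "arm a\<^sub>1 a\<^sub>2 = arm a\<^sub>1 a\<^sub>3" "arm a\<^sub>2 a\<^sub>1 = arm a\<^sub>2 a\<^sub>3" "arm a\<^sub>3 a\<^sub>1 = arm a\<^sub>3 a\<^sub>2"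
    "b\<^sub>1 \<in> arm a\<^sub>1 a\<^sub>2" "b\<^sub>2 \<in> arm a\<^sub>2 a\<^sub>1" "b\<^sub>3 \<in> arm a\<^sub>3 a\<^sub>1"
proof -
  note N = light_netD[OF assms]
  show "arm a\<^sub>1 a\<^sub>2 = arm a\<^sub>1 a\<^sub>3" "arm a\<^sub>2 a\<^sub>1 = arm a\<^sub>2 a\<^sub>3" "arm a\<^sub>3 a\<^sub>1 = arm a\<^sub>3 a\<^sub>2"
    by (rule arm_swap; rule N)+
  show "b\<^sub>1 \<in> arm a\<^sub>1 a\<^sub>2" "b\<^sub>2 \<in> arm a\<^sub>2 a\<^sub>1" "b\<^sub>3 \<in> arm a\<^sub>3 a\<^sub>1"
    using N light_net_distinct[OF assms] by (auto simp: arm_def)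
qed

lemma light_net_heavy_arm:
  assumes "light_net a\<^sub>1 b\<^sub>1 a\<^sub>2 b\<^sub>2 a\<^sub>3 b\<^sub>3"
  shows "heavy_arm a\<^sub>1 a\<^sub>3 \<longleftrightarrow> heavy_arm a\<^sub>1 a\<^sub>2" "heavy_arm a\<^sub>2 a\<^sub>3 \<longleftrightarrow> heavy_arm a\<^sub>2 a\<^sub>1"
    "heavy_arm a\<^sub>3 a\<^sub>2 \<longleftrightarrow> heavy_arm a\<^sub>3 a\<^sub>1"
  using light_net_arm[OF assms] by (auto simp: heavy_arm_def)

lemma arm_clique: "F a\<^sub>1 a\<^sub>2 \<Longrightarrow> c \<in> arm a\<^sub>1 a\<^sub>2 \<Longrightarrow> c' \<in> arm a\<^sub>1 a\<^sub>2 \<Longrightarrow> c \<noteq> c' \<Longrightarrow> F c c'"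
  using F_claw[of a\<^sub>1 c c' a\<^sub>2] armD by metis

lemma arm_neighbour: "F a\<^sub>1 a\<^sub>2 \<Longrightarrow> c \<in> arm a\<^sub>1 a\<^sub>2 \<Longrightarrow> F a\<^sub>1 w \<Longrightarrow> F c w \<Longrightarrow> w \<in> arm a\<^sub>1 a\<^sub>2"
  using F_trans[of a\<^sub>1 c w a\<^sub>2] F_sym unfolding arm_def by blast

text \<open>Two different such vertices would be adjacent, and \<open>F_trans\<close> at
  \<open>w\<close> would then make \<open>b\<close> adjacent to \<open>a\<^sub>1\<close>.\<close>

lemma arm_unique:
  assumes "F a\<^sub>1 a\<^sub>2" "w \<in> arm a\<^sub>1 a\<^sub>2" "w' \<in> arm a\<^sub>1 a\<^sub>2" "F b w" "F b w'" "b \<noteq> a\<^sub>1" "\<not> F a\<^sub>1 b"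
  shows "w = w'"
  using arm_clique[OF assms(1-3)] F_trans[of w a\<^sub>1 w' b] assms armD F_sym by metis

lemma arm_common:
  assumes "F a\<^sub>1 a\<^sub>2" "u \<in> insert a\<^sub>1 (arm a\<^sub>1 a\<^sub>2)" "v \<in> insert a\<^sub>1 (arm a\<^sub>1 a\<^sub>2)" "u \<noteq> v" "F u w" "F v w"
  shows "w \<in> insert a\<^sub>1 (arm a\<^sub>1 a\<^sub>2)"
proof (cases "u = a\<^sub>1 \<or> v = a\<^sub>1")
  case True
  then show ?thesis using assms arm_neighbour by blast
next
  case False
  then have uv: "u \<in> arm a\<^sub>1 a\<^sub>2" "v \<in> arm a\<^sub>1 a\<^sub>2" using assms by auto
  then have "F u v" using arm_clique assms by blast
  then have "w = a\<^sub>1 \<or> F a\<^sub>1 w"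
    using F_trans[of u a\<^sub>1 v w] armD[OF uv(1)] armD[OF uv(2)] assms by blast
  then show ?thesis using arm_neighbour assms uv by blast
qed

lemma hp_arm_card:
  assumes "F a\<^sub>1 a\<^sub>2" "u \<in> insert a\<^sub>1 (arm a\<^sub>1 a\<^sub>2)" "v \<in> insert a\<^sub>1 (arm a\<^sub>1 a\<^sub>2)" "hp u v"
  shows "3 \<le> card (arm a\<^sub>1 a\<^sub>2)"
proof -
  obtain w w' where w: "w \<noteq> w'" "E u w" "E v w" "E u w'" "E v w'"
    using hp_common_neighbours[OF assms(4)] .
  have "u \<noteq> v" "w \<noteq> u" "w \<noteq> v" "w' \<noteq> u" "w' \<noteq> v"
    using w assms(4) E_irrefl unfolding heavy_nonedge_def by auto
  moreover have "{u, v, w, w'} \<subseteq> insert a\<^sub>1 (arm a\<^sub>1 a\<^sub>2)"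
    using assms arm_common[OF assms(1-3)] w E_F \<open>u \<noteq> v\<close> by blast
  then have "card {u, v, w, w'} \<le> card (insert a\<^sub>1 (arm a\<^sub>1 a\<^sub>2))"
    by (intro card_mono) auto
  moreover have "card {u, v, w, w'} = 4" using calculation w by auto
  moreover have "a\<^sub>1 \<notin> arm a\<^sub>1 a\<^sub>2" using F_irrefl unfolding arm_def by auto
  ultimately show ?thesis by simp
qed

lemma hp_heavy_arm: "F a\<^sub>1 a\<^sub>2 \<Longrightarrow> c \<in> arm a\<^sub>1 a\<^sub>2 \<Longrightarrow> hp a\<^sub>1 c \<Longrightarrow> heavy_arm a\<^sub>1 a\<^sub>2"
  using hp_arm_card[of a\<^sub>1 a\<^sub>2 a\<^sub>1 c] hp_d unfolding heavy_arm_def by blast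

lemma light_net_replace:
  assumes "light_net a\<^sub>1 b\<^sub>1 a\<^sub>2 b\<^sub>2 a\<^sub>3 b\<^sub>3" "c \<in> arm a\<^sub>1 a\<^sub>2" "\<not> F c b\<^sub>2" "\<not> F c b\<^sub>3"
  shows "light_net a\<^sub>1 c a\<^sub>2 b\<^sub>2 a\<^sub>3 b\<^sub>3"
  using light_netD[OF assms(1)] light_net_arm(1)[OF assms(1)] assms(2-4) armD[of c a\<^sub>1 a\<^sub>2] armD[of c a\<^sub>1 a\<^sub>3]
  unfolding light_net_def is_net_def by simp

text \<open>All neighbours of \<open>t\<close> are mutually adjacent, so \<open>t\<close> is
  adjacent to neither \<open>b\<^sub>2\<close> nor \<open>b\<^sub>3\<close>, which are not
  neighbours of \<open>a\<^sub>1\<close>.\<close>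

lemma light_net_simplicial:
  assumes "light_net a\<^sub>1 b\<^sub>1 a\<^sub>2 b\<^sub>2 a\<^sub>3 b\<^sub>3" "simplicial F t" "F a\<^sub>1 t" "F b\<^sub>1 t"
  shows "light_net a\<^sub>1 t a\<^sub>2 b\<^sub>2 a\<^sub>3 b\<^sub>3"
proof (rule light_net_replace[OF assms(1)])
  note N = light_netD[OF assms(1)] light_net_distinct[OF assms(1)]
  show "t \<in> arm a\<^sub>1 a\<^sub>2"
    using arm_neighbour[of a\<^sub>1 a\<^sub>2 b\<^sub>1 t] light_net_arm(4)[OF assms(1)] N assms by blast
  show "\<not> F t b\<^sub>2"
    using simplicialD[OF assms(2), of a\<^sub>1 b\<^sub>2] N assms F_sym by auto
  show "\<not> F t b\<^sub>3"
    using simplicialD[OF assms(2), of a\<^sub>1 b\<^sub>3] N assms F_sym by auto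
qed

lemma light_net_E_pendant:
  assumes "light_net a\<^sub>1 b\<^sub>1 a\<^sub>2 b\<^sub>2 a\<^sub>3 b\<^sub>3"
  obtains c where "E a\<^sub>1 c" "light_net a\<^sub>1 c a\<^sub>2 b\<^sub>2 a\<^sub>3 b\<^sub>3" "c = b\<^sub>1 \<or> simplicial F c"
  using first_step[OF light_netD(7)[OF assms]] light_net_simplicial[OF assms] assms by metis

lemma light_net_E_pendants:
  assumes "light_net a\<^sub>1 b\<^sub>1 a\<^sub>2 b\<^sub>2 a\<^sub>3 b\<^sub>3"
  obtains c\<^sub>1 c\<^sub>2 c\<^sub>3 where "E a\<^sub>1 c\<^sub>1" "E a\<^sub>2 c\<^sub>2" "E a\<^sub>3 c\<^sub>3" "light_net a\<^sub>1 c\<^sub>1 a\<^sub>2 c\<^sub>2 a\<^sub>3 c\<^sub>3"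
proof -
  obtain c\<^sub>1 where c1: "E a\<^sub>1 c\<^sub>1" "light_net a\<^sub>1 c\<^sub>1 a\<^sub>2 b\<^sub>2 a\<^sub>3 b\<^sub>3"
    using light_net_E_pendant[OF assms] by blast
  obtain c\<^sub>2 where c2: "E a\<^sub>2 c\<^sub>2" "light_net a\<^sub>2 c\<^sub>2 a\<^sub>1 c\<^sub>1 a\<^sub>3 b\<^sub>3"
    using light_net_E_pendant[OF light_net_swap12[OF c1(2)]] by blast
  obtain c\<^sub>3 where c3: "E a\<^sub>3 c\<^sub>3" "light_net a\<^sub>3 c\<^sub>3 a\<^sub>2 c\<^sub>2 a\<^sub>1 c\<^sub>1"
    using light_net_E_pendant[OF light_net_swap12[OF light_net_swap23[OF c2(2)]]] light_net_swap23 by metis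
  have "light_net a\<^sub>1 c\<^sub>1 a\<^sub>2 c\<^sub>2 a\<^sub>3 c\<^sub>3"
    by (rule light_net_swap12, rule light_net_swap23, rule light_net_swap12, rule c3(2))
  then show thesis using that c1 c2 c3 by blast
qed

text \<open>
  The set \<open>Q\<close> consists of the triangle, its pendant vertices and the simplicial vertices of its clique.
  A simplicial vertex has smaller degree than the three vertices of the triangle, hence \<open>Q\<close> contains no
  o-heavy pair of \<open>G\<close> and \<open>G\<close> is claw-free on \<open>Q\<close>.
\<close>

lemma light_net_E_net:
  assumes "light_net a\<^sub>1 b\<^sub>1 a\<^sub>2 b\<^sub>2 a\<^sub>3 b\<^sub>3"
  obtains (result) Q x x' y y' z z' where "\<And>u v. u \<in> Q \<Longrightarrow> v \<in> Q \<Longrightarrow> \<not> hp u v"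
    "{x, x', y, y', z, z'} \<subseteq> Q" "is_net E x x' y y' z z'"
    "E a\<^sub>1 a\<^sub>2 \<and> E a\<^sub>1 a\<^sub>3 \<and> E a\<^sub>2 a\<^sub>3 \<or>
       (\<exists>a b c p q r. {a, b, c, p, q, r} \<subseteq> Q \<and> is_wounded E a b c p q r)"
proof -
  obtain c\<^sub>1 c\<^sub>2 c\<^sub>3 where c: "E a\<^sub>1 c\<^sub>1" "E a\<^sub>2 c\<^sub>2" "E a\<^sub>3 c\<^sub>3" and net: "light_net a\<^sub>1 c\<^sub>1 a\<^sub>2 c\<^sub>2 a\<^sub>3 c\<^sub>3"
    using light_net_E_pendants[OF assms] .
  note N = light_netD[OF net] and D = light_net_distinct[OF net]
  define T where "T = {t. simplicial F t \<and> F t a\<^sub>1 \<and> F t a\<^sub>2 \<and> F t a\<^sub>3}"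
  define A where "A = {a\<^sub>1, a\<^sub>2, a\<^sub>3} \<union> T"
  define Q where "Q = A \<union> {c\<^sub>1, c\<^sub>2, c\<^sub>3}"
  \<comment> \<open>Exchanging \<open>a\<close> for \<open>t\<close> turns the neighbourhood of
    \<open>t\<close> into a subset of that of \<open>a\<close>, which contains \<open>c\<close> in
    addition.\<close>
  have small: "d t < d a" if t: "simplicial F t" "F t a" "F a c" "\<not> F t c" "t \<noteq> c" for t a c
  proof -
    have "insert t ({u. F t u} - {a}) \<subseteq> {u. F a u} - {c}"
      using that simplicialD[OF t(1)] F_sym by blast
    then have "card (insert t ({u. F t u} - {a})) \<le> card ({u. F a u} - {c})"
      by (intro card_mono) auto
    moreover have "card ({u. F a u} - {c}) < card {u. F a u}"
      using t by (intro psubset_card_mono) auto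
    moreover have "card (insert t ({u. F t u} - {a})) = card {u. F t u}"
      using t F_irrefl card_Suc_Diff1[of "{u. F t u}" a] by simp
    ultimately show ?thesis unfolding degr_def by linarith
  qed
  have T: "\<not> F t c\<^sub>1" "\<not> F t c\<^sub>2" "\<not> F t c\<^sub>3" "t \<noteq> c\<^sub>1" "t \<noteq> c\<^sub>2" "t \<noteq> c\<^sub>3" if "t \<in> T" for t
    using that simplicialD[of t a\<^sub>2 c\<^sub>1] simplicialD[of t a\<^sub>1 c\<^sub>2] simplicialD[of t a\<^sub>1 c\<^sub>3] N D
    unfolding T_def by auto
  have T_deg: "d t < d a\<^sub>1" "d t < d a\<^sub>2" "d t < d a\<^sub>3" if "t \<in> T" for t
    using small[of t a\<^sub>1 c\<^sub>1] small[of t a\<^sub>2 c\<^sub>2] small[of t a\<^sub>3 c\<^sub>3] T[OF that] that N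
    unfolding T_def by auto
  have A_light: "d u + d v < n" if "u \<in> A" "v \<in> A" "u \<noteq> v" for u v
    using that N(31-33) T_deg unfolding A_def by fastforce
  have leaf: "y = a\<^sub>1" if "y \<in> Q" "F c\<^sub>1 y" for y
    using that N D T F_sym F_irrefl unfolding Q_def A_def by blast
  have leaf2: "y = a\<^sub>2" if "y \<in> Q" "F c\<^sub>2 y" for y
    using that N D T F_sym F_irrefl unfolding Q_def A_def by blast
  have leaf3: "y = a\<^sub>3" if "y \<in> Q" "F c\<^sub>3 y" for y
    using that N D T F_sym F_irrefl unfolding Q_def A_def by blast
  have no_hp: "\<not> hp u v" if "u \<in> Q" "v \<in> Q" for u v
  proof
    assume h: "hp u v"
    then have uv: "F u v" "F v u" "\<not> E u v" "\<not> E v u" using hp_F hp_not_E F_sym E_sym by blast+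
    have "u \<notin> {c\<^sub>1, c\<^sub>2, c\<^sub>3}" "v \<notin> {c\<^sub>1, c\<^sub>2, c\<^sub>3}"
      using leaf leaf2 leaf3 uv that c E_sym by blast+
    then have "u \<in> A" "v \<in> A" using that unfolding Q_def by auto
    then show False using A_light[of u v] hp_d[OF h] uv F_neq by fastforce
  qed
  \<comment> \<open>No triangle vertex is simplicial, because of its pendant; and a vertex adjacent
    to two triangle vertices lies in their clique, hence sees the third.\<close>
  have T_eq: "t \<in> T" if "simplicial F t" "F t x" "F t y" "x \<in> {a\<^sub>1, a\<^sub>2, a\<^sub>3}" "y \<in> {a\<^sub>1, a\<^sub>2, a\<^sub>3}" "x \<noteq> y" for t x y
  proof -
    have "t \<noteq> a\<^sub>1" "t \<noteq> a\<^sub>2" "t \<noteq> a\<^sub>3"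
      using that(1) simplicialD[of a\<^sub>1 a\<^sub>2 c\<^sub>1] simplicialD[of a\<^sub>2 a\<^sub>1 c\<^sub>2] simplicialD[of a\<^sub>3 a\<^sub>1 c\<^sub>3] N D by auto
    then show ?thesis
      using that F_trans[of x t y] N F_sym unfolding T_def by blast
  qed
  have links: "link F a\<^sub>1 a\<^sub>2 \<subseteq> Q" "link F a\<^sub>3 a\<^sub>1 \<subseteq> Q"
    using T_eq D unfolding link_def Q_def A_def by auto
  define R where "R = (\<lambda>u v. E u v \<and> u \<in> Q \<and> v \<in> Q)"
  have mono: "R\<^sup>*\<^sup>* u v" if "(\<lambda>p q. E p q \<and> p \<in> X \<and> q \<in> X)\<^sup>*\<^sup>* u v" "X \<subseteq> Q" for u v X
    using that(1) by (rule rtranclp_mono[THEN predicate2D, rotated]) (use that(2) in \<open>auto simp: R_def\<close>)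
  have in_Q: "{a\<^sub>1, a\<^sub>2, a\<^sub>3, c\<^sub>1, c\<^sub>2, c\<^sub>3} \<subseteq> Q" unfolding Q_def A_def by auto
  have paths: "R\<^sup>*\<^sup>* a\<^sub>1 a\<^sub>2" "R\<^sup>*\<^sup>* a\<^sub>3 a\<^sub>1"
    using mono[OF E_link links(1)] mono[OF E_link links(2)] N by blast+
  have steps: "R c\<^sub>1 a\<^sub>1" "R a\<^sub>2 c\<^sub>2" "R c\<^sub>3 a\<^sub>3" "R a\<^sub>1 c\<^sub>1"
    using c E_sym in_Q by (auto simp: R_def)
  have conn: "R\<^sup>*\<^sup>* c\<^sub>1 c\<^sub>2" "R\<^sup>*\<^sup>* c\<^sub>3 c\<^sub>1"
    using paths steps by (meson converse_rtranclp_into_rtranclp[of R] rtranclp.rtrancl_into_rtrancl[of R])+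
  have claw: "E u v \<or> E u w \<or> E v w"
    if "{x, u, v, w} \<subseteq> Q" "E x u" "E x v" "E x w" "u \<noteq> v" "u \<noteq> w" "v \<noteq> w" for x u v w
    using E_claw[OF that(2-7)] no_hp that(1) by blast
  have wit: thesis if "{x, x', y, y', z, z'} \<subseteq> Q" "is_net E x x' y y' z z'"
      "E a\<^sub>1 a\<^sub>2 \<and> E a\<^sub>1 a\<^sub>3 \<and> E a\<^sub>2 a\<^sub>3 \<or>
       (\<exists>a b c p q r. {a, b, c, p, q, r} \<subseteq> Q \<and> is_wounded E a b c p q r)" for x x' y y' z z'
    by (rule result[OF no_hp that])
  show thesis
  proof (rule claw_free_three_leaves[OF E_sym E_irrefl claw _ _ _ _ _ _ leaf leaf2 leaf3 conn[unfolded R_def] wit])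
    show "{c\<^sub>1, c\<^sub>2, c\<^sub>3} \<subseteq> Q" "c\<^sub>1 \<noteq> c\<^sub>2" "c\<^sub>1 \<noteq> c\<^sub>3" "c\<^sub>2 \<noteq> c\<^sub>3" "a\<^sub>3 \<noteq> c\<^sub>1" "a\<^sub>3 \<noteq> c\<^sub>2"
      using in_Q D by auto
  qed (assumption | rule E_F)+
qed

end

section \<open>Nets in closures of wounded-o-heavy graphs\<close>

locale wounded_heavy_closure = heavy_closure +
  assumes E_wounded: "is_wounded E a b c p q r \<Longrightarrow>
    \<exists>u \<in> {a, b, c, p, q, r}. \<exists>v \<in> {a, b, c, p, q, r}. heavy_nonedge V E u v"
begin

text \<open>Of the fifteen pairs, six are edges of \<open>G\<close> and seven are non-edges of the
  closure; neither kind can be o-heavy. Only \<open>b r\<close> and \<open>c r\<close>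
  remain.\<close>

lemma wounded_hp:
  assumes "E a b" "E b c" "E a c" "E a p" "E b q" "E q r"
    and "\<not> F a q" "\<not> F a r" "\<not> F b p" "\<not> F c p" "\<not> F c q" "\<not> F p q" "\<not> F p r"
    and "\<not> E b r" "\<not> E c r"
  shows "hp b r \<or> hp c r"
proof -
  have "is_wounded E a b c p q r"
    unfolding is_wounded_def using assms E_F by blast
  from E_wounded[OF this]
  obtain u v where uv: "u \<in> {a, b, c, p, q, r}" "v \<in> {a, b, c, p, q, r}" "hp u v"
    by (elim bexE)
  have nF: "\<not> hp x y" "\<not> hp y x" if "\<not> F x y" for x y using hp_F F_sym that by blast+
  have E: "\<not> hp x y" "\<not> hp y x" if "E x y" for x y using hp_not_E E_sym that by blast+
  have refl: "\<not> hp x x" for x unfolding heavy_nonedge_def by simp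
  note no = E[OF assms(1)] E[OF assms(2)] E[OF assms(3)] E[OF assms(4)] E[OF assms(5)] E[OF assms(6)]
    nF[OF assms(7)] nF[OF assms(8)] nF[OF assms(9)] nF[OF assms(10)] nF[OF assms(11)] nF[OF assms(12)]
    nF[OF assms(13)] refl
  show ?thesis
    using uv hp_sym[of r b] hp_sym[of r c] by (elim insertE emptyE) (simp_all add: no)
qed

lemma wounded_False:
  assumes "E a b" "E b c" "E a c" "E a p" "E b q" "E q r"
    and "\<not> F a q" "\<not> F a r" "\<not> F b p" "\<not> F c p" "\<not> F c q" "\<not> F p q" "\<not> F p r"
    and "\<not> F b r" "\<not> F c r"
  shows False
  using wounded_hp[OF assms(1-13)] assms E_F hp_F by blast

text \<open>The other alternative of \<open>light_net_E_net\<close> is a wounded graph inside a set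
  without o-heavy pairs.\<close>

lemma light_net_E_triangle:
  assumes "light_net a\<^sub>1 b\<^sub>1 a\<^sub>2 b\<^sub>2 a\<^sub>3 b\<^sub>3"
  shows "E a\<^sub>1 a\<^sub>2" "E a\<^sub>1 a\<^sub>3" "E a\<^sub>2 a\<^sub>3" "E a\<^sub>2 a\<^sub>1" "E a\<^sub>3 a\<^sub>1" "E a\<^sub>3 a\<^sub>2"
proof -
  have "E a\<^sub>1 a\<^sub>2 \<and> E a\<^sub>1 a\<^sub>3 \<and> E a\<^sub>2 a\<^sub>3"
  proof (rule light_net_E_net[OF assms])
    fix Q
    assume Q: "\<And>u v. u \<in> Q \<Longrightarrow> v \<in> Q \<Longrightarrow> \<not> hp u v"
      and *: "E a\<^sub>1 a\<^sub>2 \<and> E a\<^sub>1 a\<^sub>3 \<and> E a\<^sub>2 a\<^sub>3 \<or>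
       (\<exists>a b c p q r. {a, b, c, p, q, r} \<subseteq> Q \<and> is_wounded E a b c p q r)"
    have no: False if "{a, b, c, p, q, r} \<subseteq> Q" "is_wounded E a b c p q r" for a b c p q r
      using E_wounded[OF that(2)] Q that(1) by blast
    from * show ?thesis
    proof (elim disjE exE)
      fix a b c p q r
      assume "{a, b, c, p, q, r} \<subseteq> Q \<and> is_wounded E a b c p q r"
      then show ?thesis using no[of a b c p q r] by blast
    qed
  qed
  then show "E a\<^sub>1 a\<^sub>2" "E a\<^sub>1 a\<^sub>3" "E a\<^sub>2 a\<^sub>3" "E a\<^sub>2 a\<^sub>1" "E a\<^sub>3 a\<^sub>1" "E a\<^sub>3 a\<^sub>2"
    using E_sym by blast+
qed

text \<open>Witnesses \<open>c\<close> and \<open>c'\<close> of two heavy arms give non-edges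
  \<open>a\<^sub>1 c'\<close> and \<open>a\<^sub>2 c\<close> of the closure; the four degree sums
  are incompatible.\<close>

lemma heavy_arm_unique:
  assumes "light_net a\<^sub>1 b\<^sub>1 a\<^sub>2 b\<^sub>2 a\<^sub>3 b\<^sub>3" "heavy_arm a\<^sub>1 a\<^sub>2"
  shows "\<not> heavy_arm a\<^sub>2 a\<^sub>1"
proof
  assume "heavy_arm a\<^sub>2 a\<^sub>1"
  then obtain c c' where c: "c \<in> arm a\<^sub>1 a\<^sub>2" "n \<le> d a\<^sub>1 + d c" "c' \<in> arm a\<^sub>2 a\<^sub>1" "n \<le> d a\<^sub>2 + d c'"
    using assms(2) unfolding heavy_arm_def by blast
  have "d a\<^sub>1 + d c' < n" "d a\<^sub>2 + d c < n"
    using F_light armD[OF c(1)] armD[OF c(3)] F_V by metis+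
  then show False using c by linarith
qed

text \<open>Otherwise the path of \<open>G\<close> replacing \<open>a\<^sub>1 b\<^sub>1\<close> has
  an edge \<open>p q\<close> with \<open>p\<close> adjacent to \<open>a\<^sub>1\<close> in
  \<open>G\<close> and \<open>q\<close> not. The tail \<open>a\<^sub>1 p q\<close> gives a wounded
  graph whose only possible o-heavy pair is \<open>a\<^sub>1 q\<close>, which makes the arm
  heavy.\<close>

lemma light_arm_E_pendant:
  assumes net: "light_net a\<^sub>1 b\<^sub>1 a\<^sub>2 b\<^sub>2 a\<^sub>3 b\<^sub>3" and light: "\<not> heavy_arm a\<^sub>1 a\<^sub>2"
  shows "E a\<^sub>1 b\<^sub>1"
proof (rule ccontr)
  assume nE: "\<not> E a\<^sub>1 b\<^sub>1"
  obtain c\<^sub>2 where c2: "E a\<^sub>2 c\<^sub>2" "light_net a\<^sub>2 c\<^sub>2 a\<^sub>1 b\<^sub>1 a\<^sub>3 b\<^sub>3"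
    using light_net_E_pendant[OF light_net_swap12[OF net]] by blast
  note net' = light_net_swap12[OF c2(2)]
  note N = light_netD[OF net'] and D = light_net_distinct[OF net']
  let ?R = "\<lambda>p q. E p q \<and> p \<in> link F a\<^sub>1 b\<^sub>1 \<and> q \<in> link F a\<^sub>1 b\<^sub>1"
  let ?T = "\<lambda>x. x = a\<^sub>1 \<or> E a\<^sub>1 x"
  have "\<not> ?T b\<^sub>1" using nE D by auto
  then obtain p q where pq: "?R p q" "?T p" "\<not> ?T q"
    using rtranclp_leaves[OF E_link[OF N(7)], of ?T] by blast
  have p: "E a\<^sub>1 p" "simplicial F p \<and> F p a\<^sub>1 \<and> F p b\<^sub>1"
    using pq nE unfolding link_def by auto
  have q: "q = b\<^sub>1 \<or> simplicial F q \<and> F q a\<^sub>1 \<and> F q b\<^sub>1" "\<not> E a\<^sub>1 q" "q \<noteq> a\<^sub>1"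
    using pq unfolding link_def by auto
  have Np: "light_net a\<^sub>1 p a\<^sub>2 c\<^sub>2 a\<^sub>3 b\<^sub>3"
    using light_net_simplicial[OF net'] p F_sym by blast
  have Nq: "light_net a\<^sub>1 q a\<^sub>2 c\<^sub>2 a\<^sub>3 b\<^sub>3"
    using light_net_simplicial[OF net'] q F_sym net' by blast
  have "hp a\<^sub>1 q \<or> hp a\<^sub>3 q"
    using light_net_E_triangle[OF net] c2 pq p q light_netD[OF Np] light_netD[OF Nq] E_F
    by (intro wounded_hp[of a\<^sub>2 a\<^sub>1 a\<^sub>3 c\<^sub>2 p q]) blast+
  then have "hp a\<^sub>1 q" using hp_F light_netD[OF Nq] by blast
  then show False
    using hp_heavy_arm light_net_arm(4)[OF Nq] N light by blast
qed

text \<open>Otherwise the tail \<open>a\<^sub>1 x c\<close> gives wounded graphs with the other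
  pendant at \<open>a\<^sub>2\<close> or at \<open>a\<^sub>3\<close>. Both fail only if
  \<open>c\<close> is adjacent to both pendants, and then \<open>c\<close> is the centre of a
  claw.\<close>

lemma light_arm_exit:
  assumes net: "light_net a\<^sub>1 x a\<^sub>2 b\<^sub>2 a\<^sub>3 b\<^sub>3" and light: "\<not> heavy_arm a\<^sub>1 a\<^sub>2"
    and c: "E x c" "\<not> F a\<^sub>1 c" "c \<noteq> a\<^sub>1"
  shows "F a\<^sub>2 c \<or> F a\<^sub>3 c"
proof (rule ccontr)
  assume nF: "\<not> (F a\<^sub>2 c \<or> F a\<^sub>3 c)"
  obtain c\<^sub>2 where c2: "E a\<^sub>2 c\<^sub>2" "light_net a\<^sub>2 c\<^sub>2 a\<^sub>1 x a\<^sub>3 b\<^sub>3"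
    using light_net_E_pendant[OF light_net_swap12[OF net]] by blast
  obtain c\<^sub>3 where c3: "E a\<^sub>3 c\<^sub>3" "light_net a\<^sub>3 c\<^sub>3 a\<^sub>1 x a\<^sub>2 c\<^sub>2"
    using light_net_E_pendant[OF light_net_swap12[OF light_net_swap23[OF light_net_swap12[OF c2(2)]]]]
    by blast
  have net': "light_net a\<^sub>1 x a\<^sub>2 c\<^sub>2 a\<^sub>3 c\<^sub>3"
    by (rule light_net_swap23, rule light_net_swap12, rule c3(2))
  note N = light_netD[OF net'] and D = light_net_distinct[OF net'] and T = light_net_E_triangle[OF net']
  have x: "E a\<^sub>1 x" using light_arm_E_pendant[OF net light] .
  have cx: "F x c" "F c x" using c E_F F_sym by blast+
  have nb: "c \<noteq> c\<^sub>2" "c \<noteq> c\<^sub>3" using nF N by auto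
  have "\<not> F c c\<^sub>2 \<or> \<not> F c c\<^sub>3"
    using F_claw[of c x c\<^sub>2 c\<^sub>3] cx N D by auto
  then show False
  proof
    assume "\<not> F c c\<^sub>2"
    then show False
      using T x c2 c nF N F_sym by (intro wounded_False[of a\<^sub>2 a\<^sub>1 a\<^sub>3 c\<^sub>2 x c]) blast+
  next
    assume "\<not> F c c\<^sub>3"
    then show False
      using T x c3 c nF N F_sym by (intro wounded_False[of a\<^sub>3 a\<^sub>1 a\<^sub>2 c\<^sub>3 x c]) blast+
  qed
qed

text \<open>By \<open>light_arm_exit\<close> and \<open>arm_unique\<close>, \<open>x\<close> has in
  \<open>G\<close> at most one neighbour outside its clique for each of \<open>a\<^sub>2\<close> and
  \<open>a\<^sub>3\<close>; these are balanced by the neighbours \<open>a\<^sub>2\<close> and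
  \<open>a\<^sub>3\<close> of \<open>a\<^sub>1\<close>.\<close>

lemma light_arm_e_le_d:
  assumes net: "light_net a\<^sub>1 x a\<^sub>2 b\<^sub>2 a\<^sub>3 b\<^sub>3" and light: "\<not> heavy_arm a\<^sub>1 a\<^sub>2"
  shows "e x \<le> d a\<^sub>1"
proof -
  note N = light_netD[OF net] and D = light_net_distinct[OF net] and A = light_net_arm[OF net]
  define W where "W b = {w. F x w \<and> F b w \<and> \<not> F a\<^sub>1 w \<and> w \<noteq> a\<^sub>1}" for b
  have W: "finite (W b)" "card (W b) \<le> 1" if "b = a\<^sub>2 \<or> b = a\<^sub>3" for b
  proof -
    have "W b \<subseteq> {u. F x u}" unfolding W_def by auto
    then show "finite (W b)" by (rule finite_subset) simp
    moreover have "w = w'" if "w \<in> W b" "w' \<in> W b" for w w'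
      using arm_unique[of b a\<^sub>1 w w' x] that \<open>b = a\<^sub>2 \<or> b = a\<^sub>3\<close> N D unfolding W_def arm_def by auto
    ultimately show "card (W b) \<le> 1" by (metis One_nat_def card_le_Suc0_iff_eq)
  qed
  have "{u. E x u} \<subseteq> insert a\<^sub>1 (arm a\<^sub>1 a\<^sub>2 - {x}) \<union> (W a\<^sub>2 \<union> W a\<^sub>3)"
  proof
    fix u assume "u \<in> {u. E x u}"
    then have u: "E x u" "F x u" "u \<noteq> x" using E_F E_irrefl by auto
    consider "u = a\<^sub>1" | "F a\<^sub>1 u" | "\<not> F a\<^sub>1 u" "u \<noteq> a\<^sub>1" by blast
    then show "u \<in> insert a\<^sub>1 (arm a\<^sub>1 a\<^sub>2 - {x}) \<union> (W a\<^sub>2 \<union> W a\<^sub>3)"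
    proof cases
      case 2
      then show ?thesis using arm_neighbour[OF N(1) A(4)] u by blast
    next
      case 3
      then show ?thesis using light_arm_exit[OF net light u(1)] u unfolding W_def by blast
    qed simp
  qed
  then have "e x \<le> card (insert a\<^sub>1 (arm a\<^sub>1 a\<^sub>2 - {x}) \<union> (W a\<^sub>2 \<union> W a\<^sub>3))"
    unfolding degr_def by (rule card_mono[rotated]) (use W in auto)
  also have "\<dots> \<le> card (insert a\<^sub>1 (arm a\<^sub>1 a\<^sub>2 - {x})) + (card (W a\<^sub>2) + card (W a\<^sub>3))"
    using card_Un_le[of "insert a\<^sub>1 (arm a\<^sub>1 a\<^sub>2 - {x})" "W a\<^sub>2 \<union> W a\<^sub>3"] card_Un_le[of "W a\<^sub>2" "W a\<^sub>3"]
    by linarith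
  also have "\<dots> \<le> card (insert a\<^sub>1 (arm a\<^sub>1 a\<^sub>2 - {x})) + 2"
    using W(2)[of a\<^sub>2] W(2)[of a\<^sub>3] by simp
  also have "card (insert a\<^sub>1 (arm a\<^sub>1 a\<^sub>2 - {x})) = card (arm a\<^sub>1 a\<^sub>2)"
    using A(4) F_irrefl card_Suc_Diff1[OF finite_arm A(4)] unfolding arm_def by simp
  also have "card (arm a\<^sub>1 a\<^sub>2) + 2 = card (arm a\<^sub>1 a\<^sub>2 \<union> {a\<^sub>2, a\<^sub>3})"
  proof -
    have "arm a\<^sub>1 a\<^sub>2 \<inter> {a\<^sub>2, a\<^sub>3} = {}" using D N by (auto simp: arm_def)
    then show ?thesis using D by (simp add: card_Un_disjoint)
  qed
  also have "\<dots> \<le> d a\<^sub>1"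
    unfolding degr_def by (rule card_mono) (use N in \<open>auto simp: arm_def\<close>)
  finally show ?thesis .
qed

text \<open>If \<open>c\<close> lies in the arm of \<open>a\<^sub>2\<close>, then lightness of that
  arm forces the edge \<open>a\<^sub>2 c\<close> in \<open>G\<close>, and the claw at
  \<open>a\<^sub>2\<close> forces \<open>c b\<^sub>2\<close> to be an edge of \<open>G\<close> or
  o-heavy. The edge creates a wounded graph; the o-heavy pair makes the arm heavy.\<close>

lemma light_arms_no_exit:
  assumes net: "light_net a\<^sub>1 x a\<^sub>2 b\<^sub>2 a\<^sub>3 b\<^sub>3" and light: "\<not> heavy_arm a\<^sub>1 a\<^sub>2" "\<not> heavy_arm a\<^sub>2 a\<^sub>1"
    and c: "E x c" "\<not> F a\<^sub>1 c" "c \<noteq> a\<^sub>1"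
  shows "\<not> F a\<^sub>2 c"
proof
  assume F2: "F a\<^sub>2 c"
  obtain c\<^sub>3 where c3: "E a\<^sub>3 c\<^sub>3" "light_net a\<^sub>3 c\<^sub>3 a\<^sub>1 x a\<^sub>2 b\<^sub>2"
    using light_net_E_pendant[OF light_net_swap12[OF light_net_swap23[OF net]]] by blast
  have net': "light_net a\<^sub>1 x a\<^sub>2 b\<^sub>2 a\<^sub>3 c\<^sub>3"
    by (rule light_net_swap23, rule light_net_swap12, rule c3(2))
  note net2 = light_net_swap12[OF net']
  note N = light_netD[OF net'] and D = light_net_distinct[OF net'] and T = light_net_E_triangle[OF net']
  have E: "E a\<^sub>1 x" "E a\<^sub>2 b\<^sub>2"
    using light_arm_E_pendant[OF net' light(1)] light_arm_E_pendant[OF net2 light(2)] .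
  have cx: "F x c" "F c x" using c E_F F_sym by blast+
  have c2: "c \<in> arm a\<^sub>2 a\<^sub>1" using F2 c unfolding arm_def by blast
  then have cn: "\<not> F a\<^sub>3 c" "\<not> F c a\<^sub>3" "c \<noteq> a\<^sub>3"
    using armD[of c a\<^sub>2 a\<^sub>3] light_net_arm(2)[OF net'] by auto
  have cb: "c \<noteq> b\<^sub>2" "c \<noteq> c\<^sub>3" using cx N cn by auto
  have cc3: "\<not> F c c\<^sub>3" "\<not> F c\<^sub>3 c"
    using F_claw[of c x c\<^sub>3 a\<^sub>2] cx N D cb F2 F_sym by blast+
  have Ea2c: "E a\<^sub>2 c"
  proof (rule ccontr)
    assume nE: "\<not> E a\<^sub>2 c"
    have "hp a\<^sub>1 c \<or> hp a\<^sub>2 c"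
      using T E c3 c nE N cn cc3 E_F
      by (intro wounded_hp[of a\<^sub>3 a\<^sub>1 a\<^sub>2 c\<^sub>3 x c]) blast+
    then have "hp a\<^sub>2 c" using hp_F c by blast
    then show False using hp_heavy_arm[of a\<^sub>2 a\<^sub>1 c] c2 N light by blast
  qed
  have "E c b\<^sub>2 \<or> hp c b\<^sub>2"
    using E_claw_F[of a\<^sub>2 a\<^sub>1 c b\<^sub>2] T Ea2c E c N D cb by auto
  then show False
  proof
    assume Ecb: "E c b\<^sub>2"
    show False
      using Ecb T E c3 c cn cc3 N Ea2c E_sym F_sym cx
      by (intro wounded_False[of c a\<^sub>2 b\<^sub>2 x a\<^sub>3 c\<^sub>3]) blast+
  next
    assume h: "hp c b\<^sub>2"
    have "n \<le> e c + e b\<^sub>2" using h unfolding heavy_nonedge_def by blast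
    then have "n \<le> d a\<^sub>2 + d c"
      using light_arm_e_le_d[OF net2 light(2)] e_le_d[of c] by linarith
    moreover have "3 \<le> card (arm a\<^sub>2 a\<^sub>1)"
      using hp_arm_card[of a\<^sub>2 a\<^sub>1 c b\<^sub>2] h c2 light_net_arm(5)[OF net'] N by blast
    ultimately show False using light(2) c2 unfolding heavy_arm_def by blast
  qed
qed

section \<open>Edges leaving an arm, and the existence of a heavy arm\<close>

lemma arm_exit_first_step:
  assumes "x \<in> arm a\<^sub>1 a\<^sub>2" "F x w" "\<not> F a\<^sub>1 w" "w \<noteq> a\<^sub>1"
  obtains c where "E x c" "\<not> F a\<^sub>1 c" "c \<noteq> a\<^sub>1" "c = w \<or> simplicial F c \<and> F x c \<and> F w c"
proof -
  obtain c where c: "E x c" "c = w \<or> simplicial F c \<and> F x c \<and> F w c"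
    using first_step[OF assms(2)] .
  have "\<not> F a\<^sub>1 c \<and> c \<noteq> a\<^sub>1"
    using c assms F_trans[of x a\<^sub>1 c w] armD[OF assms(1)] F_sym by blast
  then show thesis using that c by blast
qed

text \<open>Without an exit the arm is closed in \<open>G\<close> after deleting
  \<open>a\<^sub>1\<close>, so by 2-connectedness it contains all other vertices; but it misses
  \<open>a\<^sub>2\<close>.\<close>

lemma arm_exit_exists:
  assumes net: "light_net a\<^sub>1 b\<^sub>1 a\<^sub>2 b\<^sub>2 a\<^sub>3 b\<^sub>3"
  obtains (exit) x w where "x \<in> arm a\<^sub>1 a\<^sub>2" "F x w" "\<not> F a\<^sub>1 w" "w \<noteq> a\<^sub>1"
proof (rule ccontr)
  assume no: "\<not> thesis"
  note N = light_netD[OF net] and A = light_net_arm[OF net]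
  have "arm a\<^sub>1 a\<^sub>2 = V - {a\<^sub>1}"
  proof (rule E_two_connected)
    show "a\<^sub>1 \<in> V" using N F_V by blast
    show "arm a\<^sub>1 a\<^sub>2 \<subseteq> V - {a\<^sub>1}" using F_V armD by blast
    show "arm a\<^sub>1 a\<^sub>2 \<noteq> {}" using A by blast
    show "y \<in> arm a\<^sub>1 a\<^sub>2" if "x \<in> arm a\<^sub>1 a\<^sub>2" "E x y" "y \<noteq> a\<^sub>1" for x y
      using arm_neighbour[OF N(1) that(1)] that no exit E_F by blast
  qed
  moreover have "a\<^sub>2 \<in> V - {a\<^sub>1}" using N F_V F_neq by blast
  ultimately show False unfolding arm_def by blast
qed

lemma light_arms_simplicial:
  assumes net: "light_net a\<^sub>1 b\<^sub>1 a\<^sub>2 b\<^sub>2 a\<^sub>3 b\<^sub>3"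
    and light: "\<not> heavy_arm a\<^sub>1 a\<^sub>2" "\<not> heavy_arm a\<^sub>2 a\<^sub>1" "\<not> heavy_arm a\<^sub>3 a\<^sub>1"
    and "F b\<^sub>1 w" "w \<noteq> a\<^sub>1"
  shows "F a\<^sub>1 w"
proof (rule ccontr)
  assume "\<not> F a\<^sub>1 w"
  then obtain c where c: "E b\<^sub>1 c" "\<not> F a\<^sub>1 c" "c \<noteq> a\<^sub>1"
    using arm_exit_first_step[OF light_net_arm(4)[OF net]] assms by metis
  have "\<not> F a\<^sub>2 c" by (rule light_arms_no_exit[OF net light(1,2) c])
  moreover have "\<not> F a\<^sub>3 c"
    by (rule light_arms_no_exit[OF light_net_swap23[OF net] _ light(3) c])
      (use light light_net_heavy_arm[OF net] in auto)
  ultimately show False using light_arm_exit[OF net light(1) c] by blast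
qed

text \<open>Some \<open>x\<close> in the first arm has an exit. If all arms are light,
  \<open>b\<^sub>2\<close> and \<open>b\<^sub>3\<close> have none, so neither is adjacent to
  \<open>x\<close>; then \<open>x\<close> can replace \<open>b\<^sub>1\<close> as a pendant, against
  \<open>light_arms_simplicial\<close>.\<close>

lemma some_heavy_arm:
  assumes net: "light_net a\<^sub>1 b\<^sub>1 a\<^sub>2 b\<^sub>2 a\<^sub>3 b\<^sub>3"
  shows "heavy_arm a\<^sub>1 a\<^sub>2 \<or> heavy_arm a\<^sub>2 a\<^sub>1 \<or> heavy_arm a\<^sub>3 a\<^sub>1"
proof (rule ccontr)
  assume "\<not> ?thesis"
  then have light: "\<not> heavy_arm a\<^sub>1 a\<^sub>2" "\<not> heavy_arm a\<^sub>2 a\<^sub>1" "\<not> heavy_arm a\<^sub>3 a\<^sub>1" by auto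
  note N = light_netD[OF net] and D = light_net_distinct[OF net] and H = light_net_heavy_arm[OF net]
  obtain x w where x: "x \<in> arm a\<^sub>1 a\<^sub>2" "F x w" "\<not> F a\<^sub>1 w" "w \<noteq> a\<^sub>1"
    using arm_exit_exists[OF net] .
  note X = armD[OF x(1)] armD[of x a\<^sub>1 a\<^sub>3] x(1) light_net_arm(1)[OF net]
  have "\<not> F x b\<^sub>2"
    using light_arms_simplicial[OF light_net_swap12[OF net], of x] light H X F_sym by auto
  moreover have "\<not> F x b\<^sub>3"
    using light_arms_simplicial[OF light_net_swap12[OF light_net_swap23[OF net]], of x] light H X F_sym
    by auto
  ultimately have "light_net a\<^sub>1 x a\<^sub>2 b\<^sub>2 a\<^sub>3 b\<^sub>3"
    using light_net_replace[OF net] x by blast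
  then show False using light_arms_simplicial light x by blast
qed

lemma arm_neighbour_card:
  assumes "F a\<^sub>1 a\<^sub>2" "b \<noteq> a\<^sub>1" "\<not> F a\<^sub>1 b"
  shows "card {z \<in> arm a\<^sub>1 a\<^sub>2. F b z} \<le> 1"
proof -
  have "finite {z \<in> arm a\<^sub>1 a\<^sub>2. F b z}" by simp
  then show ?thesis
    unfolding One_nat_def using arm_unique[OF assms(1) _ _ _ _ assms(2,3)]
    by (subst card_le_Suc0_iff_eq) blast+
qed

section \<open>Structure of a net with a heavy arm\<close>

lemma heavy_arm_light:
  assumes "light_net a\<^sub>1 b\<^sub>1 a\<^sub>2 b\<^sub>2 a\<^sub>3 b\<^sub>3" "heavy_arm a\<^sub>1 a\<^sub>2"
  shows "heavy_arm a\<^sub>1 a\<^sub>3" "\<not> heavy_arm a\<^sub>2 a\<^sub>1" "\<not> heavy_arm a\<^sub>2 a\<^sub>3" "\<not> heavy_arm a\<^sub>3 a\<^sub>1" "\<not> heavy_arm a\<^sub>3 a\<^sub>2"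
  using heavy_arm_unique[OF assms] heavy_arm_unique[OF light_net_swap23[OF assms(1)]] assms(2)
    light_net_heavy_arm[OF assms(1)] by auto

text \<open>Each of \<open>x\<close> and \<open>y\<close> has at most one neighbour in the heavy
  arm, which has at least three vertices.\<close>

lemma heavy_arm_net:
  assumes net: "light_net a\<^sub>1 b\<^sub>1 a\<^sub>2 b\<^sub>2 a\<^sub>3 b\<^sub>3" and heavy: "heavy_arm a\<^sub>1 a\<^sub>2"
    and xy: "x \<in> arm a\<^sub>2 a\<^sub>1" "y \<in> arm a\<^sub>3 a\<^sub>1" "\<not> F x y"
  obtains z where "light_net a\<^sub>1 z a\<^sub>2 x a\<^sub>3 y"
proof -
  note N = light_netD[OF net] and A = light_net_arm[OF net]
  note X = armD[OF xy(1)] armD[of x a\<^sub>2 a\<^sub>3] and Y = armD[OF xy(2)] armD[of y a\<^sub>3 a\<^sub>2]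
  let ?X = "{z \<in> arm a\<^sub>1 a\<^sub>2. F x z}" and ?Y = "{z \<in> arm a\<^sub>1 a\<^sub>2. F y z}"
  have "card ?X \<le> 1" "card ?Y \<le> 1"
    using arm_neighbour_card[OF N(1)] X Y by auto
  then have less: "card (?X \<union> ?Y) < card (arm a\<^sub>1 a\<^sub>2)"
    using card_Un_le[of ?X ?Y] heavy unfolding heavy_arm_def by linarith
  have "\<not> arm a\<^sub>1 a\<^sub>2 \<subseteq> ?X \<union> ?Y"
  proof
    assume "arm a\<^sub>1 a\<^sub>2 \<subseteq> ?X \<union> ?Y"
    then have "card (arm a\<^sub>1 a\<^sub>2) \<le> card (?X \<union> ?Y)" by (rule card_mono[rotated]) simp
    then show False using less by simp
  qed
  then obtain z where z: "z \<in> arm a\<^sub>1 a\<^sub>2" "z \<notin> ?X \<union> ?Y" by blast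
  have "light_net a\<^sub>1 z a\<^sub>2 x a\<^sub>3 y"
    using z N A X Y xy armD[of z a\<^sub>1 a\<^sub>2] armD[of z a\<^sub>1 a\<^sub>3] F_sym
    unfolding light_net_def is_net_def by auto
  then show thesis using that by blast
qed

lemma heavy_arm_E_pendant:
  assumes "light_net a\<^sub>1 b\<^sub>1 a\<^sub>2 b\<^sub>2 a\<^sub>3 b\<^sub>3" "heavy_arm a\<^sub>1 a\<^sub>2" "x \<in> arm a\<^sub>2 a\<^sub>1" "y \<in> arm a\<^sub>3 a\<^sub>1" "\<not> F x y"
  shows "E a\<^sub>2 x" "e x \<le> d a\<^sub>2"
  using heavy_arm_net[OF assms] heavy_arm_light[OF assms(1,2)] light_net_swap12
    light_arm_E_pendant light_arm_e_le_d by metis+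

lemma heavy_arm_exit:
  assumes net: "light_net a\<^sub>1 b\<^sub>1 a\<^sub>2 b\<^sub>2 a\<^sub>3 b\<^sub>3" and heavy: "heavy_arm a\<^sub>1 a\<^sub>2"
    and xy: "x \<in> arm a\<^sub>2 a\<^sub>1" "y \<in> arm a\<^sub>3 a\<^sub>1" "\<not> F x y"
    and w: "F x w" "\<not> F a\<^sub>2 w" "w \<noteq> a\<^sub>2"
  shows "F a\<^sub>1 w" "E x w"
proof -
  note light = heavy_arm_light[OF net heavy]
  obtain z where "light_net a\<^sub>1 z a\<^sub>2 x a\<^sub>3 y"
    using heavy_arm_net[OF net heavy xy] .
  then have net': "light_net a\<^sub>2 x a\<^sub>1 z a\<^sub>3 y" by (rule light_net_swap12)
  obtain c where c: "E x c" "\<not> F a\<^sub>2 c" "c \<noteq> a\<^sub>2" "c = w \<or> simplicial F c \<and> F x c \<and> F w c"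
    using arm_exit_first_step[OF xy(1) w] .
  have "\<not> F a\<^sub>3 c"
    using light_arms_no_exit[OF light_net_swap23[OF net'] light(3,5) c(1-3)] .
  then have F1: "F a\<^sub>1 c"
    using light_arm_exit[OF net' light(2) c(1-3)] by blast
  \<comment> \<open>A simplicial \<open>c\<close> would make its neighbours \<open>a\<^sub>1\<close>
    and \<open>x\<close> adjacent.\<close>
  have "c = w"
    using c(4) simplicialD[of c a\<^sub>1 x] F1 armD[OF xy(1)] F_sym by blast
  then show "F a\<^sub>1 w" "E x w" using F1 c by auto
qed

text \<open>An edge \<open>x y\<close> leaves the light arm without reaching the heavy one, so
  \<open>heavy_arm_exit\<close> must fail: \<open>x\<close> is adjacent to \<open>b\<^sub>3\<close>
  and \<open>y\<close> to \<open>b\<^sub>2\<close>. By \<open>arm_unique\<close>,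
  \<open>x = b\<^sub>2\<close> and \<open>y = b\<^sub>3\<close>, which are not adjacent.\<close>

lemma light_arms_nonadjacent:
  assumes net: "light_net a\<^sub>1 b\<^sub>1 a\<^sub>2 b\<^sub>2 a\<^sub>3 b\<^sub>3" and heavy: "heavy_arm a\<^sub>1 a\<^sub>2"
    and xy: "x \<in> arm a\<^sub>2 a\<^sub>1" "y \<in> arm a\<^sub>3 a\<^sub>1"
  shows "\<not> F x y"
proof
  assume F: "F x y"
  note N = light_netD[OF net] and A = light_net_arm[OF net]
  note X = armD[OF xy(1)] armD[of x a\<^sub>2 a\<^sub>3] and Y = armD[OF xy(2)] armD[of y a\<^sub>3 a\<^sub>2]
  have "F x b\<^sub>3"
    using heavy_arm_exit(1)[OF net heavy xy(1) A(6), of y] F X Y A xy by auto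
  then have "y = b\<^sub>3"
    using arm_unique[of a\<^sub>3 a\<^sub>1 y b\<^sub>3 x] N A xy X F by auto
  have "F y b\<^sub>2"
    using heavy_arm_exit(1)[OF light_net_swap23[OF net] heavy_arm_light(1)[OF net heavy] xy(2) A(5), of x]
      F_sym[OF F] X Y A xy by auto
  then have "x = b\<^sub>2"
    using arm_unique[of a\<^sub>2 a\<^sub>1 x b\<^sub>2 y] N A xy Y F_sym[OF F] by auto
  then show False using F \<open>y = b\<^sub>3\<close> N by auto
qed

text \<open>Some \<open>x\<close> of the light arm has an exit \<open>w\<close>, which lies in the
  heavy arm. A second vertex \<open>u\<close> of the light arm either gives a wounded graph on the
  triangle \<open>x a\<^sub>2 u\<close>, or forms an o-heavy pair with \<open>x\<close> that makes
  the arm heavy.\<close>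

lemma light_arm_singleton:
  assumes net: "light_net a\<^sub>1 b\<^sub>1 a\<^sub>2 b\<^sub>2 a\<^sub>3 b\<^sub>3" and heavy: "heavy_arm a\<^sub>1 a\<^sub>2"
  obtains c where "arm a\<^sub>2 a\<^sub>1 = {b\<^sub>2}" "{u. F b\<^sub>2 u} = {a\<^sub>2, c}" "c \<in> arm a\<^sub>1 a\<^sub>2" "E b\<^sub>2 c" "E a\<^sub>2 b\<^sub>2"
proof -
  note N = light_netD[OF net] and A = light_net_arm[OF net] and D = light_net_distinct[OF net]
    and T = light_net_E_triangle[OF net]
  have non: "\<not> F x b\<^sub>3" if "x \<in> arm a\<^sub>2 a\<^sub>1" for x
    using light_arms_nonadjacent[OF net heavy that A(6)] .
  have exit: "F a\<^sub>1 w" "E x w" if "x \<in> arm a\<^sub>2 a\<^sub>1" "F x w" "\<not> F a\<^sub>2 w" "w \<noteq> a\<^sub>2" for x w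
    using heavy_arm_exit[OF net heavy that(1) A(6) non[OF that(1)] that(2-4)] .
  have pend: "E a\<^sub>2 x" "e x \<le> d a\<^sub>2" if "x \<in> arm a\<^sub>2 a\<^sub>1" for x
    using heavy_arm_E_pendant[OF net heavy that A(6) non[OF that]] .
  have Eb3: "E a\<^sub>3 b\<^sub>3"
    using heavy_arm_E_pendant(1)[OF light_net_swap23[OF net] heavy_arm_light(1)[OF net heavy] A(6,5)] N by blast
  obtain x w where xw: "x \<in> arm a\<^sub>2 a\<^sub>1" "F x w" "\<not> F a\<^sub>2 w" "w \<noteq> a\<^sub>2"
    using arm_exit_exists[OF light_net_swap12[OF net]] .
  note w = exit[OF xw]
  have w_arm: "w \<in> arm a\<^sub>1 a\<^sub>2" using w xw unfolding arm_def by blast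
  have x: "\<not> F x a\<^sub>1" "\<not> F a\<^sub>1 x" "x \<noteq> a\<^sub>1" "\<not> F x a\<^sub>3" "\<not> F a\<^sub>3 x" "x \<noteq> a\<^sub>3"
    using armD[OF xw(1)] armD[of x a\<^sub>2 a\<^sub>3] xw(1) A by auto
  have "u = x" if u: "u \<in> arm a\<^sub>2 a\<^sub>1" for u
  proof (rule ccontr)
    assume "u \<noteq> x"
    have u': "\<not> F u a\<^sub>3" "\<not> F a\<^sub>3 u" "u \<noteq> a\<^sub>3"
      using armD[OF u] armD[of u a\<^sub>2 a\<^sub>3] u A by auto
    have "E x u \<or> hp x u"
      using E_claw_F[of a\<^sub>2 a\<^sub>3 x u] T pend[OF u] pend[OF xw(1)] x u' \<open>u \<noteq> x\<close> by blast
    then show False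
    proof
      assume Exu: "E x u"
      have "\<not> F u w"
        using arm_unique[of a\<^sub>2 a\<^sub>1 x u w] xw u N \<open>u \<noteq> x\<close> F_sym by blast
      moreover have "\<not> F w a\<^sub>3"
        using armD[of w a\<^sub>1 a\<^sub>3] w_arm A by auto
      moreover have "w \<noteq> b\<^sub>3" using non[OF xw(1)] xw by blast
      then have "\<not> F w b\<^sub>3"
        using F_claw[of w x a\<^sub>1 b\<^sub>3] xw w x non[OF xw(1)] N D F_sym by blast
      ultimately show False
        using Exu pend(1)[OF u] E_sym[OF pend(1)[OF xw(1)]] w T Eb3 x u' xw N non[OF u] non[OF xw(1)]
        by (intro wounded_False[of x a\<^sub>2 u w a\<^sub>3 b\<^sub>3]) blast+
    next
      assume h: "hp x u"
      then have "n \<le> e x + e u" unfolding heavy_nonedge_def by blast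
      then have "n \<le> d a\<^sub>2 + d u"
        using pend(2)[OF xw(1)] e_le_d[of u] by linarith
      moreover have "3 \<le> card (arm a\<^sub>2 a\<^sub>1)"
        using hp_arm_card[of a\<^sub>2 a\<^sub>1 x u] h u xw N by blast
      ultimately show False
        using heavy_arm_light(2)[OF net heavy] u unfolding heavy_arm_def by blast
    qed
  qed
  then have eq: "arm a\<^sub>2 a\<^sub>1 = {b\<^sub>2}" "x = b\<^sub>2" using A(5) by auto
  have "u \<in> {a\<^sub>2, w}" if "F b\<^sub>2 u" for u
  proof (rule ccontr)
    assume u: "u \<notin> {a\<^sub>2, w}"
    have "\<not> F a\<^sub>2 u"
      using arm_neighbour[OF N(4) A(5), of u] that eq F_irrefl by auto
    then have "u \<in> arm a\<^sub>1 a\<^sub>2"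
      using exit(1)[OF A(5) that] u unfolding arm_def by blast
    then show False
      using arm_unique[of a\<^sub>1 a\<^sub>2 u w b\<^sub>2] u w_arm N D that xw eq by auto
  qed
  then have "{u. F b\<^sub>2 u} = {a\<^sub>2, w}" using N xw eq by blast
  then show thesis using that eq w w_arm pend(1)[OF A(5)] by blast
qed

text \<open>A further vertex \<open>y\<close> of the triangle's clique is not adjacent to the
  witness \<open>c\<close> of the heavy arm, hence \<open>d y < d a\<^sub>1\<close> and
  \<open>y\<close> forms no o-heavy pair with \<open>a\<^sub>2\<close> or \<open>a\<^sub>3\<close>.
  The claws at \<open>a\<^sub>1\<close> and \<open>a\<^sub>2\<close> then give a triangle
  \<open>a\<^sub>2 a\<^sub>3 y\<close> of \<open>G\<close>, and \<open>b\<^sub>3\<close>,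
  \<open>b\<^sub>2\<close>, \<open>c\<^sub>2\<close> complete a wounded graph.\<close>

lemma heavy_arm_triangle_clique:
  assumes net: "light_net a\<^sub>1 b\<^sub>1 a\<^sub>2 b\<^sub>2 a\<^sub>3 b\<^sub>3" and heavy: "heavy_arm a\<^sub>1 a\<^sub>2"
    and x: "F a\<^sub>1 x" "F a\<^sub>2 x"
  shows "x = a\<^sub>3"
proof (rule ccontr)
  assume x3: "x \<noteq> a\<^sub>3"
  note N = light_netD[OF net] and A = light_net_arm[OF net] and D = light_net_distinct[OF net]
    and T = light_net_E_triangle[OF net]
  obtain c\<^sub>2 where c2: "arm a\<^sub>2 a\<^sub>1 = {b\<^sub>2}" "{u. F b\<^sub>2 u} = {a\<^sub>2, c\<^sub>2}" "c\<^sub>2 \<in> arm a\<^sub>1 a\<^sub>2" "E b\<^sub>2 c\<^sub>2" "E a\<^sub>2 b\<^sub>2"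
    using light_arm_singleton[OF net heavy] .
  obtain c\<^sub>3 where c3: "{u. F b\<^sub>3 u} = {a\<^sub>3, c\<^sub>3}" "c\<^sub>3 \<in> arm a\<^sub>1 a\<^sub>3" "E a\<^sub>3 b\<^sub>3"
    using light_arm_singleton[OF light_net_swap23[OF net] heavy_arm_light(1)[OF net heavy]] by metis
  obtain c where c: "c \<in> arm a\<^sub>1 a\<^sub>2" "n \<le> d a\<^sub>1 + d c"
    using heavy unfolding heavy_arm_def by blast
  have nadj: "\<not> F z y" "z \<noteq> y" if "z \<in> arm a\<^sub>1 a\<^sub>2" "F a\<^sub>1 y" "F a\<^sub>2 y" for y z
    using arm_neighbour[OF N(1) that(1,2)] armD[OF that(1)] that F_neq unfolding arm_def by blast+
  have light: "d y + d a\<^sub>2 < n" "d y + d a\<^sub>3 < n" if "F a\<^sub>1 y" "F a\<^sub>2 y" for y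
  proof -
    have "d c + d y < n"
      using F_light[of c y] nadj[OF c(1) that] F_V2 that armD[OF c(1)] by blast
    then show "d y + d a\<^sub>2 < n" "d y + d a\<^sub>3 < n" using c N by linarith+
  qed
  have step: False if y: "F a\<^sub>1 y" "F a\<^sub>2 y" "y \<noteq> a\<^sub>3" "E a\<^sub>2 y" for y
  proof -
    have y': "F a\<^sub>3 y"
      using F_trans[of a\<^sub>1 a\<^sub>3 a\<^sub>2 y] N y by blast
    have b: "\<not> F b\<^sub>2 y" "\<not> F b\<^sub>3 y"
      using arm_neighbour[OF N(4) A(5), of y] arm_neighbour[OF N(5) A(6), of y] y y'
      unfolding arm_def by blast+
    have "y \<noteq> b\<^sub>2" using y N by auto
    have "E y a\<^sub>3 \<or> hp y a\<^sub>3"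
      using E_claw_F[of a\<^sub>2 b\<^sub>2 y a\<^sub>3] c2 y T b N D \<open>y \<noteq> b\<^sub>2\<close> by auto
    then have "E a\<^sub>3 y"
      using hp_d light(2)[OF y(1,2)] E_sym by fastforce
    moreover have "\<not> F b\<^sub>3 c\<^sub>2"
    proof
      assume "F b\<^sub>3 c\<^sub>2"
      then show False
        using F_claw[of c\<^sub>2 a\<^sub>1 b\<^sub>2 b\<^sub>3] c2 E_F F_sym armD[OF c2(3)] N D by blast
    qed
    moreover have "\<not> F a\<^sub>3 c\<^sub>2" using armD[of c\<^sub>2 a\<^sub>1 a\<^sub>3] c2 A by auto
    moreover have "\<not> F y c\<^sub>2" using nadj[OF c2(3) y(1,2)] F_sym by blast
    ultimately show False
      using T y c2 c3 b N armD[OF c2(3)] F_sym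
      by (intro wounded_False[of a\<^sub>3 a\<^sub>2 y b\<^sub>3 b\<^sub>2 c\<^sub>2]) blast+
  qed
  obtain y where y: "E a\<^sub>1 y" "y = x \<or> simplicial F y \<and> F a\<^sub>1 y \<and> F x y"
    using first_step[OF x(1)] .
  have "y = x \<or> y \<noteq> a\<^sub>2 \<and> y \<noteq> a\<^sub>3"
    using y(2) simplicialD[of a\<^sub>2 a\<^sub>1 b\<^sub>2] simplicialD[of a\<^sub>3 a\<^sub>1 b\<^sub>3] N D by auto
  then have y': "F a\<^sub>2 y" "y \<noteq> a\<^sub>3" "F a\<^sub>1 y"
    using F_trans[of a\<^sub>1 a\<^sub>2 x y] y x N x3 F_sym E_F by blast+
  obtain z where z: "E a\<^sub>1 z" "light_net a\<^sub>1 z a\<^sub>2 b\<^sub>2 a\<^sub>3 b\<^sub>3"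
    using light_net_E_pendant[OF net] by blast
  have "\<not> F z y" "z \<noteq> y" using nadj[OF light_net_arm(4)[OF z(2)] y'(3,1)] .
  then have "E a\<^sub>2 y \<or> hp a\<^sub>2 y"
    using E_claw_F[of a\<^sub>1 z a\<^sub>2 y] z T y light_netD[OF z(2)] light_net_distinct[OF z(2)] y' F_neq by auto
  then show False
    using step[OF y'(3,1,2)] hp_d[of a\<^sub>2 y] light(1)[OF y'(3,1)] by linarith
qed

lemma light_arm_degrees:
  assumes net: "light_net a\<^sub>1 b\<^sub>1 a\<^sub>2 b\<^sub>2 a\<^sub>3 b\<^sub>3" and heavy: "heavy_arm a\<^sub>1 a\<^sub>2"
  shows "d a\<^sub>2 = 3" "d b\<^sub>2 = 2"
proof -
  note N = light_netD[OF net] and D = light_net_distinct[OF net]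
  obtain c where c: "arm a\<^sub>2 a\<^sub>1 = {b\<^sub>2}" "{u. F b\<^sub>2 u} = {a\<^sub>2, c}" "c \<in> arm a\<^sub>1 a\<^sub>2"
    using light_arm_singleton[OF net heavy] .
  have "u \<in> {a\<^sub>1, a\<^sub>3, b\<^sub>2}" if "F a\<^sub>2 u" for u
    using heavy_arm_triangle_clique[OF net heavy, of u] that c(1) unfolding arm_def by blast
  then have "{u. F a\<^sub>2 u} = {a\<^sub>1, a\<^sub>3, b\<^sub>2}" using N by blast
  then show "d a\<^sub>2 = 3" using D unfolding degr_def by auto
  show "d b\<^sub>2 = 2" using c armD[OF c(3)] unfolding degr_def by auto
qed

section \<open>The size of the heavy clique\<close>

lemma e_less_d: "F x y \<Longrightarrow> \<not> E x y \<Longrightarrow> e x < d x"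
  unfolding degr_def by (rule psubset_card_mono) (use E_F in auto)

lemma hp_d_strict:
  assumes "hp u v"
  shows "n + 2 \<le> d u + d v"
proof -
  have "F u v" "F v u" "\<not> E u v" "\<not> E v u"
    using hp_F[OF assms] hp_not_E[OF assms] F_sym E_sym by blast+
  then have "e u < d u" "e v < d v" using e_less_d by blast+
  then show ?thesis using assms unfolding heavy_nonedge_def by linarith
qed

lemma card_arm_le_d:
  assumes "F a\<^sub>1 a\<^sub>2" "z \<in> arm a\<^sub>1 a\<^sub>2"
  shows "card (arm a\<^sub>1 a\<^sub>2) \<le> d z"
proof -
  have "card (arm a\<^sub>1 a\<^sub>2) = card (insert a\<^sub>1 (arm a\<^sub>1 a\<^sub>2 - {z}))"
    using card_Suc_Diff1[OF finite_arm assms(2)] F_irrefl by (simp add: arm_def)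
  also have "\<dots> \<le> d z"
    unfolding degr_def
    by (rule card_mono) (use arm_clique[OF assms] armD[OF assms(2)] in auto)
  finally show ?thesis .
qed

text \<open>
  If the arm were small, no two of \<open>a\<^sub>1, c\<^sub>2, c\<^sub>3\<close> and the simplicial vertices of the arm could form an
  o-heavy pair of \<open>G\<close>, except for \<open>{a\<^sub>1, c\<^sub>2}\<close> and \<open>{a\<^sub>1, c\<^sub>3}\<close>, where \<open>c\<^sub>i\<close> is the neighbour of \<open>b\<^sub>i\<close> in the
  arm. The edge \<open>a\<^sub>1 c\<^sub>i\<close> would then yield a wounded graph, and without both edges \<open>a\<^sub>1\<close> has too small a
  degree in \<open>G\<close>.
\<close>

lemma heavy_arm_large:
  assumes net: "light_net a\<^sub>1 b\<^sub>1 a\<^sub>2 b\<^sub>2 a\<^sub>3 b\<^sub>3" and heavy: "heavy_arm a\<^sub>1 a\<^sub>2"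
  shows "n \<le> 2 * card (arm a\<^sub>1 a\<^sub>2)"
proof (rule ccontr)
  assume small: "\<not> ?thesis"
  have heavy': "heavy_arm a\<^sub>1 a\<^sub>3" using heavy_arm_light(1)[OF net heavy] .
  define m where "m = card (arm a\<^sub>1 a\<^sub>2)"
  \<comment> \<open>Stated for arbitrary names in order to cover both light arms.\<close>
  have no_E: "\<not> E a c \<and> d c \<le> m + 1 \<and> d a \<le> m + 2"
    if net: "light_net a b a' b' a'' b''" and heavy: "heavy_arm a a'" and m: "m = card (arm a a')"
      and c: "arm a' a = {b'}" "{u. F b' u} = {a', c}" "c \<in> arm a a'" "E b' c" and Eb'': "E a'' b''"
    for a b a' b' a'' b'' c
  proof -
    note N = light_netD[OF net] and A = light_net_arm[OF net] and D = light_net_distinct[OF net]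
      and T = light_net_E_triangle[OF net]
    note C = armD[OF c(3)]
    have cb: "F b' c" "F c b'" using c E_F F_sym by blast+
    have c'': "\<not> F c a''" "\<not> F a'' c" "c \<noteq> a''" using armD[of c a a''] c(3) A by auto
    have cb'': "\<not> F c b''" using F_claw[of c a b' b''] cb C N D F_sym by blast
    have d_simp: "d t \<le> m" if "t \<in> arm a a'" "simplicial F t" for t
    proof -
      have "{u. F t u} \<subseteq> insert a (arm a a' - {t})"
      proof
        fix u assume "u \<in> {u. F t u}"
        then have u: "F t u" by simp
        then have "u = a \<or> F a u" using simplicialD[OF that(2), of a u] armD[OF that(1)] by blast
        then show "u \<in> insert a (arm a a' - {t})"
          using arm_neighbour[OF N(1) that(1), of u] u F_neq by blast
      qed
      then have "d t \<le> card (insert a (arm a a' - {t}))"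
        unfolding degr_def by (rule card_mono[rotated]) simp
      then show ?thesis
        using card_Suc_Diff1[OF finite_arm that(1)] F_irrefl m by (simp add: arm_def)
    qed
    have "{u. F a u} \<subseteq> arm a a' \<union> {a', a''}"
      using heavy_arm_triangle_clique[OF net heavy] unfolding arm_def by blast
    then have "d a \<le> card (arm a a' \<union> {a', a''})"
      unfolding degr_def by (rule card_mono[rotated]) simp
    then have da: "d a \<le> m + 2"
      using card_Un_le[of "arm a a'" "{a', a''}"] D m by simp
    \<comment> \<open>A second exit of \<open>c\<close> would be adjacent to \<open>b'\<close> by
      claw-freeness, but the neighbours of \<open>b'\<close> are \<open>a'\<close> and
      \<open>c\<close>.\<close>
    have "{u. F c u} \<subseteq> insert b' (insert a (arm a a' - {c}))"
    proof
      fix u assume "u \<in> {u. F c u}"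
      then have u: "F c u" "u \<noteq> c" using F_neq by auto
      show "u \<in> insert b' (insert a (arm a a' - {c}))"
      proof (rule ccontr)
        assume nu: "u \<notin> insert b' (insert a (arm a a' - {c}))"
        then have "\<not> F a u" using arm_neighbour[OF N(1) c(3), of u] u by blast
        then have "F b' u" using F_claw[of c a b' u] nu u cb C N D by blast
        then have "u \<in> {a', c}" using c(2) by auto
        then show False using u C by auto
      qed
    qed
    then have "d c \<le> card (insert b' (insert a (arm a a' - {c})))"
      unfolding degr_def by (rule card_mono[rotated]) simp
    also have "\<dots> \<le> Suc (card (insert a (arm a a' - {c})))" by (rule card_insert_le_m1) auto
    also have "card (insert a (arm a a' - {c})) = m"
      using card_Suc_Diff1[OF finite_arm c(3)] F_irrefl m by (simp add: arm_def)
    finally have dc: "d c \<le> m + 1" by simp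
    have "\<not> E a c"
    proof
      assume Eac: "E a c"
      \<comment> \<open>The triangle \<open>c a z\<close> of \<open>G\<close> has the pendant
        \<open>b'\<close> at \<open>c\<close> and the tail \<open>a'' b''\<close> at
        \<open>a\<close>.\<close>
      have no_z: False if "light_net a z a' b' a'' b''" "E a z" "E c z" for z
        using that c Eac T Eb'' E_sym light_netD[OF that(1)] c'' cb''
        by (intro wounded_False[of c a z b' a'' b'']) blast+
      obtain z where z: "E a z" "light_net a z a' b' a'' b''" "z = b \<or> simplicial F z"
        using light_net_E_pendant[OF net] .
      note Nz = light_netD[OF z(2)] and Dz = light_net_distinct[OF z(2)]
      have "c \<noteq> z" using cb Nz by auto
      then have "E c z \<or> hp c z"
        using E_claw_F[of a a'' c z] T Eac z c'' Nz Dz by auto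
      then have h: "hp c z" using no_z z by blast
      \<comment> \<open>The degree bounds exclude an o-heavy pair \<open>c z\<close> with
        \<open>z\<close> simplicial, so \<open>z\<close> is the original pendant \<open>b\<close>.
        The path of \<open>G\<close> replacing \<open>c b\<close> then starts at a simplicial
        \<open>t\<close>, which takes over the role of \<open>z\<close>.\<close>
      have "\<not> simplicial F z"
        using hp_d_strict[OF h] dc d_simp[OF light_net_arm(4)[OF z(2)]] small
        unfolding m_def[symmetric] by linarith
      then have zb: "z = b" using z by blast
      have "F c b" using hp_F[OF h] zb by simp
      then obtain t where t: "E c t" "t = b \<or> simplicial F t \<and> F c t \<and> F b t"
        using first_step by blast
      have ts: "simplicial F t" "F c t" "F b t"
        using t hp_not_E[OF h] zb by blast+
      have "t \<noteq> a" using simplicialD[of a a' b] ts N D by auto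
      then have t_arm: "t \<in> arm a a'"
        using arm_common[OF N(1), of c b t] c(3) A(4) ts \<open>c \<noteq> z\<close> zb by blast
      have Nt: "light_net a t a' b' a'' b''"
        using light_net_simplicial[OF net ts(1)] ts armD[OF t_arm] by blast
      have "E a t \<or> hp a t"
        using E_claw_F[of c b' a t] c Eac E_sym t light_netD[OF Nt] light_net_distinct[OF Nt] by auto
      then have "hp a t" using no_z[OF Nt] t by blast
      then show False
        using hp_d_strict[of a t] da d_simp[OF t_arm ts(1)] small unfolding m_def[symmetric] by linarith
    qed
    then show ?thesis using da dc by blast
  qed
  note N = light_netD[OF net] and A = light_net_arm[OF net] and D = light_net_distinct[OF net]
    and T = light_net_E_triangle[OF net]
  obtain c\<^sub>2 where c2: "arm a\<^sub>2 a\<^sub>1 = {b\<^sub>2}" "{u. F b\<^sub>2 u} = {a\<^sub>2, c\<^sub>2}" "c\<^sub>2 \<in> arm a\<^sub>1 a\<^sub>2" "E b\<^sub>2 c\<^sub>2" "E a\<^sub>2 b\<^sub>2"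
    using light_arm_singleton[OF net heavy] .
  obtain c\<^sub>3 where c3: "arm a\<^sub>3 a\<^sub>1 = {b\<^sub>3}" "{u. F b\<^sub>3 u} = {a\<^sub>3, c\<^sub>3}" "c\<^sub>3 \<in> arm a\<^sub>1 a\<^sub>3" "E b\<^sub>3 c\<^sub>3" "E a\<^sub>3 b\<^sub>3"
    using light_arm_singleton[OF light_net_swap23[OF net] heavy'] .
  have n2: "\<not> E a\<^sub>1 c\<^sub>2" "d c\<^sub>2 \<le> m + 1"
    using no_E[OF net heavy m_def c2(1-4) c3(5)] by auto
  have n3: "\<not> E a\<^sub>1 c\<^sub>3"
    using no_E[OF light_net_swap23[OF net] heavy' _ c3(1-4) c2(5)] m_def A by auto
  have c3_arm: "c\<^sub>3 \<in> arm a\<^sub>1 a\<^sub>2" using c3 A by simp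
  note C = armD[OF c2(3)]
  have "\<not> F b\<^sub>3 c\<^sub>2"
    using F_claw[of c\<^sub>2 a\<^sub>1 b\<^sub>2 b\<^sub>3] c2(4) E_F F_sym C N D by blast
  then have c23: "c\<^sub>2 \<noteq> c\<^sub>3" using c3 E_F by blast
  have "\<not> F a\<^sub>3 c\<^sub>2" using armD[of c\<^sub>2 a\<^sub>1 a\<^sub>3] c2 A by auto
  then have "hp a\<^sub>2 c\<^sub>2 \<or> hp a\<^sub>1 c\<^sub>2"
    using T c2 c3 N C E_F n2 \<open>\<not> F b\<^sub>3 c\<^sub>2\<close>
    by (intro wounded_hp[of a\<^sub>3 a\<^sub>2 a\<^sub>1 b\<^sub>3 b\<^sub>2 c\<^sub>2]) blast+
  then have h: "hp a\<^sub>1 c\<^sub>2" using hp_F C by blast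
  \<comment> \<open>Missing \<open>c\<^sub>2\<close> and \<open>c\<^sub>3\<close> in
    \<open>G\<close> offsets the neighbours \<open>a\<^sub>2\<close> and \<open>a\<^sub>3\<close> of
    \<open>a\<^sub>1\<close>; so both vertices of the o-heavy pair
    \<open>a\<^sub>1 c\<^sub>2\<close> have degree at most \<open>m\<close> in
    \<open>G\<close>.\<close>
  have "{u. E a\<^sub>1 u} \<subseteq> (arm a\<^sub>1 a\<^sub>2 - {c\<^sub>2, c\<^sub>3}) \<union> {a\<^sub>2, a\<^sub>3}"
    using heavy_arm_triangle_clique[OF net heavy] n2(1) n3 E_F unfolding arm_def by blast
  then have "e a\<^sub>1 \<le> card ((arm a\<^sub>1 a\<^sub>2 - {c\<^sub>2, c\<^sub>3}) \<union> {a\<^sub>2, a\<^sub>3})"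
    unfolding degr_def by (rule card_mono[rotated]) simp
  also have "\<dots> \<le> card (arm a\<^sub>1 a\<^sub>2 - {c\<^sub>2, c\<^sub>3}) + 2"
    using card_Un_le[of "arm a\<^sub>1 a\<^sub>2 - {c\<^sub>2, c\<^sub>3}" "{a\<^sub>2, a\<^sub>3}"] D by simp
  also have "card (arm a\<^sub>1 a\<^sub>2 - {c\<^sub>2, c\<^sub>3}) = m - 2"
    using c2(3) c3_arm c23 unfolding m_def by (subst card_Diff_subset) auto
  also have "m - 2 + 2 = m"
    using heavy unfolding heavy_arm_def m_def by linarith
  finally have "e a\<^sub>1 \<le> m" .
  moreover have "e c\<^sub>2 < d c\<^sub>2"
    using e_less_d[of c\<^sub>2 a\<^sub>1] C n2(1) E_sym by blast
  ultimately show False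
    using h n2(2) small unfolding heavy_nonedge_def m_def[symmetric] by linarith
qed

lemma heavy_arm_net_degrees:
  assumes net: "light_net a\<^sub>1 b\<^sub>1 a\<^sub>2 b\<^sub>2 a\<^sub>3 b\<^sub>3" and heavy: "heavy_arm a\<^sub>1 a\<^sub>2"
  shows "n \<le> 2 * d a\<^sub>1" "n \<le> 2 * d b\<^sub>1" "d a\<^sub>2 = 3" "d b\<^sub>2 = 2"
    "F b\<^sub>2 w \<Longrightarrow> w \<noteq> a\<^sub>2 \<Longrightarrow> n \<le> 2 * d w"
proof -
  note N = light_netD[OF net] and A = light_net_arm[OF net]
  note large = heavy_arm_large[OF net heavy]
  have "card (arm a\<^sub>1 a\<^sub>2) \<le> d a\<^sub>1"
    unfolding degr_def by (rule card_mono) (auto simp: arm_def)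
  then show "n \<le> 2 * d a\<^sub>1" using large by linarith
  show "n \<le> 2 * d b\<^sub>1" using card_arm_le_d[OF N(1) A(4)] large by linarith
  show "d a\<^sub>2 = 3" "d b\<^sub>2 = 2" using light_arm_degrees[OF net heavy] .
  obtain c where c: "{u. F b\<^sub>2 u} = {a\<^sub>2, c}" "c \<in> arm a\<^sub>1 a\<^sub>2"
    using light_arm_singleton[OF net heavy] .
  show "n \<le> 2 * d w" if "F b\<^sub>2 w" "w \<noteq> a\<^sub>2"
    using card_arm_le_d[OF N(1) c(2)] large c(1) that by auto
qed

lemma light_net_heavy_degrees:
  assumes "light_net a\<^sub>1 b\<^sub>1 a\<^sub>2 b\<^sub>2 a\<^sub>3 b\<^sub>3" "heavy_arm a\<^sub>1 a\<^sub>2"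
  shows "n \<le> 2 * d a\<^sub>1 \<and> n \<le> 2 * d b\<^sub>1 \<and> d a\<^sub>2 = 3 \<and> d b\<^sub>2 = 2 \<and> d a\<^sub>3 = 3 \<and> d b\<^sub>3 = 2 \<and>
    (\<forall>w. F b\<^sub>2 w \<longrightarrow> w \<noteq> a\<^sub>2 \<longrightarrow> n \<le> 2 * d w) \<and> (\<forall>w. F b\<^sub>3 w \<longrightarrow> w \<noteq> a\<^sub>3 \<longrightarrow> n \<le> 2 * d w)"
  using heavy_arm_net_degrees[OF assms]
    heavy_arm_net_degrees[OF light_net_swap23[OF assms(1)] heavy_arm_light(1)[OF assms]] by blast

end

section \<open>The closure of a claw-o-heavy graph\<close>

text \<open>Connectivity as the absence of proper nonempty closed subsets; for the converse, the
  closed set is the one reachable from a given vertex.\<close>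

lemma connected_induce_iff:
  assumes sym: "\<And>u v. (u, v) \<in> parcs G \<Longrightarrow> (v, u) \<in> parcs G"
  shows "connected (with_proj G \<restriction> A) \<longleftrightarrow> A \<noteq> {} \<and>
    (\<forall>X \<subseteq> A. X \<noteq> {} \<longrightarrow> (\<forall>x \<in> X. \<forall>y \<in> A. (x, y) \<in> parcs G \<longrightarrow> y \<in> X) \<longrightarrow> X = A)"
proof -
  define R where "R = {(u, v). (u, v) \<in> parcs G \<and> u \<in> A \<and> v \<in> A}"
  have "(arcs_ends (with_proj G \<restriction> A))\<^sup>s = R"
    using sym unfolding R_def symcl_def arcs_ends_conv
    by (auto simp: induce_subgraph_def)
  then have conn: "connected (with_proj G \<restriction> A) \<longleftrightarrow>
      A \<noteq> {} \<and> (\<forall>u \<in> A. \<forall>v \<in> A. (u, v) \<in> rtrancl_on A R)"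
    by (simp add: connected_conv)
  show ?thesis
    unfolding conn
  proof (intro conj_cong refl iffI allI impI ballI)
    fix X
    assume R: "\<forall>u \<in> A. \<forall>v \<in> A. (u, v) \<in> rtrancl_on A R"
      and X: "X \<subseteq> A" "X \<noteq> {}" "\<forall>x \<in> X. \<forall>y \<in> A. (x, y) \<in> parcs G \<longrightarrow> y \<in> X"
    obtain x where "x \<in> X" using X by blast
    have "v \<in> X" if "v \<in> A" for v
    proof -
      have "(x, v) \<in> rtrancl_on A R" using R that \<open>x \<in> X\<close> X by blast
      then show ?thesis
        by (induction rule: rtrancl_on_induct) (use \<open>x \<in> X\<close> X in \<open>auto simp: R_def\<close>)
    qed
    then show "X = A" using X by blast
  next
    fix u v
    assume X: "\<forall>X \<subseteq> A. X \<noteq> {} \<longrightarrow> (\<forall>x \<in> X. \<forall>y \<in> A. (x, y) \<in> parcs G \<longrightarrow> y \<in> X) \<longrightarrow> X = A"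
      and uv: "u \<in> A" "v \<in> A"
    let ?X = "{v. (u, v) \<in> rtrancl_on A R}"
    have "?X \<subseteq> A" by (auto dest: in_rtrancl_on_in_F)
    moreover have "u \<in> ?X" using uv by simp
    moreover have "\<forall>x \<in> ?X. \<forall>y \<in> A. (x, y) \<in> parcs G \<longrightarrow> y \<in> ?X"
    proof (intro ballI impI)
      fix x y
      assume x: "x \<in> ?X" and y: "y \<in> A" "(x, y) \<in> parcs G"
      then have "(x, y) \<in> R" unfolding R_def by (auto dest: in_rtrancl_on_in_F)
      then show "y \<in> ?X" using x y by (auto intro: rtrancl_on_into_rtrancl_on)
    qed
    ultimately have "?X = A" using X by blast
    then show "(u, v) \<in> rtrancl_on A R" using uv by blast
  qed
qed

abbreviation adj :: "'a pair_pre_digraph \<Rightarrow> 'a \<Rightarrow> 'a \<Rightarrow> bool" where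
  "adj G u v \<equiv> (u, v) \<in> parcs G"

lemma pair_graph_adj:
  assumes "pair_graph G"
  shows "finite (pverts G)" "adj G u v \<Longrightarrow> adj G v u" "\<not> adj G u u"
    "adj G u v \<Longrightarrow> u \<in> pverts G" "adj G u v \<Longrightarrow> v \<in> pverts G"
proof -
  interpret pair_graph G by fact
  show "finite (pverts G)" "adj G u v \<Longrightarrow> adj G v u" "\<not> adj G u u"
    "adj G u v \<Longrightarrow> u \<in> pverts G" "adj G u v \<Longrightarrow> v \<in> pverts G"
    by (auto simp: pair_finite_verts arcs_symmetric dest: in_arcsD1 in_arcsD2 no_loops')
qed

lemma deg_eq_degr: "deg G = degr (adj G)"
  by (auto simp: deg_def degr_def nbhd_def)

lemma o_heavy_pair_eq: "o_heavy_pair G = heavy_nonedge (pverts G) (adj G)"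
  by (auto simp: o_heavy_pair_def heavy_nonedge_def deg_eq_degr fun_eq_iff)

lemma o_heavy_pair_sym: "pair_graph G \<Longrightarrow> o_heavy_pair G u v \<Longrightarrow> o_heavy_pair G v u"
  unfolding o_heavy_pair_def using pair_graph_adj(2) by (metis add.commute)

lemma finite_nbhd: "pair_graph G \<Longrightarrow> finite (nbhd G x)"
  using pair_graph_adj(1,5) by (metis finite_subset mem_Collect_eq nbhd_def subsetI)

lemma deg_mono:
  assumes "pair_graph H" "parcs G \<subseteq> parcs H"
  shows "deg G x \<le> deg H x"
  unfolding deg_def by (rule card_mono[OF finite_nbhd[OF assms(1)]]) (use assms(2) in \<open>auto simp: nbhd_def\<close>)

section \<open>Claw-o-heaviness under local completion\<close>

definition claw_heavy :: "'a pair_pre_digraph \<Rightarrow> bool" where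
  "claw_heavy G \<longleftrightarrow> (\<forall>x u v w. adj G x u \<longrightarrow> adj G x v \<longrightarrow> adj G x w \<longrightarrow>
     u \<noteq> v \<longrightarrow> u \<noteq> w \<longrightarrow> v \<noteq> w \<longrightarrow> adj G u v \<or> adj G u w \<or> adj G v w \<or>
     o_heavy_pair G u v \<or> o_heavy_pair G u w \<or> o_heavy_pair G v w)"

lemma claw_heavyD:
  assumes "claw_heavy G" "adj G x u" "adj G x v" "adj G x w" "u \<noteq> v" "u \<noteq> w" "v \<noteq> w"
    "\<not> adj G u v" "\<not> adj G u w" "\<not> adj G v w"
  shows "o_heavy_pair G u v \<or> o_heavy_pair G u w \<or> o_heavy_pair G v w"
  using assms unfolding claw_heavy_def by blast

lemma adj_local_completion:
  "adj (local_completion G x) u v \<longleftrightarrow> adj G u v \<or> adj G x u \<and> adj G x v \<and> u \<noteq> v"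
  by (auto simp: local_completion_def nbhd_def)

lemma pverts_local_completion [simp]: "pverts (local_completion G x) = pverts G"
  by (simp add: local_completion_def)

text \<open>If a claw with centre \<open>c\<close> uses an added edge \<open>c u\<close>, replacing
  \<open>u\<close> by \<open>x\<close> gives a claw of \<open>G\<close>. In its o-heavy pair
  \<open>u\<close> can stand for \<open>x\<close>, because the new degree of \<open>u\<close> is at
  least the old degree of \<open>x\<close>.\<close>

lemma claw_heavy_local_completion:
  assumes G: "pair_graph G" and claw: "claw_heavy G"
  shows "claw_heavy (local_completion G x)"
proof -
  let ?G = "local_completion G x"
  have G': "pair_graph ?G" by (rule pair_graph_local_completion[OF G])
  note S = pair_graph_adj[OF G] and S' = pair_graph_adj[OF G']
  have mono: "deg G u \<le> deg ?G u" for u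
    by (rule deg_mono[OF G']) (auto simp: local_completion_def)
  have lift: "o_heavy_pair ?G u v" if "o_heavy_pair G u v" "\<not> adj ?G u v" for u v
    using that mono[of u] mono[of v] unfolding o_heavy_pair_def by auto
  have new: "o_heavy_pair ?G u v \<or> o_heavy_pair ?G u w \<or> o_heavy_pair ?G v w"
    if a: "adj ?G c u" "\<not> adj G c u" "adj ?G c v" "adj ?G c w" "u \<noteq> v" "u \<noteq> w" "v \<noteq> w"
      "\<not> adj ?G u v" "\<not> adj ?G u w" "\<not> adj ?G v w" for c u v w
  proof -
    have xc: "adj G x c" "adj G x u" "c \<noteq> u" using a by (auto simp: adj_local_completion)
    have n: "\<not> adj G x v" "\<not> adj G x w" using a xc by (auto simp: adj_local_completion)
    have ne: "v \<noteq> x" "w \<noteq> x" using a xc S(2) by (auto simp: adj_local_completion)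
    have "adj G c v" "adj G c w" using a n by (auto simp: adj_local_completion)
    then have "o_heavy_pair G x v \<or> o_heavy_pair G x w \<or> o_heavy_pair G v w"
      using claw_heavyD[OF claw, of c x v w] S(2) xc n ne a by (auto simp: adj_local_completion)
    moreover have "o_heavy_pair ?G u y" if h: "o_heavy_pair G x y" and y: "\<not> adj ?G u y" "u \<noteq> y" for y
    proof -
      have "insert x (nbhd G x - {u}) \<subseteq> nbhd ?G u"
        using xc S(2,3) by (auto simp: nbhd_def adj_local_completion)
      then have "card (insert x (nbhd G x - {u})) \<le> deg ?G u"
        unfolding deg_def by (rule card_mono[OF finite_nbhd[OF G']])
      moreover have "card (insert x (nbhd G x - {u})) = deg G x"
        using xc S(3) finite_nbhd[OF G, of x] card_Suc_Diff1[of "nbhd G x" u]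
        unfolding deg_def by (simp add: nbhd_def)
      ultimately show ?thesis
        using h y mono[of y] S(5)[OF xc(2)] unfolding o_heavy_pair_def by auto
    qed
    ultimately show ?thesis using lift a by blast
  qed
  show ?thesis
    unfolding claw_heavy_def
  proof (intro allI impI, rule ccontr)
    fix c u v w
    assume a: "adj ?G c u" "adj ?G c v" "adj ?G c w" "u \<noteq> v" "u \<noteq> w" "v \<noteq> w"
      and n: "\<not> (adj ?G u v \<or> adj ?G u w \<or> adj ?G v w \<or>
         o_heavy_pair ?G u v \<or> o_heavy_pair ?G u w \<or> o_heavy_pair ?G v w)"
    have "adj G c u" using new[of c u v w] a n by blast
    moreover have "adj G c v"
      using new[of c v u w] a n S'(2) o_heavy_pair_sym[OF G'] by blast
    moreover have "adj G c w"
      using new[of c w u v] a n S'(2) o_heavy_pair_sym[OF G'] by blast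
    ultimately show False
      using claw_heavyD[OF claw, of c u v w] a n lift by (auto simp: adj_local_completion)
  qed
qed

section \<open>Graphs without eligible vertices\<close>

text \<open>As the neighbourhood is disconnected in \<open>bc_graph\<close>, it splits into a closed
  set and its complement. Two vertices nonadjacent on one side, with one from the other, would
  violate claw-o-heaviness. The last clause is the failure of the second alternative of
  eligibility.\<close>

lemma c_ineligible_split:
  assumes H: "pair_graph H" and claw: "claw_heavy H" and x: "x \<in> pverts H"
    and inel: "\<not> c_eligible H x" and ncl: "\<not> clique H (nbhd H x)"
  obtains C\<^sub>1 C\<^sub>2 where "disjoint_union_of_cliques (bc_graph H x) (nbhd H x) C\<^sub>1 C\<^sub>2" "C\<^sub>1 \<noteq> {}" "C\<^sub>2 \<noteq> {}"
    "\<And>z y\<^sub>1 y\<^sub>2. o_heavy_pair H x z \<Longrightarrow> y\<^sub>1 \<in> C\<^sub>1 \<Longrightarrow> y\<^sub>2 \<in> C\<^sub>2 \<Longrightarrow> adj H z y\<^sub>1 \<Longrightarrow> adj H z y\<^sub>2 \<Longrightarrow> False"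
proof -
  note S = pair_graph_adj[OF H]
  let ?B = "bc_graph H x"
  have B: "adj ?B u v \<longleftrightarrow> adj H u v \<or> adj H x u \<and> adj H x v \<and> o_heavy_pair H u v" for u v
    by (auto simp: bc_graph_def nbhd_def)
  have B_sym: "adj ?B u v \<Longrightarrow> adj ?B v u" for u v
    unfolding B using S(2) o_heavy_pair_sym[OF H] by blast
  have nc: "\<not> connected (with_proj ?B \<restriction> nbhd H x)"
    using inel x ncl unfolding c_eligible_def by blast
  have ne: "nbhd H x \<noteq> {}" using ncl unfolding clique_def by auto
  obtain X where X: "X \<subseteq> nbhd H x" "X \<noteq> {}" "X \<noteq> nbhd H x"
    and closed: "\<And>a b. a \<in> X \<Longrightarrow> b \<in> nbhd H x \<Longrightarrow> adj ?B a b \<Longrightarrow> b \<in> X"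
  proof -
    let ?closed = "\<lambda>X. \<forall>a \<in> X. \<forall>b \<in> nbhd H x. adj ?B a b \<longrightarrow> b \<in> X"
    have "\<not> (\<forall>X \<subseteq> nbhd H x. X \<noteq> {} \<longrightarrow> ?closed X \<longrightarrow> X = nbhd H x)"
      using nc ne connected_induce_iff[of ?B "nbhd H x"] B_sym by meson
    then obtain X where X: "X \<subseteq> nbhd H x" "X \<noteq> {}" "?closed X" "X \<noteq> nbhd H x" by meson
    show thesis by (rule that[OF X(1,2,4)]) (use X(3) in blast)
  qed
  let ?Y = "nbhd H x - X"
  have sep: "\<not> adj ?B u v" if "u \<in> X" "v \<in> ?Y" for u v
    using closed that by blast
  have cl: "clique ?B C" if C: "C = X \<and> D = ?Y \<or> C = ?Y \<and> D = X" for C D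
    unfolding clique_def
  proof (intro conjI ballI impI)
    show "C \<subseteq> pverts ?B"
      using C X(1) S(5) by (auto simp: bc_graph_def nbhd_def)
    fix u v assume uv: "u \<in> C" "v \<in> C" "u \<noteq> v"
    obtain w where w: "w \<in> D" using C X by blast
    have adj: "adj H x u" "adj H x v" "adj H x w" using uv w C X(1) by (auto simp: nbhd_def)
    have ne: "u \<noteq> w" "v \<noteq> w" using uv w C by auto
    have non: "\<not> adj ?B u w" "\<not> adj ?B v w"
      using sep B_sym uv w C by blast+
    show "adj ?B u v"
    proof (rule ccontr)
      assume "\<not> adj ?B u v"
      then show False
        using claw_heavyD[OF claw adj uv(3) ne] adj non unfolding B by blast
    qed
  qed
  have "disjoint_union_of_cliques ?B (nbhd H x) X ?Y"
    unfolding disjoint_union_of_cliques_def using X cl sep by blast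
  moreover have "?Y \<noteq> {}" using X by blast
  ultimately show thesis
    using that[of X ?Y] X inel x ncl unfolding c_eligible_def by blast
qed

text \<open>
  Every common neighbour \<open>c\<close> of an o-heavy pair \<open>u, v\<close> has a neighbour adjacent to neither \<open>u\<close> nor \<open>v\<close>.
  There are more common neighbours than common non-neighbours, so two of them, \<open>c\<close> and \<open>c'\<close>, share such a
  neighbour; this puts them into different cliques of the neighbourhood of \<open>u\<close>, and \<open>v\<close> is adjacent to
  both: \<open>u\<close> is eligible.
\<close>

lemma closed_no_o_heavy_pair:
  assumes H: "pair_graph H" and claw: "claw_heavy H" and inel: "\<And>x. \<not> c_eligible H x"
  shows "\<not> o_heavy_pair H u v"
proof
  assume h: "o_heavy_pair H u v"
  note S = pair_graph_adj[OF H]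
  have uv: "u \<in> pverts H" "v \<in> pverts H" "u \<noteq> v" "\<not> adj H u v" "\<not> adj H v u"
    "card (pverts H) \<le> deg H u + deg H v"
    using h S(2) unfolding o_heavy_pair_def by auto
  have bc_adj: "adj (bc_graph H x) a b \<longleftrightarrow>
      adj H a b \<or> adj H x a \<and> adj H x b \<and> o_heavy_pair H a b" for x a b
    by (auto simp: bc_graph_def nbhd_def)
  define A where "A = nbhd H u \<inter> nbhd H v"
  define D where "D = pverts H - {u, v} - (nbhd H u \<union> nbhd H v)"
  have fin: "finite (nbhd H u)" "finite (nbhd H v)" by (rule finite_nbhd[OF H])+
  have sub: "nbhd H u \<union> nbhd H v \<subseteq> pverts H - {u, v}"
    using S uv by (auto simp: nbhd_def)
  have "card (nbhd H u \<union> nbhd H v) + card D = card (pverts H - {u, v})"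
    using sub S(1) unfolding D_def
    by (metis card_Diff_subset card_mono finite_Diff finite_subset le_add_diff_inverse)
  also have "card (pverts H - {u, v}) < card (pverts H)"
    using uv S(1) by (intro psubset_card_mono) auto
  finally have "card D < card A"
    using card_Un_Int[OF fin] uv(6) unfolding A_def deg_def by linarith
  have "\<exists>w. w \<in> D \<and> adj H c w \<and> (\<exists>C\<^sub>1 C\<^sub>2. disjoint_union_of_cliques (bc_graph H c) (nbhd H c) C\<^sub>1 C\<^sub>2 \<and>
      u \<in> C\<^sub>1 \<and> w \<in> C\<^sub>2 \<and> (\<forall>z. o_heavy_pair H c z \<longrightarrow> adj H z u \<longrightarrow> adj H z w \<longrightarrow> False))" if "c \<in> A" for c
  proof -
    have c: "adj H u c" "adj H v c" "adj H c u" "adj H c v" "c \<in> pverts H"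
      using that S by (auto simp: A_def nbhd_def)
    have "\<not> clique H (nbhd H c)" using c uv by (auto simp: clique_def nbhd_def)
    then obtain C\<^sub>1 C\<^sub>2 where C: "disjoint_union_of_cliques (bc_graph H c) (nbhd H c) C\<^sub>1 C\<^sub>2" "C\<^sub>1 \<noteq> {}" "C\<^sub>2 \<noteq> {}"
      "\<And>z y\<^sub>1 y\<^sub>2. o_heavy_pair H c z \<Longrightarrow> y\<^sub>1 \<in> C\<^sub>1 \<Longrightarrow> y\<^sub>2 \<in> C\<^sub>2 \<Longrightarrow> adj H z y\<^sub>1 \<Longrightarrow> adj H z y\<^sub>2 \<Longrightarrow> False"
      using c_ineligible_split[OF H claw c(5) inel] by metis
    have sep: "\<not> adj (bc_graph H c) a b" "\<not> adj (bc_graph H c) b a" if "a \<in> C\<^sub>1" "b \<in> C\<^sub>2" for a b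
    proof -
      show 1: "\<not> adj (bc_graph H c) a b"
        using C(1) that unfolding disjoint_union_of_cliques_def by blast
      then show "\<not> adj (bc_graph H c) b a"
        unfolding bc_adj using S(2) o_heavy_pair_sym[OF H] by blast
    qed
    have N: "nbhd H c = C\<^sub>1 \<union> C\<^sub>2" "C\<^sub>1 \<inter> C\<^sub>2 = {}"
      using C(1) unfolding disjoint_union_of_cliques_def by auto
    have bc: "adj (bc_graph H c) u v" unfolding bc_adj using c h by blast
    have DU: "disjoint_union_of_cliques (bc_graph H c) (nbhd H c) C\<^sub>2 C\<^sub>1"
      using C(1) sep unfolding disjoint_union_of_cliques_def by blast
    have in_D: "w \<in> D \<and> adj H c w"
      if "w \<in> nbhd H c" "\<not> adj (bc_graph H c) u w" "\<not> adj (bc_graph H c) v w" "w \<noteq> u" "w \<noteq> v" for w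
      using that S(5) unfolding D_def bc_adj by (auto simp: nbhd_def)
    have wit: ?thesis if DU: "disjoint_union_of_cliques (bc_graph H c) (nbhd H c) C C'"
      and u: "u \<in> C" "v \<in> C" and w: "w \<in> C'"
      and no: "\<And>z. o_heavy_pair H c z \<Longrightarrow> adj H z u \<Longrightarrow> adj H z w \<Longrightarrow> False" for C C' w
    proof -
      have "w \<in> nbhd H c" "\<not> adj (bc_graph H c) u w" "\<not> adj (bc_graph H c) v w" "w \<noteq> u" "w \<noteq> v"
        using DU u w unfolding disjoint_union_of_cliques_def by blast+
      then have "w \<in> D \<and> adj H c w" by (rule in_D)
      then show ?thesis
        using DU u w no by (intro exI[of _ w] conjI exI[of _ C] exI[of _ C'] allI impI) simp_all
    qed
    \<comment> \<open>The o-heavy pair is an edge of \<open>bc_graph H c\<close>, so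
      \<open>u\<close> and \<open>v\<close> share a clique, and any vertex of the other one serves
      as \<open>w\<close>.\<close>
    have "u \<in> C\<^sub>1 \<union> C\<^sub>2" "v \<in> C\<^sub>1 \<union> C\<^sub>2"
      unfolding N(1)[symmetric] nbhd_def using c by simp_all
    then have "u \<in> C\<^sub>1 \<and> v \<in> C\<^sub>1 \<or> u \<in> C\<^sub>2 \<and> v \<in> C\<^sub>2"
      using bc sep by blast
    then show ?thesis
    proof
      assume u: "u \<in> C\<^sub>1 \<and> v \<in> C\<^sub>1"
      obtain w where "w \<in> C\<^sub>2" using C by blast
      then show ?thesis using u C(4) by (intro wit[OF C(1), of w]) blast+
    next
      assume u: "u \<in> C\<^sub>2 \<and> v \<in> C\<^sub>2"
      obtain w where "w \<in> C\<^sub>1" using C by blast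
      then show ?thesis using u C(4) by (intro wit[OF DU, of w]) blast+
    qed
  qed
  then obtain g where g: "\<And>c. c \<in> A \<Longrightarrow> g c \<in> D \<and> adj H c (g c) \<and>
      (\<exists>C\<^sub>1 C\<^sub>2. disjoint_union_of_cliques (bc_graph H c) (nbhd H c) C\<^sub>1 C\<^sub>2 \<and> u \<in> C\<^sub>1 \<and> g c \<in> C\<^sub>2 \<and>
        (\<forall>z. o_heavy_pair H c z \<longrightarrow> adj H z u \<longrightarrow> adj H z (g c) \<longrightarrow> False))"
    by metis
  have "finite D" using S(1) unfolding D_def by simp
  moreover have "g ` A \<subseteq> D" using g by blast
  ultimately have "\<not> inj_on g A"
    using \<open>card D < card A\<close> card_inj_on_le linorder_not_le by blast
  then obtain c c' where cc: "c \<in> A" "c' \<in> A" "c \<noteq> c'" "g c = g c'"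
    unfolding inj_on_def by blast
  have c: "adj H u c" "adj H v c" "adj H u c'" "adj H v c'" "adj H c u" "adj H c' u"
    "adj H c' (g c)" using cc g[of c'] S by (auto simp: A_def nbhd_def)
  obtain C\<^sub>1 C\<^sub>2 where C: "disjoint_union_of_cliques (bc_graph H c) (nbhd H c) C\<^sub>1 C\<^sub>2" "u \<in> C\<^sub>1" "g c \<in> C\<^sub>2"
    and no_z: "\<And>z. o_heavy_pair H c z \<Longrightarrow> adj H z u \<Longrightarrow> adj H z (g c) \<Longrightarrow> False"
    using g[OF cc(1)] by blast
  \<comment> \<open>\<open>c'\<close> is adjacent to \<open>u\<close> and \<open>g c\<close>, which
    lie in different cliques of the neighbourhood of \<open>c\<close>; so it is neither adjacent to
    \<open>c\<close> nor in an o-heavy pair with \<open>c\<close>.\<close>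
  have "\<not> adj H c c'"
  proof
    assume "adj H c c'"
    then have "c' \<in> nbhd H c" by (simp add: nbhd_def)
    then have "c' \<in> C\<^sub>1 \<union> C\<^sub>2" using C(1) unfolding disjoint_union_of_cliques_def by blast
    moreover have "adj (bc_graph H c) u c'" "adj (bc_graph H c) c' (g c)" unfolding bc_adj using c by auto
    ultimately show False using C unfolding disjoint_union_of_cliques_def by blast
  qed
  moreover have "\<not> o_heavy_pair H c c'" using no_z[of c'] c by blast
  ultimately have ncc: "\<not> adj (bc_graph H u) c c'" "\<not> adj (bc_graph H u) c' c"
    unfolding bc_adj using S(2) o_heavy_pair_sym[OF H] by blast+
  have "\<not> clique H (nbhd H u)"
    using c \<open>\<not> adj H c c'\<close> cc(3) by (auto simp: clique_def nbhd_def)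
  then obtain K\<^sub>1 K\<^sub>2 where K: "disjoint_union_of_cliques (bc_graph H u) (nbhd H u) K\<^sub>1 K\<^sub>2"
    "\<And>z y\<^sub>1 y\<^sub>2. o_heavy_pair H u z \<Longrightarrow> y\<^sub>1 \<in> K\<^sub>1 \<Longrightarrow> y\<^sub>2 \<in> K\<^sub>2 \<Longrightarrow> adj H z y\<^sub>1 \<Longrightarrow> adj H z y\<^sub>2 \<Longrightarrow> False"
    using c_ineligible_split[OF H claw uv(1) inel] by metis
  have "c \<in> nbhd H u" "c' \<in> nbhd H u" using c by (simp_all add: nbhd_def)
  then have "c \<in> K\<^sub>1 \<union> K\<^sub>2" "c' \<in> K\<^sub>1 \<union> K\<^sub>2"
    using K(1) unfolding disjoint_union_of_cliques_def by blast+
  moreover have "\<not> (c \<in> K\<^sub>1 \<and> c' \<in> K\<^sub>1)" "\<not> (c \<in> K\<^sub>2 \<and> c' \<in> K\<^sub>2)"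
    using K(1) ncc cc(3) unfolding disjoint_union_of_cliques_def clique_def by blast+
  ultimately show False using K(2)[OF h] c by blast
qed

text \<open>Without o-heavy pairs \<open>bc_graph H x\<close> has the same edges as
  \<open>H\<close>, so \<open>c_ineligible_split\<close> yields cliques of \<open>H\<close>.\<close>

lemma closed_neighbourhoods:
  assumes H: "pair_graph H" and claw: "claw_heavy H" and inel: "\<And>x. \<not> c_eligible H x"
    and x: "adj H x u" "adj H x v" "adj H x w" "u \<noteq> v" "u \<noteq> w" "v \<noteq> w"
  shows "adj H u v \<or> adj H u w \<or> adj H v w" "adj H u v \<Longrightarrow> adj H v w \<Longrightarrow> adj H u w"
proof -
  note S = pair_graph_adj[OF H]
  note no = closed_no_o_heavy_pair[OF H claw inel]
  show "adj H u v \<or> adj H u w \<or> adj H v w"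
    using claw_heavyD[OF claw x] no by blast
  assume a: "adj H u v" "adj H v w"
  show "adj H u w"
  proof (cases "clique H (nbhd H x)")
    case True
    then show ?thesis using x by (auto simp: clique_def nbhd_def)
  next
    case False
    have B: "adj (bc_graph H x) a b \<longleftrightarrow> adj H a b" for a b
      using no by (auto simp: bc_graph_def)
    obtain C\<^sub>1 C\<^sub>2 where "disjoint_union_of_cliques (bc_graph H x) (nbhd H x) C\<^sub>1 C\<^sub>2"
      using c_ineligible_split[OF H claw S(4)[OF x(1)] inel False] by metis
    then have C: "{u. adj H x u} = C\<^sub>1 \<union> C\<^sub>2" "\<And>a b. a \<in> C\<^sub>1 \<Longrightarrow> b \<in> C\<^sub>1 \<Longrightarrow> a \<noteq> b \<Longrightarrow> adj H a b"
      "\<And>a b. a \<in> C\<^sub>2 \<Longrightarrow> b \<in> C\<^sub>2 \<Longrightarrow> a \<noteq> b \<Longrightarrow> adj H a b"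
      "\<And>a b. a \<in> C\<^sub>1 \<Longrightarrow> b \<in> C\<^sub>2 \<Longrightarrow> \<not> adj H a b"
      unfolding disjoint_union_of_cliques_def clique_def B nbhd_def by blast+
    have "u \<in> C\<^sub>1 \<union> C\<^sub>2" "v \<in> C\<^sub>1 \<union> C\<^sub>2" "w \<in> C\<^sub>1 \<union> C\<^sub>2" using C(1) x by blast+
    then show ?thesis using C(2-4) a x(5) S(2) by blast
  qed
qed

section \<open>Sequences of local completions\<close>

lemma completion_steps:
  assumes "completion_step\<^sup>*\<^sup>* G H" "pair_graph G"
  shows "pair_graph H" "pverts H = pverts G" "parcs G \<subseteq> parcs H" "claw_heavy G \<Longrightarrow> claw_heavy H"
proof -
  have "pair_graph H \<and> pverts H = pverts G \<and> parcs G \<subseteq> parcs H \<and> (claw_heavy G \<longrightarrow> claw_heavy H)"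
    using assms(1)
  proof (induction rule: rtranclp_induct)
    case base
    then show ?case using assms(2) by simp
  next
    case (step K L)
    then show ?case
      using pair_graph_local_completion claw_heavy_local_completion
      by (auto simp: completion_step_def adj_local_completion)
  qed
  then show "pair_graph H" "pverts H = pverts G" "parcs G \<subseteq> parcs H" "claw_heavy G \<Longrightarrow> claw_heavy H"
    by auto
qed

text \<open>If a completion at \<open>y\<close> adds an edge at \<open>x\<close>, then
  \<open>y\<close> is adjacent to \<open>x\<close> and thus to all its other neighbours; the new
  neighbourhood of \<open>x\<close> lies in the completed clique around \<open>y\<close>.\<close>

lemma simplicial_completion_steps:
  assumes "completion_step\<^sup>*\<^sup>* G H" "pair_graph G" "simplicial (adj G) x"
  shows "simplicial (adj H) x"
  using assms
proof (induction rule: rtranclp_induct)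
  case (step K L)
  then obtain y where L: "L = local_completion K y" by (auto simp: completion_step_def)
  note S = pair_graph_adj[OF completion_steps(1)[OF step.hyps(1) step.prems(1)]]
  have "simplicial (adj K) x" using step by blast
  then show ?case
    unfolding simplicial_def L adj_local_completion using S(2) by blast
qed

text \<open>A vertex at which a completion took place stays simplicial, so it can be used to bypass the new edges.\<close>

lemma link_path_completion_steps:
  assumes "completion_step\<^sup>*\<^sup>* G K" "completion_step\<^sup>*\<^sup>* K H" "pair_graph G" "adj K u v"
  shows "(\<lambda>p q. adj G p q \<and> p \<in> link (adj H) u v \<and> q \<in> link (adj H) u v)\<^sup>*\<^sup>* u v"
  using assms
proof (induction arbitrary: u v rule: rtranclp_induct)
  case base
  then show ?case by (auto simp: link_def)
next
  case (step K L)
  have KH: "completion_step\<^sup>*\<^sup>* K H"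
    using step.hyps(2) step.prems(1) by (rule converse_rtranclp_into_rtranclp)
  have pK: "pair_graph K" using completion_steps(1)[OF step.hyps(1) step.prems(2)] .
  obtain x where L: "L = local_completion K x"
    using step.hyps(2) by (auto simp: completion_step_def)
  have pL: "pair_graph L" unfolding L by (rule pair_graph_local_completion[OF pK])
  show ?case
  proof (cases "adj K u v")
    case True
    then show ?thesis using step.IH[OF KH step.prems(2)] by blast
  next
    case False
    then have x: "adj K x u" "adj K x v" "adj K u x" "u \<noteq> v"
      using step.prems(3) pair_graph_adj(2)[OF pK] by (auto simp: L adj_local_completion)
    have "simplicial (adj L) x"
      using pair_graph_adj(3)[OF pK] by (auto simp: simplicial_def L adj_local_completion)
    then have sx: "simplicial (adj H) x"
      using simplicial_completion_steps[OF step.prems(1) pL] by blast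
    have pH: "pair_graph H" using completion_steps(1)[OF KH pK] .
    have KH_adj: "adj H a b" if "adj K a b" for a b using completion_steps(3)[OF KH pK] that by blast
    let ?P = "\<lambda>a b p q. adj G p q \<and> p \<in> link (adj H) a b \<and> q \<in> link (adj H) a b"
    \<comment> \<open>As \<open>x\<close> is simplicial in \<open>H\<close> and adjacent to
      \<open>u\<close> and \<open>v\<close>, any other neighbour of \<open>x\<close> is adjacent to
      or equal to each of them.\<close>
    have "link (adj H) u x \<subseteq> link (adj H) u v" "link (adj H) x v \<subseteq> link (adj H) u v"
      using sx KH_adj[OF x(1)] KH_adj[OF x(2)] pair_graph_adj(2)[OF pH] unfolding link_def simplicial_def
      by blast+
    then have le: "?P u x \<le> ?P u v" "?P x v \<le> ?P u v" by auto
    have paths: "(?P u x)\<^sup>*\<^sup>* u x" "(?P x v)\<^sup>*\<^sup>* x v"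
      using step.IH[OF KH step.prems(2)] x by blast+
    show ?thesis
      using predicate2D[OF rtranclp_mono[OF le(1)] paths(1)] predicate2D[OF rtranclp_mono[OF le(2)] paths(2)]
      by (rule rtranclp_trans)
  qed
qed

section \<open>Forbidden graphs\<close>

lemma o_heavy_graph_onD:
  assumes "o_heavy (graph_on k T) G" "length xs = k" "distinct xs" "set xs \<subseteq> pverts G"
    and "\<And>i j. i < k \<Longrightarrow> j < k \<Longrightarrow> adj G (xs ! i) (xs ! j) \<longleftrightarrow> (i, j) \<in> T \<union> T\<inverse>"
  shows "\<exists>u \<in> set xs. \<exists>v \<in> set xs. o_heavy_pair G u v"
proof -
  have im: "(!) xs ` pverts (graph_on k T) = set xs"
    using assms(2) by (auto simp: graph_on_def set_conv_nth)
  have "induced_embedding (graph_on k T) G ((!) xs)"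
    unfolding induced_embedding_def im using assms(2-5)
    by (auto simp: graph_on_def inj_on_def nth_eq_iff_index_eq)
  then show ?thesis
    using assms(1) im unfolding o_heavy_def by metis
qed

lemma less_numeral_cases:
  "i < (3::nat) \<longleftrightarrow> i = 0 \<or> i = 1 \<or> i = 2"
  "i < (4::nat) \<longleftrightarrow> i = 0 \<or> i = 1 \<or> i = 2 \<or> i = 3"
  "i < (5::nat) \<longleftrightarrow> i = 0 \<or> i = 1 \<or> i = 2 \<or> i = 3 \<or> i = 4"
  "i < (6::nat) \<longleftrightarrow> i = 0 \<or> i = 1 \<or> i = 2 \<or> i = 3 \<or> i = 4 \<or> i = 5"
  by linarith+

lemma claw_heavy_if_o_heavy:
  assumes G: "pair_graph G" and o: "o_heavy claw_graph G"
  shows "claw_heavy G"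
  unfolding claw_heavy_def
proof (intro allI impI, rule ccontr)
  note S = pair_graph_adj[OF G]
  fix x u v w
  assume a: "adj G x u" "adj G x v" "adj G x w" "u \<noteq> v" "u \<noteq> w" "v \<noteq> w"
    and n: "\<not> (adj G u v \<or> adj G u w \<or> adj G v w \<or>
         o_heavy_pair G u v \<or> o_heavy_pair G u w \<or> o_heavy_pair G v w)"
  have comm: "adj G a b \<longleftrightarrow> adj G b a" for a b using S(2) by blast
  have ne: "x \<noteq> u" "x \<noteq> v" "x \<noteq> w" using a S(3) by auto
  have "\<exists>a \<in> set [x, u, v, w]. \<exists>b \<in> set [x, u, v, w]. o_heavy_pair G a b"
  proof (rule o_heavy_graph_onD[OF o[unfolded claw_graph_def]])
    show "length [x, u, v, w] = 4" "distinct [x, u, v, w]" using a ne by auto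
    show "set [x, u, v, w] \<subseteq> pverts G" using a S(4,5) by auto
    show "adj G ([x, u, v, w] ! i) ([x, u, v, w] ! j) \<longleftrightarrow>
        (i, j) \<in> {(0, 1), (0, 2), (0, 3)} \<union> {(0, 1), (0, 2), (0, 3)}\<inverse>" if "i < 4" "j < 4" for i j
      using that a n S(3) comm[of u x] comm[of v x] comm[of w x] comm[of v u] comm[of w u] comm[of w v]
      unfolding less_numeral_cases by (elim disjE) simp_all
  qed
  then obtain p q where pq: "p \<in> {x, u, v, w}" "q \<in> {x, u, v, w}" "o_heavy_pair G p q" by auto
  have sym: "o_heavy_pair G b a \<Longrightarrow> o_heavy_pair G a b" for a b using o_heavy_pair_sym[OF G] .
  have "\<not> adj G p q" "\<not> adj G q p" "p \<noteq> q" using pq(3) S(2) unfolding o_heavy_pair_def by auto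
  then show False using pq a n sym by auto
qed

lemma o_heavy_wounded:
  assumes G: "pair_graph G" and o: "o_heavy wounded_graph G" and W: "is_wounded (adj G) a b c p q r"
  shows "\<exists>u \<in> {a, b, c, p, q, r}. \<exists>v \<in> {a, b, c, p, q, r}. o_heavy_pair G u v"
proof -
  note S = pair_graph_adj[OF G]
  note w = W[unfolded is_wounded_def]
  let ?xs = "[a, b, c, p, q, r]"
  let ?T = "{(0, 1), (1, 2), (0, 2), (0, 3), (1, 4), (4, 5)} :: (nat \<times> nat) set"
  have "\<exists>u \<in> set ?xs. \<exists>v \<in> set ?xs. o_heavy_pair G u v"
  proof (rule o_heavy_graph_onD[OF o[unfolded wounded_graph_def]])
    show "length ?xs = 6" by simp
    show "distinct ?xs" using w S(2,3) by auto
    show "set ?xs \<subseteq> pverts G" using w S(4,5) by auto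
    have flip: "adj G b a" "adj G c b" "adj G c a" "adj G p a" "adj G q b" "adj G r q"
      "\<not> adj G q a" "\<not> adj G r a" "\<not> adj G p b" "\<not> adj G r b" "\<not> adj G p c" "\<not> adj G q c"
      "\<not> adj G r c" "\<not> adj G q p" "\<not> adj G r p"
      using w S(2) by blast+
    show "adj G (?xs ! i) (?xs ! j) \<longleftrightarrow> (i, j) \<in> ?T \<union> ?T\<inverse>" if "i < 6" "j < 6" for i j
      using that w flip S(3) unfolding less_numeral_cases by (elim disjE) simp_all
  qed
  then show ?thesis by simp
qed

lemma o_heavy_net:
  assumes G: "pair_graph G" and o: "o_heavy net_graph G" and N: "is_net (adj G) x x' y y' z z'"
  shows "\<exists>u \<in> {x, x', y, y', z, z'}. \<exists>v \<in> {x, x', y, y', z, z'}. o_heavy_pair G u v"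
proof -
  note S = pair_graph_adj[OF G]
  note w = N[unfolded is_net_def]
  let ?xs = "[x, y, z, x', y', z']"
  let ?T = "{(0, 1), (1, 2), (0, 2), (0, 3), (1, 4), (2, 5)} :: (nat \<times> nat) set"
  have "\<exists>u \<in> set ?xs. \<exists>v \<in> set ?xs. o_heavy_pair G u v"
  proof (rule o_heavy_graph_onD[OF o[unfolded net_graph_def]])
    show "length ?xs = 6" by simp
    show "distinct ?xs" using w S(2,3) by auto
    show "set ?xs \<subseteq> pverts G" using w S(4,5) by auto
    have flip: "adj G y x" "adj G z x" "adj G z y" "adj G x' x" "adj G y' y" "adj G z' z"
      "\<not> adj G y' x" "\<not> adj G z' x" "\<not> adj G x' y" "\<not> adj G z' y" "\<not> adj G x' z" "\<not> adj G y' z"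
      "\<not> adj G y' x'" "\<not> adj G z' x'" "\<not> adj G z' y'"
      using w S(2) by blast+
    show "adj G (?xs ! i) (?xs ! j) \<longleftrightarrow> (i, j) \<in> ?T \<union> ?T\<inverse>" if "i < 6" "j < 6" for i j
      using that w flip S(3) unfolding less_numeral_cases by (elim disjE) simp_all
  qed
  then show ?thesis by auto
qed

text \<open>Every induced copy of \<open>T\<close> contains one of \<open>S\<close>, which supplies
  the o-heavy pair.\<close>

lemma o_heavy_supergraph:
  assumes "induced_embedding S T g" "o_heavy S G"
  shows "o_heavy T G"
  unfolding o_heavy_def
proof (intro allI impI)
  fix f assume f: "induced_embedding T G f"
  have "induced_embedding S G (f \<circ> g)"
    using f assms(1) unfolding induced_embedding_def
    by (auto simp: image_subset_iff inj_on_def)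
  then obtain u v where uv: "u \<in> (f \<circ> g) ` pverts S" "v \<in> (f \<circ> g) ` pverts S" "o_heavy_pair G u v"
    using assms(2) unfolding o_heavy_def by meson
  have sub: "(f \<circ> g) ` pverts S \<subseteq> f ` pverts T"
    using assms(1) unfolding induced_embedding_def by auto
  show "\<exists>u \<in> f ` pverts T. \<exists>v \<in> f ` pverts T. o_heavy_pair G u v"
    using uv(3) subsetD[OF sub uv(1)] subsetD[OF sub uv(2)] by (intro bexI[of _ u] bexI[of _ v])
qed

lemma induced_embedding_graph_on:
  assumes "length xs = k" "distinct xs" "set xs \<subseteq> {..<l}"
    and "\<And>i j. i < k \<Longrightarrow> j < k \<Longrightarrow> (xs ! i, xs ! j) \<in> T \<union> T\<inverse> \<longleftrightarrow> (i, j) \<in> S \<union> S\<inverse>"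
  shows "induced_embedding (graph_on k S) (graph_on l T) ((!) xs)"
proof -
  have "(!) xs ` {..<k} = set xs"
    using assms(1) by (auto simp: set_conv_nth)
  then show ?thesis
    unfolding induced_embedding_def using assms
    by (auto simp: graph_on_def inj_on_def nth_eq_iff_index_eq)
qed

lemma small_graphs:
  "path_graph 4 = graph_on 4 {(0, 1), (1, 2), (2, 3)}"
  "path_graph 5 = graph_on 5 {(0, 1), (1, 2), (2, 3), (3, 4)}"
  "cycle_graph 3 = graph_on 3 {(2, 0), (0, 1), (1, 2)}"
  "Z_graph 1 = graph_on 4 {(0, 1), (1, 2), (0, 2), (2, 3)}"
  "Z_graph 2 = graph_on 5 {(0, 1), (1, 2), (0, 2), (2, 3), (3, 4)}"
proof -
  have p: "{(i, Suc i) | i. Suc i < 3} = {(0, 1), (1, 2)}"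
    "{(i, Suc i) | i. Suc i < 4} = {(0, 1), (1, 2), (2, 3)}"
    "{(i, Suc i) | i. Suc i < 5} = {(0, 1), (1, 2), (2, 3), (3, 4)}"
    by (auto simp: less_Suc_eq numeral_eq_Suc)
  have z: "{(i, Suc i) | i. 2 \<le> i \<and> i < 3} = {(2, 3)}" "{(i, Suc i) | i. 2 \<le> i \<and> i < 4} = {(2, 3), (3, 4)}"
    by (auto simp: less_Suc_eq numeral_eq_Suc)
  show "path_graph 4 = graph_on 4 {(0, 1), (1, 2), (2, 3)}"
    "path_graph 5 = graph_on 5 {(0, 1), (1, 2), (2, 3), (3, 4)}"
    "cycle_graph 3 = graph_on 3 {(2, 0), (0, 1), (1, 2)}"
    unfolding path_graph_def cycle_graph_def p by simp_all
  have "(1::nat) + 3 = 4" "(1::nat) + 2 = 3" "(2::nat) + 3 = 5" "(2::nat) + 2 = 4" by simp_all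
  then show "Z_graph 1 = graph_on 4 {(0, 1), (1, 2), (0, 2), (2, 3)}"
    "Z_graph 2 = graph_on 5 {(0, 1), (1, 2), (0, 2), (2, 3), (3, 4)}"
    unfolding Z_graph_def by (simp_all only: z Un_insert_left Un_empty_left)
qed

text \<open>The lists in the proof give the images of the vertices \<open>0, 1, ...\<close>; the net
  and the wounded graph embed in themselves.\<close>

lemma forbidden_graph_cases:
  assumes "S \<in> {path_graph 4, path_graph 5, cycle_graph 3, Z_graph 1, Z_graph 2,
              bull_graph, net_graph, wounded_graph}"
  obtains g where "induced_embedding S net_graph g" | g where "induced_embedding S wounded_graph g"
proof -
  have 1: "induced_embedding (path_graph 4) net_graph ((!) [3, 0, 1, 4])"
    unfolding small_graphs bull_graph_def net_graph_def
    by (rule induced_embedding_graph_on, simp, simp, simp, unfold less_numeral_cases, elim disjE) simp_all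
  have 2: "induced_embedding (cycle_graph 3) net_graph ((!) [0, 1, 2])"
    unfolding small_graphs bull_graph_def net_graph_def
    by (rule induced_embedding_graph_on, simp, simp, simp, unfold less_numeral_cases, elim disjE) simp_all
  have 3: "induced_embedding (Z_graph 1) net_graph ((!) [0, 1, 2, 5])"
    unfolding small_graphs bull_graph_def net_graph_def
    by (rule induced_embedding_graph_on, simp, simp, simp, unfold less_numeral_cases, elim disjE) simp_all
  have 4: "induced_embedding bull_graph net_graph ((!) [0, 1, 2, 3, 4])"
    unfolding small_graphs bull_graph_def net_graph_def
    by (rule induced_embedding_graph_on, simp, simp, simp, unfold less_numeral_cases, elim disjE) simp_all
  have 5: "induced_embedding (path_graph 5) wounded_graph ((!) [3, 0, 1, 4, 5])"
    unfolding small_graphs bull_graph_def wounded_graph_def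
    by (rule induced_embedding_graph_on, simp, simp, simp, unfold less_numeral_cases, elim disjE) simp_all
  have 6: "induced_embedding (Z_graph 2) wounded_graph ((!) [0, 2, 1, 4, 5])"
    unfolding small_graphs bull_graph_def wounded_graph_def
    by (rule induced_embedding_graph_on, simp, simp, simp, unfold less_numeral_cases, elim disjE) simp_all
  have id: "induced_embedding T T id" for T :: "nat pair_pre_digraph"
    by (simp add: induced_embedding_def)
  show thesis
    using assms that(1)[of "(!) [3, 0, 1, 4]"] that(1)[of "(!) [0, 1, 2]"] that(1)[of "(!) [0, 1, 2, 5]"]
      that(1)[of "(!) [0, 1, 2, 3, 4]"] that(2)[of "(!) [3, 0, 1, 4, 5]"] that(2)[of "(!) [0, 2, 1, 4, 5]"]
      that(1)[of id] that(2)[of id]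
    by (elim insertE emptyE) (simp_all only: 1 2 3 4 5 6 id)
qed

text \<open>Completions keep the vertex set, so o-heaviness in \<open>G\<close> and in
  \<open>H\<close> refers to the same \<open>n\<close>.\<close>

lemma heavy_closure_c_closure:
  assumes G: "pair_graph G" and conn: "two_connected G" and claw: "claw_heavy G" and cl: "is_c_closure G H"
  shows "heavy_closure (pverts H) (adj G) (adj H)"
proof
  have steps: "completion_step\<^sup>*\<^sup>* G H" and inel: "\<And>x. \<not> c_eligible H x"
    using cl unfolding is_c_closure_def by auto
  note C = completion_steps[OF steps G]
  note clawH = C(4)[OF claw]
  note S = pair_graph_adj[OF G] and SH = pair_graph_adj[OF C(1)]
  show "finite (pverts H)" using SH(1) .
  show "adj G u v \<Longrightarrow> adj H u v" for u v using C(3) by blast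
  show "adj G u v \<Longrightarrow> adj G v u" for u v by (rule S(2))
  show "adj H u v \<Longrightarrow> adj H v u" for u v by (rule SH(2))
  show "\<not> adj H u u" for u by (rule SH(3))
  show "adj H u v \<Longrightarrow> u \<in> pverts H" for u v by (rule SH(4))
  show "adj H u w" if "adj H x u" "adj H x v" "adj H x w" "adj H u v" "adj H v w" "u \<noteq> w" for x u v w
    using closed_neighbourhoods(2)[OF C(1) clawH inel that(1-3)] that SH(3) by blast
  show "adj H u v \<or> adj H u w \<or> adj H v w"
    if "adj H x u" "adj H x v" "adj H x w" "u \<noteq> v" "u \<noteq> w" "v \<noteq> w" for x u v w
    using closed_neighbourhoods(1)[OF C(1) clawH inel that] .
  show "\<not> heavy_nonedge (pverts H) (adj H) u v" for u v
    using closed_no_o_heavy_pair[OF C(1) clawH inel] unfolding o_heavy_pair_eq .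
  show "adj G u v \<or> adj G u w \<or> adj G v w \<or> heavy_nonedge (pverts H) (adj G) u v \<or>
      heavy_nonedge (pverts H) (adj G) u w \<or> heavy_nonedge (pverts H) (adj G) v w"
    if "adj G x u" "adj G x v" "adj G x w" "u \<noteq> v" "u \<noteq> w" "v \<noteq> w" for x u v w
    using claw that unfolding claw_heavy_def o_heavy_pair_eq C(2) by blast
  show "(\<lambda>p q. adj G p q \<and> p \<in> link (adj H) u v \<and> q \<in> link (adj H) u v)\<^sup>*\<^sup>* u v" if "adj H u v" for u v
    using link_path_completion_steps[OF steps rtranclp.rtrancl_refl G that] .
  show "X = pverts H - {v}"
    if v: "v \<in> pverts H" and X: "X \<subseteq> pverts H - {v}" "X \<noteq> {}"
      and closed: "\<And>x y. x \<in> X \<Longrightarrow> adj G x y \<Longrightarrow> y \<noteq> v \<Longrightarrow> y \<in> X" for v X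
  proof -
    have "connected (with_proj G \<restriction> (pverts G - {v}))"
      using conn v unfolding two_connected_def C(2) by blast
    then have "\<forall>X \<subseteq> pverts G - {v}. X \<noteq> {} \<longrightarrow>
        (\<forall>x \<in> X. \<forall>y \<in> pverts G - {v}. adj G x y \<longrightarrow> y \<in> X) \<longrightarrow> X = pverts G - {v}"
      using connected_induce_iff[of G, OF S(2)] by blast
    moreover have "\<forall>x \<in> X. \<forall>y \<in> pverts G - {v}. adj G x y \<longrightarrow> y \<in> X" using closed by blast
    ultimately show ?thesis using X unfolding C(2) by blast
  qed
qed

lemma induced_free_claw:
  assumes "\<And>x u v w. adj H x u \<Longrightarrow> adj H x v \<Longrightarrow> adj H x w \<Longrightarrow> u \<noteq> v \<Longrightarrow> u \<noteq> w \<Longrightarrow> v \<noteq> w \<Longrightarrow>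
      adj H u v \<or> adj H u w \<or> adj H v w"
  shows "induced_free claw_graph H"
  unfolding induced_free_def
proof
  assume "\<exists>f. induced_embedding claw_graph H f"
  then obtain f where f: "induced_embedding claw_graph H f" by blast
  let ?T = "{(0, 1), (0, 2), (0, 3)} :: (nat \<times> nat) set"
  have *: "adj H (f i) (f j) \<longleftrightarrow> (i, j) \<in> ?T \<union> ?T\<inverse>" if "i < 4" "j < 4" for i j
    using f that unfolding induced_embedding_def claw_graph_def graph_on_def by simp
  have inj: "inj_on f {..<4}"
    using f unfolding induced_embedding_def claw_graph_def graph_on_def by simp
  have "f 1 \<noteq> f 2" "f 1 \<noteq> f 3" "f 2 \<noteq> f 3"
    using inj_onD[OF inj, of 1 2] inj_onD[OF inj, of 1 3] inj_onD[OF inj, of 2 3] by auto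
  then show False
    using assms[of "f 0" "f 1" "f 2" "f 3"] *[of 0 1] *[of 0 2] *[of 0 3] *[of 1 2] *[of 1 3] *[of 2 3]
    by simp
qed

lemma is_net_induced_embedding:
  assumes "induced_embedding net_graph H f"
  shows "is_net (adj H) (f 0) (f 3) (f 1) (f 4) (f 2) (f 5)"
proof -
  let ?T = "{(0, 1), (1, 2), (0, 2), (0, 3), (1, 4), (2, 5)} :: (nat \<times> nat) set"
  have *: "adj H (f i) (f j) \<longleftrightarrow> (i, j) \<in> ?T \<union> ?T\<inverse>" if "i < 6" "j < 6" for i j
    using assms that unfolding induced_embedding_def net_graph_def graph_on_def by simp
  show ?thesis
    unfolding is_net_def by (simp add: *)
qed

theorem theorem13:
  fixes G H :: "'a pair_pre_digraph" and S :: "nat pair_pre_digraph"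
  assumes "pair_graph G"
    and "two_connected G"
    and "S \<in> {path_graph 4, path_graph 5, cycle_graph 3, Z_graph 1, Z_graph 2,
              bull_graph, net_graph, wounded_graph}"
    and "family_o_heavy {claw_graph, S} G"
    and "is_c_closure G H"
  shows "induced_free claw_graph H \<and> N_pq_heavy H"
proof -
  have claw: "claw_heavy G" and S: "o_heavy S G"
    using claw_heavy_if_o_heavy[OF assms(1)] assms(4) unfolding family_o_heavy_def by auto
  interpret heavy_closure "pverts H" "adj G" "adj H"
    by (rule heavy_closure_c_closure[OF assms(1,2) claw assms(5)])
  have H: "pair_graph H" and verts: "pverts H = pverts G"
    using completion_steps[OF _ assms(1)] assms(5) unfolding is_c_closure_def by blast+
  have "induced_free claw_graph H"
    by (rule induced_free_claw[OF F_claw])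
  moreover have "N_pq_heavy H"
    unfolding N_pq_heavy_def
  proof (intro allI impI)
    fix f :: "nat \<Rightarrow> 'a"
    assume "induced_embedding net_graph H f"
    then have net: "is_net (adj H) (f 0) (f 3) (f 1) (f 4) (f 2) (f 5)"
      by (rule is_net_induced_embedding)
    show "p_heavy_net H f \<or> q_heavy_net H f"
    proof (rule disjCI)
      assume not_q: "\<not> q_heavy_net H f"
      show "p_heavy_net H f"
      proof (rule ccontr)
        assume not_p: "\<not> p_heavy_net H f"
        have "deg H (f i) + deg H (f j) < card (pverts H)" if "adj H (f i) (f j)" "i < 3" "j < 3" for i j
          using not_p that unfolding p_heavy_net_def a_heavy_pair_def by (meson linorder_not_le)
        then have light: "light_net (f 0) (f 3) (f 1) (f 4) (f 2) (f 5)"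
          using net unfolding light_net_def is_net_def deg_eq_degr by simp
        consider "o_heavy net_graph G" | "o_heavy wounded_graph G"
          by (rule forbidden_graph_cases[OF assms(3)]) (use o_heavy_supergraph[OF _ S] in blast)+
        then show False
        proof cases
          case 1
          show False
          \<comment> \<open>The net of \<open>G\<close> obtained here lies in a set without o-heavy
            pairs.\<close>
          proof (rule light_net_E_net[OF light])
            fix Q x x' y y' z z'
            assume Q: "\<And>u v. u \<in> Q \<Longrightarrow> v \<in> Q \<Longrightarrow> \<not> heavy_nonedge (pverts H) (adj G) u v"
              and sub: "{x, x', y, y', z, z'} \<subseteq> Q" and N: "is_net (adj G) x x' y y' z z'"
            obtain u v where uv: "u \<in> {x, x', y, y', z, z'}" "v \<in> {x, x', y, y', z, z'}" "o_heavy_pair G u v"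
              using o_heavy_net[OF assms(1) 1 N] by (elim bexE)
            show False
              using Q[OF subsetD[OF sub uv(1)] subsetD[OF sub uv(2)]] uv(3) by (simp add: o_heavy_pair_eq verts)
          qed
        next
          case 2
          interpret wounded_heavy_closure "pverts H" "adj G" "adj H"
            by unfold_locales (rule o_heavy_wounded[OF assms(1) 2, unfolded o_heavy_pair_eq, folded verts])
          \<comment> \<open>The heavy arm may sit at any triangle vertex, hence the free
            indices.\<close>
          have q: "q_heavy_net H f"
            if "light_net (f i) (f (i + 3)) (f j) (f (j + 3)) (f k) (f (k + 3))" "heavy_arm (f i) (f j)"
              "i < 3" "\<And>l. l < 3 \<Longrightarrow> l \<noteq> i \<Longrightarrow> l = j \<or> l = k" for i j k
          proof -
            have heavyI: "heavy H v" if "card (pverts H) \<le> 2 * deg H v" "v \<in> pverts H" for v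
              using that unfolding heavy_def by linarith
            note L = light_net_heavy_degrees[OF that(1,2), folded deg_eq_degr] and N = light_netD[OF that(1)]
            show ?thesis
              unfolding q_heavy_net_def
            proof (intro exI[of _ i] conjI allI impI ballI)
              show "i < 3" by fact
              show "heavy H (f i)" "heavy H (f (i + 3))" using L N F_V by (auto intro: heavyI)
              fix l :: nat
              assume "l < 3" "l \<noteq> i"
              then have l: "l = j \<or> l = k" by (rule that(4))
              then show "deg H (f l) = 3" "deg H (f (l + 3)) = 2" using L by auto
              fix w
              assume "w \<in> nbhd H (f (l + 3)) - {f l}"
              then have w: "adj H (f (l + 3)) w" "w \<noteq> f l" by (auto simp: nbhd_def)
              then have "card (pverts H) \<le> 2 * deg H w" using L l by blast
              then show "heavy H w" using F_V2[OF w(1)] by (rule heavyI)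
            qed
          qed
          have eq: "(0::nat) + 3 = 3" "(1::nat) + 3 = 4" "(2::nat) + 3 = 5" by simp_all
          have "q_heavy_net H f" if "heavy_arm (f 0) (f 1)"
            by (rule q[of 0 1 2, unfolded eq, OF light that]) auto
          moreover have "q_heavy_net H f" if "heavy_arm (f 1) (f 0)"
            by (rule q[of 1 0 2, unfolded eq, OF light_net_swap12[OF light] that]) auto
          moreover have "q_heavy_net H f" if "heavy_arm (f 2) (f 0)"
            by (rule q[of 2 0 1, unfolded eq, OF light_net_swap12[OF light_net_swap23[OF light]] that]) auto
          ultimately show False using some_heavy_arm[OF light] not_q by blast
        qed
      qed
    qed
  qed
  ultimately show ?thesis by blast
qed

end
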